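(* Let $k\ge 2$, let $n_1,\dots,n_k,d_1,\dots,d_k$ be positive integers and let $r\ge 1$ be an integer. Set $Y=\mathbb{P}^{n_1}\times\cdots\times\mathbb{P}^{n_k}$, let $X=\nu(Y)$ be the Segre-Veronese variety embedded by $\mathcal{O}_Y(d_1,\dots,d_k)$, and let $t=\min\{d_1,\dots,d_k\}$. Then $$\mathcal{E}_r(X)\text{ and }\tilde{\mathcal{E}}_r(X)\text{ are nonempty if and only if } r\ge t+1$$ (that is, both are nonempty if $r\ge t+1$, and both are empty if $r\le t$).
   Context: The base field is $\mathbb{C}$. $\nu:Y\to\mathbb{P}^N$, $N=\prod_{i}\binom{n_i+d_i}{d_i}-1$, is the embedding given by the complete linear system $|\mathcal{O}_Y(d_1,\dots,d_k)|$ (the case of all $d_i=1$, i.e. Segre varieties, is included). For an integral nondegenerate variety $X\subset\mathbb{P}^N$, $X_{\mathrm{sm}}$ is its smooth locus and $\mathcal{S}_r(X)$ is the set of (unordered) sets of $r$ distinct smooth points of $X$. For a finite $A\subset X_{\mathrm{sm}}$, $2A$ is the zero-dimensional scheme with ideal sheaf $(\mathcal{I}_{A,X})^2$, and $\langle 2A\rangle\subseteq\mathbb{P}^N$ is its linear span, i.e. the span of the union of the tangent spaces $T_pX$, $p\in A$. The $r$-th strong base locus of $X$ is $$\mathcal{E}_r(X)=\{A\in\mathcal{S}_r(X)\mid \langle 2A\rangle\neq\mathbb{P}^N\text{ and }\langle 2(A\cup\{q\})\rangle=\langle 2A\rangle\text{ for some }q\in X_{\mathrm{sm}}\setminus A\}.$$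 The tangential contact locus of $A$ is $C(A)=\mathrm{Sing}(\langle 2A\rangle\cap X_{\mathrm{sm}})$, meaning the set of $x\in X_{\mathrm{sm}}$ with $T_xX\subseteq\langle 2A\rangle$, and $$\tilde{\mathcal{E}}_r(X)=\{A\in\mathcal{S}_r(X)\mid \langle 2A\rangle\neq\mathbb{P}^N\text{ and }\dim C(A)>0\}.$$
   Formalization: The nonemptiness claim for r ≥ t+1 excludes k=2, n=(1,1), d=(1,1), the quadric surface in P^3: there two distinct tangent planes already span P^3, so both loci are empty for all r ≥ 2 and the claim is false. The emptiness claim for r ≤ t includes this case. *)

theory Defs
  imports
    "HOL-Analysis.Analysis"
    "HOL-Library.Function_Algebras"
    "HOL-Library.Poly_Mapping"
    "HOL-Library.Extended_Nat"
begin

section \<open>Projective spaces over the complex numbers\<close>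

text \<open>
  For a finite set \<open>I\<close> of coordinate labels, the vector space of functions \<open>'i \<Rightarrow> complex\<close> supported
  on \<open>I\<close> plays the role of the coordinate space of dimension \<open>card I\<close>, and \<open>proj_space I\<close> is its
  projectivization: a point is the class of all its homogeneous coordinate vectors.
\<close>

definition cscale :: "complex \<Rightarrow> ('i \<Rightarrow> complex) \<Rightarrow> 'i \<Rightarrow> complex" where
  "cscale c v = (\<lambda>i. c * v i)"

interpretation cfun: vector_space "cscale :: complex \<Rightarrow> ('i \<Rightarrow> complex) \<Rightarrow> 'i \<Rightarrow> complex"
  by unfold_locales (simp_all add: cscale_def fun_eq_iff algebra_simps)

definition coord_space :: "'i set \<Rightarrow> ('i \<Rightarrow> complex) set" where
  "coord_space I = {v. \<forall>i. i \<notin> I \<longrightarrow> v i = 0}"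

definition proj_point :: "('i \<Rightarrow> complex) \<Rightarrow> ('i \<Rightarrow> complex) set" where
  "proj_point v = {cscale c v | c. c \<noteq> 0}"

definition proj_space :: "'i set \<Rightarrow> ('i \<Rightarrow> complex) set set" where
  "proj_space I = {proj_point v | v. v \<in> coord_space I \<and> v \<noteq> 0}"


section \<open>Homogeneous polynomials and the Zariski topology\<close>

type_synonym 'i mpoly = "('i \<Rightarrow>\<^sub>0 nat) \<Rightarrow>\<^sub>0 complex"

definition mpoly_eval :: "'i mpoly \<Rightarrow> ('i \<Rightarrow> complex) \<Rightarrow> complex" where
  "mpoly_eval F x =
    (\<Sum>m\<in>Poly_Mapping.keys F. Poly_Mapping.lookup F m *
      (\<Prod>i\<in>Poly_Mapping.keys m. x i ^ Poly_Mapping.lookup m i))"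

definition homogeneous :: "'i mpoly \<Rightarrow> bool" where
  "homogeneous F \<longleftrightarrow>
    (\<exists>e. \<forall>m\<in>Poly_Mapping.keys F. (\<Sum>i\<in>Poly_Mapping.keys m. Poly_Mapping.lookup m i) = e)"

definition vanishes_at :: "'i mpoly \<Rightarrow> ('i \<Rightarrow> complex) set \<Rightarrow> bool" where
  "vanishes_at F p \<longleftrightarrow> (\<forall>x\<in>p. mpoly_eval F x = 0)"

text \<open>
  Polynomials may use labels outside \<open>I\<close>; these coordinates are zero on \<open>proj_space I\<close>, so
  they do not affect the closed sets of \<open>proj_space I\<close>. \<open>zariski_closed_in S\<close> is closedness in
  the topology induced on \<open>S\<close>.
\<close>

definition zariski_closed_in :: "('i \<Rightarrow> complex) set set \<Rightarrow> ('i \<Rightarrow> complex) set set \<Rightarrow> bool" where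
  "zariski_closed_in S Z \<longleftrightarrow>
    (\<exists>\<F>. (\<forall>F\<in>\<F>. homogeneous F) \<and> Z = {p\<in>S. \<forall>F\<in>\<F>. vanishes_at F p})"

definition zariski_irreducible :: "('i \<Rightarrow> complex) set set \<Rightarrow> bool" where
  "zariski_irreducible Z \<longleftrightarrow> Z \<noteq> {} \<and>
    (\<forall>Z1 Z2. zariski_closed_in Z Z1 \<and> zariski_closed_in Z Z2 \<and> Z = Z1 \<union> Z2 \<longrightarrow> Z = Z1 \<or> Z = Z2)"

text \<open>
  The dimension is the combinatorial (Krull) dimension of the induced topology, i.e. the supremum of
  the lengths of chains of irreducible closed subsets. By this formula the empty set has dimension
  \<open>0\<close>, so \<open>zariski_dim S > 0\<close> implies that \<open>S\<close> is nonempty.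
\<close>

definition zariski_dim :: "('i \<Rightarrow> complex) set set \<Rightarrow> enat" where
  "zariski_dim S = Sup {enat l | l. \<exists>Z :: nat \<Rightarrow> ('i \<Rightarrow> complex) set set.
     (\<forall>j\<le>l. zariski_closed_in S (Z j) \<and> zariski_irreducible (Z j)) \<and>
     (\<forall>j<l. Z j \<subset> Z (Suc j))}"


section \<open>Tangent spaces and contact loci\<close>

text \<open>
  Here \<open>X\<close> is a projective variety in \<open>proj_space I\<close>. Linear subspaces of \<open>proj_space I\<close> are
  represented by the corresponding vector subspaces of \<open>coord_space I\<close>; the projective
  dimension is one less than the vector space dimension. In particular \<open>tangent_space I X p\<close> is the cone over
  the embedded tangent space of \<open>X\<close> at \<open>p\<close>.
\<close>

definition partial_deriv :: "'i \<Rightarrow> 'i mpoly \<Rightarrow> ('i \<Rightarrow> complex) \<Rightarrow> complex" where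
  "partial_deriv i F x = deriv (\<lambda>z. mpoly_eval F (x(i := z))) (x i)"

definition tangent_space ::
    "'i set \<Rightarrow> ('i \<Rightarrow> complex) set set \<Rightarrow> ('i \<Rightarrow> complex) set \<Rightarrow> ('i \<Rightarrow> complex) set" where
  "tangent_space I X p = {v \<in> coord_space I.
     \<forall>F. homogeneous F \<and> (\<forall>q\<in>X. vanishes_at F q) \<longrightarrow>
       (\<forall>x\<in>p. (\<Sum>i\<in>I. partial_deriv i F x * v i) = 0)}"

definition smooth_locus :: "'i set \<Rightarrow> ('i \<Rightarrow> complex) set set \<Rightarrow> ('i \<Rightarrow> complex) set set" where
  "smooth_locus I X = {p \<in> X. enat (cfun.dim (tangent_space I X p)) = zariski_dim X + 1}"

definition smooth_point_sets ::
    "'i set \<Rightarrow> ('i \<Rightarrow> complex) set set \<Rightarrow> nat \<Rightarrow> ('i \<Rightarrow> complex) set set set" where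
  "smooth_point_sets I X r = {A. A \<subseteq> smooth_locus I X \<and> finite A \<and> card A = r}"

text \<open>
  The linear span of the scheme \<open>2A\<close> defined by the square of the ideal sheaf of \<open>A\<close> in \<open>X\<close>; at smooth
  points it is the span of the tangent spaces.
\<close>

definition double_span ::
    "'i set \<Rightarrow> ('i \<Rightarrow> complex) set set \<Rightarrow> ('i \<Rightarrow> complex) set set \<Rightarrow> ('i \<Rightarrow> complex) set" where
  "double_span I X A = cfun.span (\<Union>p\<in>A. tangent_space I X p)"

definition strong_base_locus ::
    "'i set \<Rightarrow> ('i \<Rightarrow> complex) set set \<Rightarrow> nat \<Rightarrow> ('i \<Rightarrow> complex) set set set" where
  "strong_base_locus I X r = {A \<in> smooth_point_sets I X r.
     double_span I X A \<noteq> coord_space I \<and>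
     (\<exists>q \<in> smooth_locus I X - A. double_span I X (A \<union> {q}) = double_span I X A)}"

definition contact_locus ::
    "'i set \<Rightarrow> ('i \<Rightarrow> complex) set set \<Rightarrow> ('i \<Rightarrow> complex) set set \<Rightarrow> ('i \<Rightarrow> complex) set set" where
  "contact_locus I X A = {x \<in> smooth_locus I X. tangent_space I X x \<subseteq> double_span I X A}"

definition positive_contact_locus ::
    "'i set \<Rightarrow> ('i \<Rightarrow> complex) set set \<Rightarrow> nat \<Rightarrow> ('i \<Rightarrow> complex) set set set" where
  "positive_contact_locus I X r = {A \<in> smooth_point_sets I X r.
     double_span I X A \<noteq> coord_space I \<and> zariski_dim (contact_locus I X A) > 0}"


section \<open>Segre-Veronese varieties\<close>

text \<open>
  The factors are indexed by \<open>i < k\<close>, with homogeneous coordinates \<open>y i 0, \<dots>, y i (n i)\<close> on the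
  \<open>i\<close>-th factor. The target of the embedding has one coordinate for each monomial of multidegree
  \<open>(d 0, \<dots>, d (k - 1))\<close>, labelled by its exponents; these monomials form a basis of the
  space of sections of the line bundle.
\<close>

definition multi_exponents ::
    "nat \<Rightarrow> (nat \<Rightarrow> nat) \<Rightarrow> (nat \<Rightarrow> nat) \<Rightarrow> (nat \<Rightarrow> nat \<Rightarrow> nat) set" where
  "multi_exponents k n d = {e. (\<forall>i j. \<not> (i < k \<and> j \<le> n i) \<longrightarrow> e i j = 0) \<and>
     (\<forall>i<k. (\<Sum>j\<le>n i. e i j) = d i)}"

definition multi_monomials ::
    "nat \<Rightarrow> (nat \<Rightarrow> nat) \<Rightarrow> (nat \<Rightarrow> nat) \<Rightarrow> (nat \<Rightarrow> nat \<Rightarrow> complex) \<Rightarrow> (nat \<Rightarrow> nat \<Rightarrow> nat) \<Rightarrow> complex" where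
  "multi_monomials k n d y = (\<lambda>e. if e \<in> multi_exponents k n d
     then (\<Prod>i<k. \<Prod>j\<le>n i. y i j ^ e i j) else 0)"

definition multi_proj_space :: "nat \<Rightarrow> (nat \<Rightarrow> nat) \<Rightarrow> (nat \<Rightarrow> (nat \<Rightarrow> complex) set) set" where
  "multi_proj_space k n = (\<Pi>\<^sub>E i\<in>{..<k}. proj_space {..n i})"

text \<open>
  The image of a point \<open>P\<close> of the product is the class of the vector of monomials; the union ranges
  over all choices of homogeneous coordinates \<open>y\<close> of \<open>P\<close>, which all give the same class.
\<close>

definition segre_veronese_map ::
    "nat \<Rightarrow> (nat \<Rightarrow> nat) \<Rightarrow> (nat \<Rightarrow> nat) \<Rightarrow> (nat \<Rightarrow> (nat \<Rightarrow> complex) set) \<Rightarrow>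
      ((nat \<Rightarrow> nat \<Rightarrow> nat) \<Rightarrow> complex) set" where
  "segre_veronese_map k n d P = (\<Union>y\<in>Pi {..<k} P. proj_point (multi_monomials k n d y))"

definition segre_veronese ::
    "nat \<Rightarrow> (nat \<Rightarrow> nat) \<Rightarrow> (nat \<Rightarrow> nat) \<Rightarrow> ((nat \<Rightarrow> nat \<Rightarrow> nat) \<Rightarrow> complex) set set" where
  "segre_veronese k n d = segre_veronese_map k n d ` multi_proj_space k n"

end

theory Submission
  imports Defs
begin


text \<open>
  The tangent space at the point with multihomogeneous coordinates \<open>y\<close> is spanned by the partial
  derivatives of the monomial map. Hence a form \<open>g\<close> of multidegree \<open>d\<close> gives a hyperplane, and this
  hyperplane contains the tangent space at \<open>y\<close> iff \<open>g\<close> is singular at \<open>y\<close>. If \<open>r \<le> t\<close>, then for \<open>r\<close> points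
  \<open>A\<close> and a further point \<open>q\<close> there is a product of linear forms that is singular along \<open>A\<close> but not at \<open>q\<close>,
  so the tangent space at \<open>q\<close> is not contained in the span of the tangent spaces along \<open>A\<close>; in
  particular the contact locus of \<open>A\<close> is \<open>A\<close> at most.

  If \<open>r \<ge> t + 1\<close>, place the points on a line in a factor of degree \<open>t\<close>. Along this line the tangent
  spaces are given by polynomials of degree at most \<open>t\<close> in the parameter, so by Lagrange interpolation
  any \<open>t + 1\<close> of them have the same span, spanned by the monomials of degree at most \<open>1\<close> in the
  coordinates that vanish on the line.

  The points are smooth because the dimension of \<open>X\<close> is the sum of the \<open>n i\<close>: coordinate subspaces give
  a chain of this length, and a chain of length \<open>l\<close> produces \<open>(u + 1) ^ l\<close> linearly independent
  forms on \<open>X\<close> of degree linear in \<open>u\<close>, of which there are at most \<open>O(u ^ N)\<close>, where \<open>N\<close> is that sum.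
\<close>

section \<open>Forms and the Zariski topology\<close>

text \<open>Singularity at a point costs two linear forms, so \<open>r\<close> points consume degree
  \<open>2 * r\<close>, while a single factor is only known to offer degree \<open>t >= r\<close>.
  The cost has to be spread over two factors for each point. The obstacle is a point of
  \<open>A\<close> that differs from \<open>q\<close> in just one factor: every linear form that
  vanishes there and not at \<open>q\<close> comes from that factor. If more than half of these
  points depend on the same factor, nonvanishing at \<open>q\<close> is given up and a simple zero
  at \<open>q\<close> is accepted, which serves as well. For \<open>r >= t + 1\<close>,
  interpolation makes the spans equal, but the loci also need this span to be proper, which requires
  a monomial of degree at least \<open>2\<close> in the coordinates that vanish on the line. On the
  quadric surface, the image of \<open>P^1 x P^1\<close> in \<open>P^3\<close>, there is none: the
  tangent planes at two distinct points already span \<open>P^3\<close>, so both loci are empty for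
  \<open>r >= 2\<close>. This is the case excluded from the nonemptiness half.\<close>

lemma sum_fun_apply: "(\<Sum>a\<in>A. f a) x = (\<Sum>a\<in>A. f a x)"
  by (induction A rule: infinite_finite_induct) auto

lemma cscale_apply [simp]: "cscale c f x = c * f x"
  by (simp add: cscale_def)

text \<open>\<open>cfun.independent\<close> speaks of sets and does not see repetitions in a family,
  so injectivity is derived too; the later dimension counts need the number of indices.\<close>

lemma independent_family:
  fixes h :: "'a \<Rightarrow> 'b \<Rightarrow> complex"
  assumes fin: "finite J"
    and ind: "\<And>a m. (\<And>x. (\<Sum>m\<in>J. a m * h m x) = 0) \<Longrightarrow> m \<in> J \<Longrightarrow> a m = 0"
  shows "inj_on h J" "cfun.independent (h ` J)"
proof -
  show inj: "inj_on h J"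
  proof (rule inj_onI, rule ccontr)
    fix m m' assume m: "m \<in> J" "m' \<in> J" "h m = h m'" "m \<noteq> m'"
    define a where "a = (\<lambda>i. if i = m then 1 else if i = m' then - 1 else (0::complex))"
    have "(\<Sum>i\<in>J. a i * h i x) = 0" for x
    proof -
      have "(\<Sum>i\<in>J. a i * h i x) = (\<Sum>i\<in>{m, m'}. a i * h i x)"
        using m fin by (intro sum.mono_neutral_right) (auto simp: a_def)
      then show ?thesis using m by (simp add: a_def)
    qed
    then have "a m = 0" using m(1) by (rule ind)
    then show False by (simp add: a_def)
  qed
  show "cfun.independent (h ` J)"
  proof (rule cfun.independent_if_scalars_zero)
    show "finite (h ` J)" using fin by simp
    fix f v assume eq: "(\<Sum>x\<in>h ` J. cscale (f x) x) = 0" and "v \<in> h ` J"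
    then obtain m where m: "m \<in> J" "v = h m" by auto
    have "(\<Sum>m\<in>J. f (h m) * h m x) = 0" for x
      using fun_cong[OF eq, of x] by (simp add: sum.reindex[OF inj] sum_fun_apply)
    then show "f v = 0" using ind[of "\<lambda>m. f (h m)"] m by auto
  qed
qed

text \<open>Bilinearity reduces a product of two combinations to products of generators. This serves
  both the forms on the ambient space and the multihomogeneous forms.\<close>

lemma span_mult:
  fixes f g :: "'a \<Rightarrow> complex"
  assumes f: "f \<in> cfun.span A" and g: "g \<in> cfun.span B"
    and AB: "\<And>a b. a \<in> A \<Longrightarrow> b \<in> B \<Longrightarrow> (\<lambda>x. a x * b x) \<in> cfun.span C"
  shows "(\<lambda>x. f x * g x) \<in> cfun.span C"
proof -
  have 1: "(\<lambda>x. a x * g x) \<in> cfun.span C" if "a \<in> A" for a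
    using g
  proof (induction rule: cfun.span_induct_alt)
    case base
    have "(\<lambda>x. 0 x * g x) = 0" "(\<lambda>x. a x * 0 x) = 0" for a :: "'a \<Rightarrow> complex"
      by (simp_all add: fun_eq_iff)
    then show ?case by (simp only: cfun.span_zero)
  next
    case (step c x y)
    have "(\<lambda>z. a z * (cscale c x + y) z) = cscale c (\<lambda>z. a z * x z) + (\<lambda>z. a z * y z)"
      by (auto simp: fun_eq_iff algebra_simps)
    then show ?case
      using cfun.span_add[OF cfun.span_scale[OF AB[OF that step(1)]] step(2)] by metis
  qed
  show ?thesis using f
  proof (induction rule: cfun.span_induct_alt)
    case base
    have "(\<lambda>x. 0 x * g x) = 0" "(\<lambda>x. a x * 0 x) = 0" for a :: "'a \<Rightarrow> complex"
      by (simp_all add: fun_eq_iff)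
    then show ?case by (simp only: cfun.span_zero)
  next
    case (step c x y)
    have "(\<lambda>z. (cscale c x + y) z * g z) = cscale c (\<lambda>z. x z * g z) + (\<lambda>z. y z * g z)"
      by (auto simp: fun_eq_iff algebra_simps)
    then show ?case
      using cfun.span_add[OF cfun.span_scale[OF 1[OF step(1)]] step(2)] by metis
  qed
qed

section \<open>Homogeneous forms as functions\<close>

definition mdeg :: "('i \<Rightarrow>\<^sub>0 nat) \<Rightarrow> nat" where
  "mdeg m = (\<Sum>i\<in>Poly_Mapping.keys m. Poly_Mapping.lookup m i)"

definition mfun :: "('i \<Rightarrow>\<^sub>0 nat) \<Rightarrow> ('i \<Rightarrow> complex) \<Rightarrow> complex" where
  "mfun m x = (\<Prod>i\<in>Poly_Mapping.keys m. x i ^ Poly_Mapping.lookup m i)"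

text \<open>Forms are kept as functions, so that sums and products need no arithmetic of
  \<open>mpoly\<close>. The zero function belongs to every degree.\<close>

definition form :: "nat \<Rightarrow> (('i \<Rightarrow> complex) \<Rightarrow> complex) set" where
  "form s = cfun.span (mfun ` {m. mdeg m = s})"

lemma mfun_superset:
  assumes "finite V" "Poly_Mapping.keys m \<subseteq> V"
  shows "mfun m x = (\<Prod>i\<in>V. x i ^ Poly_Mapping.lookup m i)"
  unfolding mfun_def using assms
  by (intro prod.mono_neutral_left) (auto simp: in_keys_iff)

lemma mdeg_superset:
  assumes "finite V" "Poly_Mapping.keys m \<subseteq> V"
  shows "mdeg m = (\<Sum>i\<in>V. Poly_Mapping.lookup m i)"
  unfolding mdeg_def using assms
  by (intro sum.mono_neutral_left) (auto simp: in_keys_iff)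

lemma mfun_add: "mfun (m + m') x = mfun m x * mfun m' x"
proof -
  let ?V = "Poly_Mapping.keys m \<union> Poly_Mapping.keys m'"
  have "finite ?V" "Poly_Mapping.keys (m + m') \<subseteq> ?V" by (simp_all add: Poly_Mapping.keys_add)
  then show ?thesis
    by (simp add: mfun_superset[of ?V] lookup_add power_add prod.distrib)
qed

lemma mdeg_add: "mdeg (m + m') = mdeg m + mdeg m'"
proof -
  let ?V = "Poly_Mapping.keys m \<union> Poly_Mapping.keys m'"
  have "finite ?V" "Poly_Mapping.keys (m + m') \<subseteq> ?V" by (simp_all add: Poly_Mapping.keys_add)
  then show ?thesis
    by (simp add: mdeg_superset[of ?V] lookup_add sum.distrib)
qed

lemma mpoly_eval_superset:
  assumes "finite K" "Poly_Mapping.keys F \<subseteq> K"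
  shows "mpoly_eval F x = (\<Sum>m\<in>K. Poly_Mapping.lookup F m * mfun m x)"
  unfolding mpoly_eval_def mfun_def using assms
  by (intro sum.mono_neutral_left) (auto simp: in_keys_iff)

lemma mpoly_eval_add: "mpoly_eval (F + G) x = mpoly_eval F x + mpoly_eval G x"
proof -
  let ?V = "Poly_Mapping.keys F \<union> Poly_Mapping.keys G"
  have "finite ?V" "Poly_Mapping.keys (F + G) \<subseteq> ?V" by (simp_all add: Poly_Mapping.keys_add)
  then show ?thesis
    by (simp add: mpoly_eval_superset[of ?V] lookup_add sum.distrib algebra_simps)
qed

lemma mpoly_eval_single: "mpoly_eval (Poly_Mapping.single m c) x = c * mfun m x"
  by (simp add: mpoly_eval_superset[of "{m}"])

lemma mpoly_eval_form:
  assumes "\<And>m. m \<in> Poly_Mapping.keys F \<Longrightarrow> mdeg m = s"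
  shows "mpoly_eval F \<in> form s"
proof -
  have "mpoly_eval F = (\<Sum>m\<in>Poly_Mapping.keys F. cscale (Poly_Mapping.lookup F m) (mfun m))"
    by (auto simp: fun_eq_iff sum_fun_apply mpoly_eval_superset[OF _ order_refl])
  also have "\<dots> \<in> form s"
    unfolding form_def using assms
    by (intro cfun.span_sum cfun.span_scale cfun.span_base) auto
  finally show ?thesis .
qed

text \<open>The way back to polynomials, needed because closed sets are defined by elements of
  \<open>mpoly\<close>.\<close>

lemma formE:
  assumes "f \<in> form s"
  obtains F where "\<And>m. m \<in> Poly_Mapping.keys F \<Longrightarrow> mdeg m = s" "mpoly_eval F = f"
proof -
  have "\<exists>F. (\<forall>m\<in>Poly_Mapping.keys F. mdeg m = s) \<and> mpoly_eval F = f"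
    using assms unfolding form_def
  proof (induction rule: cfun.span_induct_alt)
    case base
    show ?case by (rule exI[of _ 0]) (simp add: mpoly_eval_def fun_eq_iff)
  next
    case (step c g y)
    then obtain F m where F: "\<forall>m\<in>Poly_Mapping.keys F. mdeg m = s" "mpoly_eval F = y"
      and m: "g = mfun m" "mdeg m = s" by auto
    let ?F = "Poly_Mapping.single m c + F"
    have "\<forall>m\<in>Poly_Mapping.keys ?F. mdeg m = s"
      using Poly_Mapping.keys_add[of "Poly_Mapping.single m c" F] F m
      by (auto split: if_splits)
    moreover have "mpoly_eval ?F = cscale c g + y"
      by (simp add: fun_eq_iff mpoly_eval_add mpoly_eval_single m F(2)[symmetric])
    ultimately show ?case by blast
  qed
  then show ?thesis using that by blast
qed

lemma homogeneous_iff: "homogeneous F \<longleftrightarrow> (\<exists>s. \<forall>m\<in>Poly_Mapping.keys F. mdeg m = s)"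
  by (simp add: homogeneous_def mdeg_def)

lemma form_add: "f \<in> form s \<Longrightarrow> g \<in> form s \<Longrightarrow> (\<lambda>x. f x + g x) \<in> form s"
  using cfun.span_add[of f _ g] by (simp add: form_def plus_fun_def)

lemma form_scale: "f \<in> form s \<Longrightarrow> (\<lambda>x. c * f x) \<in> form s"
  using cfun.span_scale[of f _ c] by (simp add: form_def cscale_def)

lemma form_zero: "(\<lambda>x. 0) \<in> form s"
  using cfun.span_zero by (simp add: form_def zero_fun_def)

lemma form_diff: "f \<in> form s \<Longrightarrow> g \<in> form s \<Longrightarrow> (\<lambda>x. f x - g x) \<in> form s"
  using form_add[of f s "\<lambda>x. -1 * g x"] form_scale[of g s "-1"] by simp

lemma form_sum: "(\<And>i. i \<in> I \<Longrightarrow> f i \<in> form s) \<Longrightarrow> (\<lambda>x. \<Sum>i\<in>I. f i x) \<in> form s"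
  by (induction I rule: infinite_finite_induct) (auto intro: form_add form_zero)

lemma form_mult: "f \<in> form s \<Longrightarrow> g \<in> form t \<Longrightarrow> (\<lambda>x. f x * g x) \<in> form (s + t)"
  unfolding form_def
proof (erule (1) span_mult)
  fix a b :: "('a \<Rightarrow> complex) \<Rightarrow> complex"
  assume "a \<in> mfun ` {m. mdeg m = s}" "b \<in> mfun ` {m. mdeg m = t}"
  then obtain m m' where m: "a = mfun m" "b = mfun m'" "mdeg m = s" "mdeg m' = t" by auto
  have "(\<lambda>x. a x * b x) = mfun (m + m')"
    by (simp add: m mfun_add fun_eq_iff)
  then show "(\<lambda>x. a x * b x) \<in> cfun.span (mfun ` {m. mdeg m = s + t})"
    using m by (auto intro!: cfun.span_base simp: mdeg_add)
qed

lemma form_const: "(\<lambda>x. c) \<in> form 0"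
proof -
  have "(\<lambda>x. 1) = mfun (0 :: 'a \<Rightarrow>\<^sub>0 nat)" by (simp add: mfun_def fun_eq_iff)
  then have "(\<lambda>x. 1) \<in> (form 0 :: (('a \<Rightarrow> complex) \<Rightarrow> complex) set)"
    unfolding form_def by (intro cfun.span_base) (auto simp: mdeg_def)
  from form_scale[OF this, of c] show ?thesis by simp
qed

lemma form_coord: "(\<lambda>x. x i) \<in> form 1"
proof -
  have "(\<lambda>x. x i) = mfun (Poly_Mapping.single i 1)" by (simp add: mfun_def fun_eq_iff)
  then show ?thesis
    unfolding form_def by (intro cfun.span_base) (auto simp: mdeg_def)
qed

lemma form_power: "f \<in> form s \<Longrightarrow> (\<lambda>x. f x ^ m) \<in> form (m * s)"
  by (induction m) (auto intro: form_const form_mult)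

lemma form_prod:
  "finite I \<Longrightarrow> (\<And>i. i \<in> I \<Longrightarrow> f i \<in> form (s i)) \<Longrightarrow> (\<lambda>x. \<Prod>i\<in>I. f i x) \<in> form (\<Sum>i\<in>I. s i)"
  by (induction I rule: finite_induct) (auto intro: form_const form_mult)

lemma form_cscale:
  assumes "f \<in> form s"
  shows "f (cscale c x) = c ^ s * f x"
  using assms unfolding form_def
proof (induction rule: cfun.span_induct_alt)
  case base
  then show ?case by simp
next
  case (step a g y)
  then obtain m where m: "g = mfun m" "mdeg m = s" by auto
  have "g (cscale c x) = c ^ s * g x"
    using m(2) by (simp add: m(1) mfun_def mdeg_def power_mult_distrib prod.distrib flip: power_sum)
  then show ?case using step(2) by (simp add: algebra_simps del: cscale_apply)
       (simp add: algebra_simps)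
qed

section \<open>Closed and irreducible sets in projective space\<close>

lemma proj_point_self [simp]: "v \<in> proj_point v"
  by (auto simp: proj_point_def cscale_def intro!: exI[of _ 1])

lemma form_zero_proj_point:
  assumes "f \<in> form s"
  shows "(\<forall>x\<in>proj_point v. f x = 0) \<longleftrightarrow> f v = 0"
proof
  assume "\<forall>x\<in>proj_point v. f x = 0"
  then show "f v = 0" by auto
qed (auto simp: proj_point_def form_cscale[OF assms])

text \<open>Each function of the family is replaced by all homogeneous polynomials that define it;
  by \<open>formE\<close> there is at least one.\<close>

lemma zariski_closed_inI:
  assumes "\<And>f. f \<in> \<F> \<Longrightarrow> \<exists>s. f \<in> form s" and "Z = {p \<in> S. \<forall>f\<in>\<F>. \<forall>x\<in>p. f x = 0}"
  shows "zariski_closed_in S Z"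
  unfolding zariski_closed_in_def
proof (intro exI[of _ "{F. homogeneous F \<and> mpoly_eval F \<in> \<F>}"] conjI)
  have "\<F> = mpoly_eval ` {F. homogeneous F \<and> mpoly_eval F \<in> \<F>}"
  proof (intro equalityI subsetI)
    fix f assume f: "f \<in> \<F>"
    then obtain s where "f \<in> form s" using assms(1) by blast
    then obtain F where "\<And>m. m \<in> Poly_Mapping.keys F \<Longrightarrow> mdeg m = s" "mpoly_eval F = f"
      using formE by blast
    then show "f \<in> mpoly_eval ` {F. homogeneous F \<and> mpoly_eval F \<in> \<F>}"
      using f by (auto simp: homogeneous_iff)
  qed auto
  then have "(\<forall>f\<in>\<F>. Q f) \<longleftrightarrow> (\<forall>F\<in>{F. homogeneous F \<and> mpoly_eval F \<in> \<F>}. Q (mpoly_eval F))" for Q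
    by (metis (no_types, lifting) image_iff)
  then show "Z = {p \<in> S. \<forall>F\<in>{F. homogeneous F \<and> mpoly_eval F \<in> \<F>}. vanishes_at F p}"
    unfolding assms(2) vanishes_at_def by presburger
qed auto

lemma zariski_closed_inE:
  assumes "zariski_closed_in S Z"
  obtains \<F> where "\<forall>f\<in>\<F>. \<exists>s. f \<in> form s" "Z = {p \<in> S. \<forall>f\<in>\<F>. \<forall>x\<in>p. f x = 0}"
proof -
  from assms obtain \<G> where G: "\<forall>F\<in>\<G>. homogeneous F" "Z = {p\<in>S. \<forall>F\<in>\<G>. vanishes_at F p}"
    unfolding zariski_closed_in_def by auto
  show ?thesis
  proof (rule that[of "mpoly_eval ` \<G>"])
    show "\<forall>f\<in>mpoly_eval ` \<G>. \<exists>s. f \<in> form s"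
      using G(1) by (force simp: homogeneous_iff intro: mpoly_eval_form)
  qed (auto simp: G(2) vanishes_at_def)
qed

text \<open>The homogeneous ideal of an irreducible set is prime: the zero loci of \<open>f\<close>
  and \<open>g\<close> are closed and cover \<open>Z\<close>.\<close>

lemma zariski_irreducible_mult:
  assumes irr: "zariski_irreducible Z" and f: "f \<in> form s" and g: "g \<in> form t"
    and Z: "Z \<subseteq> range proj_point"
    and fg: "\<And>p x. p \<in> Z \<Longrightarrow> x \<in> p \<Longrightarrow> f x * g x = 0"
  shows "(\<forall>p\<in>Z. \<forall>x\<in>p. f x = 0) \<or> (\<forall>p\<in>Z. \<forall>x\<in>p. g x = 0)"
proof -
  let ?A = "{p\<in>Z. \<forall>x\<in>p. f x = 0}" and ?B = "{p\<in>Z. \<forall>x\<in>p. g x = 0}"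
  have c: "zariski_closed_in Z ?A" "zariski_closed_in Z ?B"
    using f g zariski_closed_inI[of "{f}" ?A Z] zariski_closed_inI[of "{g}" ?B Z] by auto
  have "p \<in> ?A \<union> ?B" if "p \<in> Z" for p
  proof -
    obtain v where v: "p = proj_point v" using Z \<open>p \<in> Z\<close> by auto
    have "f v * g v = 0" by (rule fg[OF that]) (simp add: v)
    then show ?thesis
      using that v form_zero_proj_point[OF f] form_zero_proj_point[OF g] by auto
  qed
  then have "Z = ?A \<union> ?B" by auto
  with irr c have "Z = ?A \<or> Z = ?B" unfolding zariski_irreducible_def by blast
  then show ?thesis by blast
qed

text \<open>Irreducibility means that any two nonempty open sets meet, and it is enough to test the
  open sets where a single form does not vanish.\<close>

lemma zariski_irreducibleI:
  assumes ne: "Z \<noteq> {}"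
    and *: "\<And>f g s t p q x y. f \<in> form s \<Longrightarrow> g \<in> form t \<Longrightarrow> p \<in> Z \<Longrightarrow> q \<in> Z \<Longrightarrow> x \<in> p \<Longrightarrow> y \<in> q \<Longrightarrow>
      f x \<noteq> 0 \<Longrightarrow> g y \<noteq> 0 \<Longrightarrow> \<exists>p\<in>Z. \<exists>x\<in>p. f x \<noteq> 0 \<and> (\<exists>x\<in>p. g x \<noteq> 0)"
  shows "zariski_irreducible Z"
  unfolding zariski_irreducible_def
proof (intro conjI ne allI impI, elim conjE)
  fix Z1 Z2 assume c: "zariski_closed_in Z Z1" "zariski_closed_in Z Z2" and Z: "Z = Z1 \<union> Z2"
  obtain \<F> where F: "\<forall>f\<in>\<F>. \<exists>s. f \<in> form s" "Z1 = {p \<in> Z. \<forall>f\<in>\<F>. \<forall>x\<in>p. f x = 0}"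
    using zariski_closed_inE[OF c(1)] by blast
  obtain \<G> where G: "\<forall>f\<in>\<G>. \<exists>s. f \<in> form s" "Z2 = {p \<in> Z. \<forall>f\<in>\<G>. \<forall>x\<in>p. f x = 0}"
    using zariski_closed_inE[OF c(2)] by blast
  show "Z = Z1 \<or> Z = Z2"
  proof (rule ccontr)
    assume "\<not> (Z = Z1 \<or> Z = Z2)"
    then obtain p q where "p \<in> Z" "p \<notin> Z1" "q \<in> Z" "q \<notin> Z2" using Z by blast
    then obtain f x g y where fg: "f \<in> \<F>" "x \<in> p" "f x \<noteq> 0" "g \<in> \<G>" "y \<in> q" "g y \<noteq> 0"
      using F(2) G(2) by auto
    obtain s t where st: "f \<in> form s" "g \<in> form t" using F(1) G(1) fg by blast
    obtain r where "r \<in> Z" "\<exists>x\<in>r. f x \<noteq> 0" "\<exists>x\<in>r. g x \<noteq> 0"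
      using *[OF st \<open>p \<in> Z\<close> \<open>q \<in> Z\<close> fg(2,5,3,6)] by blast
    then have "r \<notin> Z1" "r \<notin> Z2" using F(2) G(2) fg by blast+
    then show False using \<open>r \<in> Z\<close> Z by blast
  qed
qed


lemma proj_point_cscale: "c \<noteq> 0 \<Longrightarrow> proj_point (cscale c v) = proj_point v"
proof (intro equalityI subsetI)
  fix x assume "c \<noteq> 0" "x \<in> proj_point v"
  then obtain b where "b \<noteq> 0" "x = cscale b v" by (auto simp: proj_point_def)
  then have "x = cscale (b / c) (cscale c v)" "b / c \<noteq> 0"
    using \<open>c \<noteq> 0\<close> by (auto simp: cscale_def)
  then show "x \<in> proj_point (cscale c v)" unfolding proj_point_def by blast
next
  fix x assume "c \<noteq> 0" "x \<in> proj_point (cscale c v)"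
  then obtain b where "b \<noteq> 0" "x = cscale b (cscale c v)" by (auto simp: proj_point_def)
  then have "x = cscale (b * c) v" "b * c \<noteq> 0"
    using \<open>c \<noteq> 0\<close> by (auto simp: cscale_def)
  then show "x \<in> proj_point v" unfolding proj_point_def by blast
qed

text \<open>Nonproportional vectors have a nonzero \<open>2 x 2\<close> minor that involves a column
  \<open>j\<close> with \<open>w j\<close> nonzero; replacing \<open>v\<close> by variables in it
  gives the linear form.\<close>

lemma separating_form:
  assumes "v \<noteq> 0" "w \<noteq> 0" "proj_point v \<noteq> proj_point w"
  obtains f where "f \<in> form 1" "f w = 0" "f v \<noteq> 0"
proof -
  obtain j where j: "w j \<noteq> 0" using assms(2) by (auto simp: fun_eq_iff)
  have "\<exists>i. v i * w j \<noteq> w i * v j"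
  proof (rule ccontr)
    assume *: "\<not> ?thesis"
    define c where "c = v j / w j"
    have v: "v = cscale c w" using j * by (auto simp: fun_eq_iff field_simps c_def)
    then have "c \<noteq> 0" using assms(1) by (auto simp: fun_eq_iff)
    then show False using assms(3) proj_point_cscale[of c w] v by simp
  qed
  then obtain i where i: "v i * w j \<noteq> w i * v j" by blast
  have "(\<lambda>x. w j * x i - w i * x j) \<in> form 1"
    by (intro form_diff form_scale form_coord)
  then show ?thesis by (rule that) (use i in \<open>auto simp: mult.commute\<close>)
qed

text \<open>Given two points \<open>p\<close> and \<open>q\<close>, primality fails for the product
  of linear forms that vanish at the points other than \<open>p\<close> and a linear form that
  vanishes at \<open>p\<close> but not at \<open>q\<close>.\<close>

lemma zariski_irreducible_finite:
  assumes "zariski_irreducible Z" "finite Z" and Z: "Z \<subseteq> proj_point ` (- {0})"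
  shows "\<exists>p. Z = {p}"
proof (rule ccontr)
  assume no: "\<nexists>p. Z = {p}"
  obtain p where p: "p \<in> Z" using assms(1) by (auto simp: zariski_irreducible_def)
  then obtain q where q: "q \<in> Z" "q \<noteq> p" using no by blast
  obtain v where v: "p = proj_point v" "v \<noteq> 0" using p Z by auto
  have "\<exists>f. f \<in> form 1 \<and> (\<forall>x\<in>r. f x = 0) \<and> f v \<noteq> 0" if "r \<in> Z - {p}" for r
  proof -
    have r: "r \<in> Z" "r \<noteq> p" using that by auto
    then obtain w where w: "r = proj_point w" "w \<noteq> 0" using Z by auto
    then obtain f where "f \<in> form 1" "f w = 0" "f v \<noteq> 0"
      using separating_form[of v w] v r by metis
    then show ?thesis using w form_zero_proj_point by blast
  qed
  then obtain f where f: "\<And>r. r \<in> Z - {p} \<Longrightarrow> f r \<in> form 1"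
    "\<And>r x. r \<in> Z - {p} \<Longrightarrow> x \<in> r \<Longrightarrow> f r x = 0" "\<And>r. r \<in> Z - {p} \<Longrightarrow> f r v \<noteq> 0"
    by metis
  let ?F = "\<lambda>x. \<Prod>r\<in>Z - {p}. f r x"
  have F: "?F \<in> form (\<Sum>r\<in>Z - {p}. 1)" using assms(2) f(1) by (intro form_prod) auto
  have Fv: "?F v \<noteq> 0" using assms(2) f(3) by auto
  obtain w where w: "q = proj_point w" "w \<noteq> 0" using q Z by auto
  obtain g where g: "g \<in> form 1" "g v = 0" "g w \<noteq> 0"
    using separating_form[of w v] v w q by metis
  have "?F x * g x = 0" if "r \<in> Z" "x \<in> r" for r x
  proof (cases "r = p")
    case True
    then show ?thesis using that v g form_zero_proj_point[OF g(1), of v] by auto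
  next
    case False
    then have "\<exists>r\<in>Z - {p}. f r x = 0" using that f(2) by blast
    then show ?thesis using assms(2) by simp
  qed
  moreover have "Z \<subseteq> range proj_point" using Z by auto
  ultimately have "(\<forall>p\<in>Z. \<forall>x\<in>p. ?F x = 0) \<or> (\<forall>p\<in>Z. \<forall>x\<in>p. g x = 0)"
    using zariski_irreducible_mult[OF assms(1) F g(1)] by blast
  then show False
  proof
    assume "\<forall>p\<in>Z. \<forall>x\<in>p. ?F x = 0"
    then show False using p v Fv proj_point_self by blast
  next
    assume "\<forall>p\<in>Z. \<forall>x\<in>p. g x = 0"
    then show False using q w g proj_point_self by blast
  qed
qed

section \<open>Dimension and chains of irreducible closed sets\<close>

lemma zariski_closed_in_subset: "zariski_closed_in S Z \<Longrightarrow> Z \<subseteq> S"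
  by (auto simp: zariski_closed_in_def)

lemma zariski_dim_leI:
  assumes "\<And>l Z. (\<And>j. j \<le> l \<Longrightarrow> zariski_closed_in S (Z j) \<and> zariski_irreducible (Z j)) \<Longrightarrow>
    (\<And>j. j < l \<Longrightarrow> Z j \<subset> Z (Suc j)) \<Longrightarrow> l \<le> N"
  shows "zariski_dim S \<le> enat N"
  unfolding zariski_dim_def
proof (rule Sup_least, clarify)
  fix l :: nat and Z :: "nat \<Rightarrow> ('a \<Rightarrow> complex) set set"
  assume "\<forall>j\<le>l. zariski_closed_in S (Z j) \<and> zariski_irreducible (Z j)" "\<forall>j<l. Z j \<subset> Z (Suc j)"
  then show "enat l \<le> enat N" using assms[of l Z] by simp
qed

lemma zariski_dim_geI:
  assumes "\<And>j. j \<le> l \<Longrightarrow> zariski_closed_in S (Z j)" "\<And>j. j \<le> l \<Longrightarrow> zariski_irreducible (Z j)"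
    "\<And>j. j < l \<Longrightarrow> Z j \<subset> Z (Suc j)"
  shows "enat l \<le> zariski_dim S"
  unfolding zariski_dim_def using assms by (intro Sup_upper) auto

text \<open>A chain of length \<open>1\<close> would put a nonempty set strictly inside an
  irreducible finite set, which is a single point.\<close>

lemma zariski_dim_finite:
  assumes "finite S" "S \<subseteq> proj_point ` (- {0})"
  shows "zariski_dim S = 0"
proof -
  have "zariski_dim S \<le> enat 0"
  proof (rule zariski_dim_leI, rule ccontr)
    fix l and Z :: "nat \<Rightarrow> _"
    assume Z: "\<And>j. j \<le> l \<Longrightarrow> zariski_closed_in S (Z j) \<and> zariski_irreducible (Z j)"
      "\<And>j. j < l \<Longrightarrow> Z j \<subset> Z (Suc j)" and "\<not> l \<le> 0"
    then have l: "0 < l" "Suc 0 \<le> l" by auto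
    have "Z 0 \<noteq> {}" using Z(1)[of 0] by (auto simp: zariski_irreducible_def)
    have "Z (Suc 0) \<subseteq> S" using Z(1)[OF l(2)] zariski_closed_in_subset by blast
    then have "finite (Z (Suc 0))" "Z (Suc 0) \<subseteq> proj_point ` (- {0})"
      using assms by (auto intro: finite_subset)
    then obtain p where "Z (Suc 0) = {p}"
      using zariski_irreducible_finite Z(1)[OF l(2)] by blast
    then show False using Z(2)[OF l(1)] \<open>Z 0 \<noteq> {}\<close> by auto
  qed
  then show ?thesis by (simp add: zero_enat_def[symmetric])
qed

text \<open>
  For a chain of irreducible closed sets \<open>Z 0 \<subset> \<dots> \<subset> Z l\<close> choose forms \<open>f j\<close> vanishing on
  \<open>Z j\<close> but not on \<open>Z (Suc j)\<close>, and a linear form \<open>x0\<close> that does not vanish on \<open>Z 0\<close>. The products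
  of powers of the \<open>f j\<close>, made homogeneous of degree \<open>L\<close> by powers of \<open>x0\<close>, are linearly independent
  on \<open>Z l\<close>. The head of the list is the exponent of the last form.
\<close>

primrec chain_form ::
    "(nat \<Rightarrow> 'v \<Rightarrow> complex) \<Rightarrow> (nat \<Rightarrow> nat) \<Rightarrow> ('v \<Rightarrow> complex) \<Rightarrow> nat list \<Rightarrow> nat \<Rightarrow> 'v \<Rightarrow> complex" where
  "chain_form f s x0 [] L = (\<lambda>x. x0 x ^ L)"
| "chain_form f s x0 (t # ts) L =
    (\<lambda>x. f (length ts) x ^ t * chain_form f s x0 ts (L - t * s (length ts)) x)"

text \<open>The lower bound on \<open>L\<close> makes the truncated subtractions in
  \<open>chain_form\<close> exact: with exponents at most \<open>u\<close>, the forms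
  \<open>f j\<close> never use up more degree than is available.\<close>

lemma chain_form_in_form:
  assumes "\<And>j. j < length ts \<Longrightarrow> f j \<in> form (s j)" "x0 \<in> form 1" "set ts \<subseteq> {..u}"
    "u * (\<Sum>j<length ts. s j) \<le> L"
  shows "chain_form f s x0 ts L \<in> form L"
  using assms
proof (induction ts arbitrary: L)
  case Nil
  then show ?case using form_power[of x0 1 L] by simp
next
  case (Cons t ts)
  let ?s = "s (length ts)"
  have t: "t * ?s \<le> u * ?s" using Cons.prems(3) by simp
  have L: "u * (\<Sum>j<length ts. s j) + u * ?s \<le> L" using Cons.prems(4) by (simp add: algebra_simps)
  have "chain_form f s x0 ts (L - t * ?s) \<in> form (L - t * ?s)"
  proof (rule Cons.IH)
    show "u * (\<Sum>j<length ts. s j) \<le> L - t * ?s" using t L by linarith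
  qed (use Cons.prems in auto)
  moreover have "(\<lambda>x. f (length ts) x ^ t) \<in> form (t * ?s)"
    using Cons.prems by (intro form_power) auto
  ultimately have "chain_form f s x0 (t # ts) L \<in> form (t * ?s + (L - t * ?s))"
    unfolding chain_form.simps by (rule form_mult[rotated])
  then show ?case using t L by simp
qed

text \<open>A relation on \<open>Z (Suc l)\<close> is sorted by powers of \<open>f l\<close>. If
  \<open>t0\<close> is the lowest power with a nonzero coefficient, primality allows division by
  \<open>f l ^ t0\<close>, since \<open>f l\<close> does not vanish on \<open>Z (Suc l)\<close>.
  Restricting the quotient to \<open>Z l\<close>, where \<open>f l\<close> vanishes, leaves a
  shorter relation for the induction.\<close>

lemma chain_form_independent:
  fixes Z :: "nat \<Rightarrow> ('i \<Rightarrow> complex) set set"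
  assumes "\<And>j. j \<le> l \<Longrightarrow> zariski_irreducible (Z j)" "\<And>j. j \<le> l \<Longrightarrow> Z j \<subseteq> range proj_point"
    "\<And>j. j < l \<Longrightarrow> Z j \<subseteq> Z (Suc j)"
    "\<And>j. j < l \<Longrightarrow> f j \<in> form (s j)"
    "\<And>j p x. j < l \<Longrightarrow> p \<in> Z j \<Longrightarrow> x \<in> p \<Longrightarrow> f j x = 0"
    "\<And>j. j < l \<Longrightarrow> \<exists>p\<in>Z (Suc j). \<exists>x\<in>p. f j x \<noteq> 0"
    "x0 \<in> form 1" "\<exists>p\<in>Z 0. \<exists>x\<in>p. x0 x \<noteq> 0"
    "u * (\<Sum>j<l. s j) \<le> L"
    "\<And>p x. p \<in> Z l \<Longrightarrow> x \<in> p \<Longrightarrow>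
      (\<Sum>ts\<in>{ts. set ts \<subseteq> {..u} \<and> length ts = l}. a ts * chain_form f s x0 ts L x) = 0"
    "set us \<subseteq> {..u}" "length us = l"
  shows "a us = 0"
  using assms
proof (induction l arbitrary: L a us)
  case 0
  have *: "{ts. set ts \<subseteq> {..u} \<and> length ts = 0} = {[]}" by auto
  obtain p x where px: "p \<in> Z 0" "x \<in> p" "x0 x \<noteq> 0" using 0(8) by blast
  have "a [] * x0 x ^ L = 0" using 0(10)[OF px(1,2)] unfolding * by simp
  then show ?case using px(3) 0(12) by simp
next
  case (Suc l)
  let ?J = "{ts. set ts \<subseteq> {..u} \<and> length ts = l}"
  \<comment> \<open>\<open>G t\<close> is the coefficient of \<open>f l ^ t\<close>.\<close>
  define G where "G = (\<lambda>t x. \<Sum>ts\<in>?J. a (t # ts) * chain_form f s x0 ts (L - t * s l) x)"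
  have finJ: "finite ?J" by (rule finite_lists_length_eq) simp
  have L: "u * (\<Sum>j<l. s j) + u * s l \<le> L" using Suc.prems(9) by (simp add: algebra_simps)
  have tL: "t * s l \<le> u * s l" if "t \<le> u" for t using that by simp
  have sum_eq: "(\<Sum>ts\<in>{ts. set ts \<subseteq> {..u} \<and> length ts = Suc l}. a ts * chain_form f s x0 ts L x)
      = (\<Sum>t\<le>u. f l x ^ t * G t x)" for x
  proof -
    have inj: "inj_on (\<lambda>(ts, t). t # ts) (?J \<times> {..u})" by (auto simp: inj_on_def)
    have "(\<Sum>ts\<in>{ts. set ts \<subseteq> {..u} \<and> length ts = Suc l}. a ts * chain_form f s x0 ts L x)
      = (\<Sum>(ts, t)\<in>?J \<times> {..u}. a (t # ts) * chain_form f s x0 (t # ts) L x)"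
      unfolding lists_length_Suc_eq sum.reindex[OF inj] by (simp only: case_prod_unfold o_def)
    also have "\<dots> = (\<Sum>ts\<in>?J. \<Sum>t\<le>u. a (t # ts) * chain_form f s x0 (t # ts) L x)"
      by (rule sum.cartesian_product[symmetric])
    also have "\<dots> = (\<Sum>t\<le>u. \<Sum>ts\<in>?J. a (t # ts) * chain_form f s x0 (t # ts) L x)"
      by (rule sum.swap)
    also have "\<dots> = (\<Sum>t\<le>u. f l x ^ t * G t x)"
      unfolding G_def sum_distrib_left by (intro sum.cong) auto
    finally show ?thesis .
  qed
  have G: "G t \<in> form (L - t * s l)" if "t \<le> u" for t
    unfolding G_def
  proof (intro form_sum form_scale)
    fix ts assume "ts \<in> ?J"
    then have ts: "set ts \<subseteq> {..u}" "length ts = l" by auto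
    have "u * (\<Sum>j<l. s j) \<le> L - t * s l" using tL[OF that] L by linarith
    then show "chain_form f s x0 ts (L - t * s l) \<in> form (L - t * s l)"
      using ts Suc.prems(4,7) by (intro chain_form_in_form[where u = u]) auto
  qed
  have "\<forall>t\<le>u. \<forall>ts\<in>?J. a (t # ts) = 0"
  proof (rule ccontr)
    assume "\<not> ?thesis"
    then have ex: "\<exists>t. t \<le> u \<and> (\<exists>ts\<in>?J. a (t # ts) \<noteq> 0)" by auto
    define t0 where "t0 = (LEAST t. t \<le> u \<and> (\<exists>ts\<in>?J. a (t # ts) \<noteq> 0))"
    have t0: "t0 \<le> u" "\<exists>ts\<in>?J. a (t0 # ts) \<noteq> 0"
      using LeastI_ex[OF ex] unfolding t0_def by blast+
    have lt: "a (t # ts) = 0" if "t < t0" "ts \<in> ?J" for t ts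
      using not_less_Least[OF that(1)[unfolded t0_def]] that t0(1) by auto
    \<comment> \<open>\<open>H\<close> is the relation divided by \<open>f l ^ t0\<close>. All its
      terms have the same degree because \<open>G t\<close> has degree
      \<open>L - t * s l\<close>.\<close>
    define H where "H = (\<lambda>x. \<Sum>t\<in>{t0..u}. f l x ^ (t - t0) * G t x)"
    have H: "H \<in> form (L - t0 * s l)"
      unfolding H_def
    proof (rule form_sum)
      fix t assume t: "t \<in> {t0..u}"
      have "(\<lambda>x. f l x ^ (t - t0) * G t x) \<in> form ((t - t0) * s l + (L - t * s l))"
        using t Suc.prems(4) G by (intro form_mult form_power) auto
      moreover have "(t - t0) * s l + (L - t * s l) = L - t0 * s l"
      proof -
        have "t * s l \<le> L" using t tL[of t] order_trans[OF tL[of t], of L] L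
          by (simp del: mult_le_cancel2)
        moreover have "(t - t0) * s l = t * s l - t0 * s l" "t0 * s l \<le> t * s l"
          using t by (simp_all add: diff_mult_distrib)
        ultimately show ?thesis by linarith
      qed
      ultimately show "(\<lambda>x. f l x ^ (t - t0) * G t x) \<in> form (L - t0 * s l)" by simp
    qed
    have fH: "f l x ^ t0 * H x = 0" if "p \<in> Z (Suc l)" "x \<in> p" for p x
    proof -
      have "(\<Sum>t\<le>u. f l x ^ t * G t x) = (\<Sum>t\<in>{t0..u}. f l x ^ t * G t x)"
        by (rule sum.mono_neutral_right) (auto simp: G_def lt)
      also have "\<dots> = f l x ^ t0 * H x"
        unfolding H_def sum_distrib_left
      proof (rule sum.cong[OF refl])
        fix t assume "t \<in> {t0..u}"
        then have "f l x ^ t = f l x ^ t0 * f l x ^ (t - t0)" by (simp flip: power_add)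
        then show "f l x ^ t * G t x = f l x ^ t0 * (f l x ^ (t - t0) * G t x)" by simp
      qed
      finally show ?thesis using Suc.prems(10)[OF that] sum_eq by simp
    qed
    have "(\<lambda>x. f l x ^ t0) \<in> form (t0 * s l)" using Suc.prems(4) by (intro form_power) auto
    then have "(\<forall>p\<in>Z (Suc l). \<forall>x\<in>p. f l x ^ t0 = 0) \<or> (\<forall>p\<in>Z (Suc l). \<forall>x\<in>p. H x = 0)"
      using fH by (rule zariski_irreducible_mult[OF Suc.prems(1)[OF order_refl] _ H Suc.prems(2)[OF order_refl]])
    moreover have "\<not> (\<forall>p\<in>Z (Suc l). \<forall>x\<in>p. f l x ^ t0 = 0)"
      using Suc.prems(6)[of l] by (metis lessI power_not_zero)
    ultimately have H0: "\<forall>p\<in>Z (Suc l). \<forall>x\<in>p. H x = 0" by blast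
    \<comment> \<open>On \<open>Z l\<close> only the term \<open>t = t0\<close> of \<open>H\<close>
      survives, because there \<open>0 ^ 0 = 1\<close>.\<close>
    have G0: "G t0 x = 0" if "p \<in> Z l" "x \<in> p" for p x
    proof -
      have "f l x = 0" using Suc.prems(5)[of l p x] that by simp
      have "H x = (\<Sum>t\<in>{t0}. f l x ^ (t - t0) * G t x)"
        unfolding H_def using t0 \<open>f l x = 0\<close> by (intro sum.mono_neutral_right) auto
      then show ?thesis using H0 Suc.prems(3)[of l] that by auto
    qed
    have "a (t0 # ts) = 0" if "ts \<in> ?J" for ts
    proof (rule Suc.IH[where L = "L - t0 * s l" and a = "\<lambda>ts. a (t0 # ts)"])
      show "u * (\<Sum>j<l. s j) \<le> L - t0 * s l" using tL[OF t0(1)] L by linarith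
      show "(\<Sum>ts\<in>?J. a (t0 # ts) * chain_form f s x0 ts (L - t0 * s l) x) = 0"
        if "p \<in> Z l" "x \<in> p" for p x
        using G0[OF that] unfolding G_def .
      show "set ts \<subseteq> {..u}" "length ts = l" using that by auto
    qed (use Suc.prems(1-8) in \<open>simp_all add: less_Suc_eq\<close>)
    then show False using t0(2) by blast
  qed
  moreover obtain t ts where "us = t # ts" using Suc.prems(12) by (cases us) auto
  ultimately show ?case using Suc.prems(11,12) by auto
qed


text \<open>The constant \<open>c\<close> is the sum of the degrees of the forms \<open>f j\<close>.
  It depends on the chain but not on \<open>u\<close>, and this linear growth of the degree is what
  the counting argument in \<open>chain_length_le\<close> needs. Independence on \<open>Z l\<close>
  is weakened to independence on the larger set \<open>S\<close>.\<close>

lemma chain_independent_forms: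
  assumes S: "S \<subseteq> proj_point ` (- {0})"
    and Z: "\<And>j. j \<le> l \<Longrightarrow> zariski_closed_in S (Z j)" "\<And>j. j \<le> l \<Longrightarrow> zariski_irreducible (Z j)"
    "\<And>j. j < l \<Longrightarrow> Z j \<subset> Z (Suc j)"
  obtains c h where "\<And>u ts. set ts \<subseteq> {..u} \<Longrightarrow> length ts = l \<Longrightarrow> h u ts \<in> form (u * c)"
    "\<And>u a us. (\<And>p x. p \<in> S \<Longrightarrow> x \<in> p \<Longrightarrow>
        (\<Sum>ts\<in>{ts. set ts \<subseteq> {..u} \<and> length ts = l}. a ts * h u ts x) = 0) \<Longrightarrow>
      set us \<subseteq> {..u} \<Longrightarrow> length us = l \<Longrightarrow> a us = (0::complex)"
proof -
  have ZS: "Z j \<subseteq> S" if "j \<le> l" for j using Z(1)[OF that] zariski_closed_in_subset by blast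
  have "\<exists>f s. f \<in> form s \<and> (\<forall>p\<in>Z j. \<forall>x\<in>p. f x = 0) \<and> (\<exists>p\<in>Z (Suc j). \<exists>x\<in>p. f x \<noteq> 0)"
    if j: "j < l" for j
  proof -
    have "zariski_closed_in S (Z j)" using Z(1) j by simp
    then obtain \<F> where F: "\<forall>f\<in>\<F>. \<exists>s. f \<in> form s" "Z j = {p \<in> S. \<forall>f\<in>\<F>. \<forall>x\<in>p. f x = 0}"
      using zariski_closed_inE by blast
    obtain p where p: "p \<in> Z (Suc j)" "p \<notin> Z j" using Z(3)[OF j] by blast
    then have "p \<in> S" using ZS[of "Suc j"] j by auto
    then obtain f x where f: "f \<in> \<F>" "x \<in> p" "f x \<noteq> 0" using p F(2) by auto
    moreover have "\<forall>p\<in>Z j. \<forall>x\<in>p. f x = 0" using f(1) F(2) by auto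
    ultimately show ?thesis using F(1) p(1) by blast
  qed
  then obtain f s where f: "\<And>j. j < l \<Longrightarrow> f j \<in> form (s j)"
    "\<And>j. j < l \<Longrightarrow> (\<forall>p\<in>Z j. \<forall>x\<in>p. f j x = 0)"
    "\<And>j. j < l \<Longrightarrow> (\<exists>p\<in>Z (Suc j). \<exists>x\<in>p. f j x \<noteq> 0)"
    by metis
  obtain p where p: "p \<in> Z 0" using Z(2)[of 0] by (auto simp: zariski_irreducible_def)
  then have "p \<in> S" using ZS[of 0] by auto
  then obtain v where v: "p = proj_point v" "v \<noteq> 0" using S by auto
  then obtain i where i: "v i \<noteq> 0" by (auto simp: fun_eq_iff)
  have x0: "\<exists>p\<in>Z 0. \<exists>x\<in>p. x i \<noteq> 0"
    using p i v(1) by (intro bexI[of _ p] bexI[of _ v]) auto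
  let ?c = "\<Sum>j<l. s j"
  let ?h = "\<lambda>u ts. chain_form f s (\<lambda>x. x i) ts (u * ?c)"
  show ?thesis
  proof (rule that)
    show "?h u ts \<in> form (u * ?c)" if "set ts \<subseteq> {..u}" "length ts = l" for u ts
      using that f(1) form_coord by (intro chain_form_in_form[where u = u]) auto
    fix u us and a :: "nat list \<Rightarrow> complex"
    assume a: "\<And>p x. p \<in> S \<Longrightarrow> x \<in> p \<Longrightarrow>
        (\<Sum>ts\<in>{ts. set ts \<subseteq> {..u} \<and> length ts = l}. a ts * ?h u ts x) = 0"
      and us: "set us \<subseteq> {..u}" "length us = l"
    show "a us = 0"
    proof (rule chain_form_independent[where Z = Z and f = f and s = s and ?x0.0 = "\<lambda>x. x i" and u = u and L = "u * ?c"])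
      show "Z j \<subseteq> range proj_point" if "j \<le> l" for j using ZS[OF that] S by auto
      show "(\<Sum>ts\<in>{ts. set ts \<subseteq> {..u} \<and> length ts = l}. a ts * ?h u ts x) = 0"
        if "p \<in> Z l" "x \<in> p" for p x by (rule a) (use that ZS[of l] in auto)
      show "\<exists>p\<in>Z 0. \<exists>x\<in>p. x i \<noteq> 0" by (rule x0)
      show "Z j \<subseteq> Z (Suc j)" if "j < l" for j using Z(3)[OF that] by blast
    qed (use Z(2) f us form_coord in auto)
  qed
qed


section \<open>The cone over a Segre-Veronese variety\<close>

definition upd2 :: "('a \<Rightarrow> 'b \<Rightarrow> 'c) \<Rightarrow> 'a \<Rightarrow> 'b \<Rightarrow> 'c \<Rightarrow> 'a \<Rightarrow> 'b \<Rightarrow> 'c" where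
  "upd2 y i j t = y(i := (y i)(j := t))"

lemma upd2_apply: "upd2 y i j t i' j' = (if i' = i \<and> j' = j then t else y i' j')"
  by (simp add: upd2_def)

lemma upd2_same [simp]: "upd2 y i j t i j = t"
  by (simp add: upd2_def)

lemma upd2_triv [simp]: "upd2 y i j (y i j) = y"
  by (simp add: upd2_def)

context
  fixes k :: nat and n :: "nat \<Rightarrow> nat"
begin

definition mon :: "(nat \<Rightarrow> nat \<Rightarrow> complex) \<Rightarrow> (nat \<Rightarrow> nat \<Rightarrow> nat) \<Rightarrow> complex" where
  "mon y e = (\<Prod>i<k. \<Prod>j\<le>n i. y i j ^ e i j)"

text \<open>\<open>Dv d y i j\<close> is the partial derivative of \<open>nu d\<close> with respect to \<open>y i j\<close>.\<close>

definition Dv :: "(nat \<Rightarrow> nat) \<Rightarrow> (nat \<Rightarrow> nat \<Rightarrow> complex) \<Rightarrow> nat \<Rightarrow> nat \<Rightarrow> (nat \<Rightarrow> nat \<Rightarrow> nat) \<Rightarrow> complex" where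
  "Dv d y i j = (\<lambda>e. if e \<in> multi_exponents k n d
     then of_nat (e i j) * mon y (upd2 e i j (e i j - 1)) else 0)"

text \<open>Says that \<open>y\<close> consists of homogeneous coordinates of a point of the
  product. Entries outside the index range are unconstrained, unlike in
  \<open>proj_space\<close>.\<close>

definition valid :: "(nat \<Rightarrow> nat \<Rightarrow> complex) \<Rightarrow> bool" where
  "valid y \<longleftrightarrow> (\<forall>i<k. \<exists>j\<le>n i. y i j \<noteq> 0)"

text \<open>A vertex of the polytope of exponents. Its monomial is a product of powers of the
  coordinates \<open>y i (J i)\<close>, so it does not vanish at \<open>y\<close> when these are
  nonzero.\<close>

definition top_exponent :: "(nat \<Rightarrow> nat) \<Rightarrow> (nat \<Rightarrow> nat) \<Rightarrow> nat \<Rightarrow> nat \<Rightarrow> nat" where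
  "top_exponent d J = (\<lambda>i j. if i < k \<and> j = J i then d i else 0)"

abbreviation exps :: "(nat \<Rightarrow> nat) \<Rightarrow> (nat \<Rightarrow> nat \<Rightarrow> nat) set" where
  "exps d \<equiv> multi_exponents k n d"

abbreviation nu :: "(nat \<Rightarrow> nat) \<Rightarrow> (nat \<Rightarrow> nat \<Rightarrow> complex) \<Rightarrow> (nat \<Rightarrow> nat \<Rightarrow> nat) \<Rightarrow> complex" where
  "nu d \<equiv> multi_monomials k n d"

abbreviation pt :: "(nat \<Rightarrow> nat) \<Rightarrow> (nat \<Rightarrow> nat \<Rightarrow> complex) \<Rightarrow> ((nat \<Rightarrow> nat \<Rightarrow> nat) \<Rightarrow> complex) set" where
  "pt d y \<equiv> proj_point (nu d y)"

lemma nu_apply: "nu d y e = (if e \<in> exps d then mon y e else 0)"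
  by (simp add: multi_monomials_def mon_def)

lemma nu_in_coord_space: "nu d y \<in> coord_space (exps d)"
  by (simp add: coord_space_def nu_apply)

lemma mon_add: "mon y (e + e') = mon y e * mon y e'"
  by (simp add: mon_def power_add prod.distrib)

lemma mon_upd2:
  assumes "i < k" "j \<le> n i"
  shows "mon y (upd2 e i j c) = y i j ^ c * mon y (upd2 e i j 0)"
proof -
  have "mon y (upd2 e i j c) = y i j ^ c * (\<Prod>j'\<in>{..n i} - {j}. y i j' ^ e i j') *
      (\<Prod>i'\<in>{..<k} - {i}. \<Prod>j'\<le>n i'. y i' j' ^ e i' j')" for c
  proof -
    have "mon y (upd2 e i j c) = (\<Prod>j'\<le>n i. y i j' ^ upd2 e i j c i j') *
      (\<Prod>i'\<in>{..<k} - {i}. \<Prod>j'\<le>n i'. y i' j' ^ upd2 e i j c i' j')"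
      unfolding mon_def using assms by (intro prod.remove) auto
    also have "(\<Prod>j'\<le>n i. y i j' ^ upd2 e i j c i j') =
        y i j ^ c * (\<Prod>j'\<in>{..n i} - {j}. y i j' ^ upd2 e i j c i j')"
      using assms by (subst prod.remove[of _ j]) auto
    also have "(\<Prod>j'\<in>{..n i} - {j}. y i j' ^ upd2 e i j c i j') = (\<Prod>j'\<in>{..n i} - {j}. y i j' ^ e i j')"
      by (intro prod.cong) (auto simp: upd2_apply)
    also have "(\<Prod>i'\<in>{..<k} - {i}. \<Prod>j'\<le>n i'. y i' j' ^ upd2 e i j c i' j') =
        (\<Prod>i'\<in>{..<k} - {i}. \<Prod>j'\<le>n i'. y i' j' ^ e i' j')"
      by (intro prod.cong) (auto simp: upd2_apply)
    finally show ?thesis .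
  qed
  from this[of c] this[of 0] show ?thesis by simp
qed

lemma mon_split:
  assumes "i < k" "j \<le> n i"
  shows "mon y e = y i j ^ e i j * mon y (upd2 e i j 0)"
  using mon_upd2[OF assms, of y e "e i j"] by simp

lemma mon_cong:
  "(\<And>i j. i < k \<Longrightarrow> j \<le> n i \<Longrightarrow> e i j \<noteq> 0 \<Longrightarrow> y i j = y' i j) \<Longrightarrow> mon y e = mon y' e"
  unfolding mon_def by (intro prod.cong refl) (metis atMost_iff lessThan_iff power_0)

lemma mon_curve:
  assumes "i < k" "j \<le> n i"
  shows "mon (upd2 y i j t) e = t ^ e i j * mon y (upd2 e i j 0)"
proof -
  have "mon (upd2 y i j t) (upd2 e i j 0) = mon y (upd2 e i j 0)"
    by (rule mon_cong) (auto simp: upd2_apply split: if_splits)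
  then show ?thesis using mon_split[OF assms, of "upd2 y i j t" e] by simp
qed

lemma nu_curve_deriv:
  assumes "i < k" "j \<le> n i"
  shows "((\<lambda>t. nu d (upd2 y i j t) e) has_field_derivative Dv d y i j e) (at (y i j))"
proof (cases "e \<in> exps d")
  case True
  have "((\<lambda>t. t ^ e i j * mon y (upd2 e i j 0)) has_field_derivative
      of_nat (e i j) * y i j ^ (e i j - 1) * mon y (upd2 e i j 0)) (at (y i j))"
    by (auto intro!: derivative_eq_intros)
  moreover have "of_nat (e i j) * y i j ^ (e i j - 1) * mon y (upd2 e i j 0) = Dv d y i j e"
    using True mon_upd2[OF assms, of y e "e i j - 1"] by (simp add: Dv_def)
  ultimately show ?thesis using True by (simp add: nu_apply mon_curve[OF assms])
qed (simp add: nu_apply Dv_def)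

lemma mon_scale: "e \<in> exps d \<Longrightarrow> mon (\<lambda>i. cscale (c i) (y i)) e = (\<Prod>i<k. c i ^ d i) * mon y e"
  by (auto simp: mon_def multi_exponents_def power_mult_distrib prod.distrib simp flip: power_sum
      intro!: prod.cong)

lemma nu_scale: "nu d (\<lambda>i. cscale (c i) (y i)) = cscale (\<Prod>i<k. c i ^ d i) (nu d y)"
  by (auto simp: nu_apply mon_scale fun_eq_iff)

lemma nu_cong: "(\<And>i j. i < k \<Longrightarrow> j \<le> n i \<Longrightarrow> y i j = y' i j) \<Longrightarrow> nu d y = nu d y'"
  unfolding fun_eq_iff nu_apply using mon_cong by metis

lemma top_exponent_in: "(\<And>i. i < k \<Longrightarrow> J i \<le> n i) \<Longrightarrow> top_exponent d J \<in> exps d"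
  by (auto simp: multi_exponents_def top_exponent_def sum.delta)

lemma mon_top_exponent:
  "(\<And>i. i < k \<Longrightarrow> J i \<le> n i) \<Longrightarrow> mon y (top_exponent d J) = (\<Prod>i<k. y i (J i) ^ d i)"
  unfolding mon_def
proof (intro prod.cong refl)
  fix i assume J: "\<And>i. i < k \<Longrightarrow> J i \<le> n i" and "i \<in> {..<k}"
  then have i: "i < k" "J i \<le> n i" by auto
  have "(\<Prod>j\<le>n i. y i j ^ top_exponent d J i j) = (\<Prod>j\<le>n i. if j = J i then y i j ^ d i else 1)"
    using i by (intro prod.cong) (auto simp: top_exponent_def)
  then show "(\<Prod>j\<le>n i. y i j ^ top_exponent d J i j) = y i (J i) ^ d i"
    using i by (simp add: prod.delta)
qed

lemma validE:
  assumes "valid y"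
  obtains J where "\<And>i. i < k \<Longrightarrow> J i \<le> n i" "\<And>i. i < k \<Longrightarrow> y i (J i) \<noteq> 0"
  using assms unfolding valid_def by metis

lemma nu_top_nonzero:
  assumes "\<And>i. i < k \<Longrightarrow> J i \<le> n i" "\<And>i. i < k \<Longrightarrow> y i (J i) \<noteq> 0"
  shows "nu d y (top_exponent d J) \<noteq> 0"
  using assms by (simp add: nu_apply top_exponent_in mon_top_exponent)

lemma nu_nonzero: "valid y \<Longrightarrow> nu d y \<noteq> 0"
  by (metis validE nu_top_nonzero zero_fun_apply)

text \<open>Rescaling the coordinates in factor \<open>i\<close> by \<open>c i\<close> multiplies
  the vector of monomials by the product of the \<open>c i ^ d i\<close>, so the union in
  \<open>segre_veronese_map\<close> collapses to one class.\<close>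

lemma segre_veronese_eq: "segre_veronese k n d = {pt d y | y. valid y}"
proof (intro equalityI subsetI)
  fix p assume "p \<in> segre_veronese k n d"
  then obtain P where P: "P \<in> multi_proj_space k n" "p = segre_veronese_map k n d P"
    by (auto simp: segre_veronese_def)
  have "\<exists>v. v \<in> coord_space {..n i} \<and> v \<noteq> 0 \<and> P i = proj_point v" if "i < k" for i
    using P(1) that by (force simp: multi_proj_space_def proj_space_def PiE_def)
  then obtain y where y: "\<And>i. i < k \<Longrightarrow> y i \<in> coord_space {..n i}" "\<And>i. i < k \<Longrightarrow> y i \<noteq> 0"
    "\<And>i. i < k \<Longrightarrow> P i = proj_point (y i)" by metis
  have "valid y"
    unfolding valid_def
  proof (intro allI impI)
    fix i assume "i < k"
    then obtain j where "y i j \<noteq> 0" using y(2) by (metis ext zero_fun_apply)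
    then show "\<exists>j\<le>n i. y i j \<noteq> 0" using y(1)[OF \<open>i < k\<close>] by (auto simp: coord_space_def)
  qed
  have "pt d y' = pt d y" if "y' \<in> Pi {..<k} P" for y'
  proof -
    have "\<exists>c. c \<noteq> 0 \<and> y' i = cscale c (y i)" if "i < k" for i
      using \<open>y' \<in> Pi {..<k} P\<close> that y(3)[OF that] by (force simp: proj_point_def Pi_def)
    then obtain c where c: "\<And>i. i < k \<Longrightarrow> c i \<noteq> 0" "\<And>i. i < k \<Longrightarrow> y' i = cscale (c i) (y i)"
      by metis
    have "nu d y' = nu d (\<lambda>i. cscale (c i) (y i))" by (rule nu_cong) (simp add: c)
    also have "\<dots> = cscale (\<Prod>i<k. c i ^ d i) (nu d y)" by (rule nu_scale)
    finally show ?thesis using c(1) by (simp add: proj_point_cscale)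
  qed
  moreover have "y \<in> Pi {..<k} P" using y(3) by auto
  ultimately have "p = pt d y" unfolding P(2) segre_veronese_map_def by blast
  then show "p \<in> {pt d y | y. valid y}" using \<open>valid y\<close> by blast
next
  fix p assume "p \<in> {pt d y | y. valid y}"
  then obtain y where y: "p = pt d y" "valid y" by auto
  \<comment> \<open>Cutting off at \<open>n i\<close> puts the vector into
    \<open>coord_space\<close> and does not change its image.\<close>
  define w where "w = (\<lambda>i j. if j \<le> n i then y i j else 0)"
  define P where "P = (\<lambda>i\<in>{..<k}. proj_point (w i))"
  have "P i \<in> proj_space {..n i}" if "i < k" for i
  proof -
    have "w i \<in> coord_space {..n i}" by (auto simp: w_def coord_space_def)
    moreover obtain j where "j \<le> n i" "y i j \<noteq> 0" using y(2) \<open>i < k\<close> by (auto simp: valid_def)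
    then have "w i j \<noteq> 0" by (simp add: w_def)
    then have "w i \<noteq> 0" by (metis zero_fun_apply)
    ultimately show ?thesis using that by (auto simp: P_def proj_space_def)
  qed
  then have P: "P \<in> multi_proj_space k n" by (auto simp: multi_proj_space_def P_def)
  have "pt d y' = p" if "y' \<in> Pi {..<k} P" for y'
  proof -
    have "\<exists>c. c \<noteq> 0 \<and> y' i = cscale c (w i)" if "i < k" for i
      using \<open>y' \<in> Pi {..<k} P\<close> that by (force simp: proj_point_def Pi_def P_def)
    then obtain c where c: "\<And>i. i < k \<Longrightarrow> c i \<noteq> 0" "\<And>i. i < k \<Longrightarrow> y' i = cscale (c i) (w i)"
      by metis
    have "nu d y' = nu d (\<lambda>i. cscale (c i) (y i))" by (rule nu_cong) (simp add: c w_def)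
    also have "\<dots> = cscale (\<Prod>i<k. c i ^ d i) (nu d y)" by (rule nu_scale)
    finally show ?thesis using c(1) by (simp add: proj_point_cscale y)
  qed
  moreover have "w \<in> Pi {..<k} P" by (auto simp: P_def)
  ultimately have "p = segre_veronese_map k n d P" unfolding segre_veronese_map_def by blast
  then show "p \<in> segre_veronese k n d" using P by (auto simp: segre_veronese_def)
qed

lemma segre_veronese_proj_point: "segre_veronese k n d \<subseteq> proj_point ` (- {0})"
  by (auto simp: segre_veronese_eq nu_nonzero)

text \<open>In each factor the last exponent is determined by the others and the degree, so there
  are only \<open>n i\<close> free exponents, each at most \<open>M\<close>. This makes the number
  of forms grow with an exponent equal to the dimension.\<close>

lemma finite_exps_card:
  assumes "\<And>i. i < k \<Longrightarrow> d i \<le> M"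
  shows "finite (exps d)" "card (exps d) \<le> (M + 1) ^ (\<Sum>i<k. n i)"
proof -
  let ?I = "SIGMA i:{..<k}. {..<n i}"
  let ?T = "PiE ?I (\<lambda>_. {..M})"
  let ?f = "\<lambda>e. restrict (\<lambda>(i, j). e i j) ?I"
  have le: "e i j \<le> d i" if "e \<in> exps d" "i < k" "j \<le> n i" for e i j
  proof -
    have "e i j \<le> (\<Sum>j\<le>n i. e i j)" using that by (intro member_le_sum) auto
    then show ?thesis using that by (simp add: multi_exponents_def)
  qed
  have inj: "inj_on ?f (exps d)"
  proof (rule inj_onI, intro ext)
    fix e e' i j assume e: "e \<in> exps d" "e' \<in> exps d" "?f e = ?f e'"
    have lt: "e i j = e' i j" if "i < k" "j < n i" for i j
      using fun_cong[OF e(3), of "(i, j)"] that by simp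
    show "e i j = e' i j"
    proof (cases "i < k \<and> j \<le> n i")
      case True
      show ?thesis
      proof (cases "j = n i")
        case True
        have "(\<Sum>j\<le>n i. e i j) = (\<Sum>j\<le>n i. e' i j)"
          using e(1,2) \<open>i < k \<and> j \<le> n i\<close> by (simp add: multi_exponents_def)
        moreover have "{..n i} = insert (n i) {..<n i}" by auto
        moreover have "(\<Sum>j<n i. e i j) = (\<Sum>j<n i. e' i j)"
          using lt \<open>i < k \<and> j \<le> n i\<close> by (intro sum.cong) auto
        ultimately show ?thesis using True by simp
      qed (use lt True in auto)
    qed (use e(1,2) in \<open>auto simp: multi_exponents_def\<close>)
  qed
  have sub: "?f ` exps d \<subseteq> ?T"
  proof (intro image_subsetI PiE_I)
    fix e x assume e: "e \<in> exps d" and x: "x \<in> ?I"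
    then obtain i j where ij: "x = (i, j)" "i < k" "j < n i" by auto
    then have "e i j \<le> M" using le[OF e, of i j] assms[of i] by simp
    then show "?f e x \<in> {..M}" using ij by simp
  qed auto
  have fT: "finite ?T" by (intro finite_PiE) auto
  show "finite (exps d)" using finite_imageD[OF finite_subset[OF sub fT] inj] .
  have "card (exps d) \<le> card ?T" using card_inj_on_le[OF inj sub fT] .
  also have "card ?T = (M + 1) ^ card ?I" by (simp add: card_PiE)
  also have "card ?I = (\<Sum>i<k. n i)" by simp
  finally show "card (exps d) \<le> (M + 1) ^ (\<Sum>i<k. n i)" .
qed

lemma finite_exps [simp]: "finite (exps d)"
proof (rule finite_exps_card)
  fix i assume "i < k"
  then show "d i \<le> (\<Sum>i<k. d i)" by (intro member_le_sum) auto
qed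

end

section \<open>Tangent spaces\<close>

text \<open>A chain rule whose coefficients \<open>g\<close> depend on the point but not on the
  curve. The functions with such a rule contain the constants and the coordinates and are closed
  under sums and products.\<close>

lemma mpoly_eval_curve_aux:
  assumes "finite V" "\<And>m. m \<in> Poly_Mapping.keys F \<Longrightarrow> Poly_Mapping.keys m \<subseteq> V"
  shows "\<exists>g. \<forall>\<gamma> \<gamma>' t0. (\<forall>e\<in>V. ((\<lambda>t. \<gamma> t e) has_field_derivative \<gamma>' e) (at t0)) \<longrightarrow>
    ((\<lambda>t. mpoly_eval F (\<gamma> t)) has_field_derivative (\<Sum>e\<in>V. g (\<gamma> t0) e * \<gamma>' e)) (at t0)"
proof -
  define Q :: "(('a \<Rightarrow> complex) \<Rightarrow> complex) \<Rightarrow> bool" where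
    "Q f \<longleftrightarrow> (\<exists>g. \<forall>\<gamma> \<gamma>' t0. (\<forall>e\<in>V. ((\<lambda>t. \<gamma> t e) has_field_derivative \<gamma>' e) (at t0)) \<longrightarrow>
      ((\<lambda>t. f (\<gamma> t)) has_field_derivative (\<Sum>e\<in>V. g (\<gamma> t0) e * \<gamma>' e)) (at t0))" for f
  have const: "Q (\<lambda>x. c)" for c
    unfolding Q_def by (rule exI[of _ "\<lambda>_ _. 0"]) simp
  have coord: "Q (\<lambda>x. x i)" if "i \<in> V" for i
    unfolding Q_def
  proof (intro exI[of _ "\<lambda>_ e. if e = i then 1 else 0"] allI impI)
    fix \<gamma> :: "complex \<Rightarrow> 'a \<Rightarrow> complex" and \<gamma>' t0
    assume *: "\<forall>e\<in>V. ((\<lambda>t. \<gamma> t e) has_field_derivative \<gamma>' e) (at t0)"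
    have "(\<Sum>e\<in>V. (if e = i then 1 else 0) * \<gamma>' e) = (\<Sum>e\<in>V. if e = i then \<gamma>' e else 0)"
      by (intro sum.cong) auto
    also have "\<dots> = \<gamma>' i" using assms(1) that by simp
    finally show "((\<lambda>t. \<gamma> t i) has_field_derivative
        (\<Sum>e\<in>V. (if e = i then 1 else 0) * \<gamma>' e)) (at t0)"
      using * that by simp
  qed
  have mult: "Q (\<lambda>x. f x * g x)" if "Q f" "Q g" for f g
  proof -
    obtain df where df: "\<forall>\<gamma> \<gamma>' t0. (\<forall>e\<in>V. ((\<lambda>t. \<gamma> t e) has_field_derivative \<gamma>' e) (at t0)) \<longrightarrow>
      ((\<lambda>t. f (\<gamma> t)) has_field_derivative (\<Sum>e\<in>V. df (\<gamma> t0) e * \<gamma>' e)) (at t0)"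
      using \<open>Q f\<close> unfolding Q_def by blast
    obtain dg where dg: "\<forall>\<gamma> \<gamma>' t0. (\<forall>e\<in>V. ((\<lambda>t. \<gamma> t e) has_field_derivative \<gamma>' e) (at t0)) \<longrightarrow>
      ((\<lambda>t. g (\<gamma> t)) has_field_derivative (\<Sum>e\<in>V. dg (\<gamma> t0) e * \<gamma>' e)) (at t0)"
      using \<open>Q g\<close> unfolding Q_def by blast
    show ?thesis
      unfolding Q_def
    proof (intro exI[of _ "\<lambda>x e. df x e * g x + dg x e * f x"] allI impI)
      fix \<gamma> :: "complex \<Rightarrow> 'a \<Rightarrow> complex" and \<gamma>' t0
      assume *: "\<forall>e\<in>V. ((\<lambda>t. \<gamma> t e) has_field_derivative \<gamma>' e) (at t0)"
      show "((\<lambda>t. f (\<gamma> t) * g (\<gamma> t)) has_field_derivative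
        (\<Sum>e\<in>V. (df (\<gamma> t0) e * g (\<gamma> t0) + dg (\<gamma> t0) e * f (\<gamma> t0)) * \<gamma>' e)) (at t0)"
        using DERIV_mult[OF df[rule_format, of \<gamma> \<gamma>' t0] dg[rule_format, of \<gamma> \<gamma>' t0]] *
        by (simp add: sum_distrib_left sum_distrib_right sum.distrib algebra_simps)
    qed
  qed
  have add: "Q (\<lambda>x. f x + g x)" if "Q f" "Q g" for f g
  proof -
    obtain df where df: "\<forall>\<gamma> \<gamma>' t0. (\<forall>e\<in>V. ((\<lambda>t. \<gamma> t e) has_field_derivative \<gamma>' e) (at t0)) \<longrightarrow>
      ((\<lambda>t. f (\<gamma> t)) has_field_derivative (\<Sum>e\<in>V. df (\<gamma> t0) e * \<gamma>' e)) (at t0)"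
      using \<open>Q f\<close> unfolding Q_def by blast
    obtain dg where dg: "\<forall>\<gamma> \<gamma>' t0. (\<forall>e\<in>V. ((\<lambda>t. \<gamma> t e) has_field_derivative \<gamma>' e) (at t0)) \<longrightarrow>
      ((\<lambda>t. g (\<gamma> t)) has_field_derivative (\<Sum>e\<in>V. dg (\<gamma> t0) e * \<gamma>' e)) (at t0)"
      using \<open>Q g\<close> unfolding Q_def by blast
    show ?thesis
      unfolding Q_def
    proof (intro exI[of _ "\<lambda>x e. df x e + dg x e"] allI impI)
      fix \<gamma> :: "complex \<Rightarrow> 'a \<Rightarrow> complex" and \<gamma>' t0
      assume *: "\<forall>e\<in>V. ((\<lambda>t. \<gamma> t e) has_field_derivative \<gamma>' e) (at t0)"
      show "((\<lambda>t. f (\<gamma> t) + g (\<gamma> t)) has_field_derivative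
        (\<Sum>e\<in>V. (df (\<gamma> t0) e + dg (\<gamma> t0) e) * \<gamma>' e)) (at t0)"
        using DERIV_add[OF df[rule_format, of \<gamma> \<gamma>' t0] dg[rule_format, of \<gamma> \<gamma>' t0]] *
        by (simp add: sum.distrib algebra_simps)
    qed
  qed
  have power: "Q (\<lambda>x. f x ^ m)" if "Q f" for f and m :: nat
    by (induction m) (auto intro: const mult that)
  have prod: "Q (\<lambda>x. \<Prod>i\<in>I. f i x)" if "\<And>i. i \<in> I \<Longrightarrow> Q (f i)" for I :: "'a set" and f
    using that by (induction I rule: infinite_finite_induct) (auto intro: const mult)
  have sum: "Q (\<lambda>x. \<Sum>i\<in>I. f i x)" if "\<And>i. i \<in> I \<Longrightarrow> Q (f i)" for I :: "('a \<Rightarrow>\<^sub>0 nat) set" and f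
    using that by (induction I rule: infinite_finite_induct) (auto intro: const add)
  have "Q (mpoly_eval F)"
    unfolding mpoly_eval_def using assms(2) by (intro sum mult const prod power coord) auto
  then show ?thesis unfolding Q_def .
qed

text \<open>Testing the chain rule on curves that move a single coordinate identifies its
  coefficients with \<open>partial_deriv\<close>.\<close>

lemma mpoly_eval_curve:
  assumes I: "finite I" and \<gamma>: "\<And>t. \<gamma> t \<in> coord_space I"
    and der: "\<And>e. e \<in> I \<Longrightarrow> ((\<lambda>t. \<gamma> t e) has_field_derivative \<gamma>' e) (at t0)"
  shows "((\<lambda>t. mpoly_eval F (\<gamma> t)) has_field_derivative
    (\<Sum>i\<in>I. partial_deriv i F (\<gamma> t0) * \<gamma>' i)) (at t0)"
proof -
  \<comment> \<open>\<open>F\<close> may involve labels outside \<open>I\<close>; there the curve is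
    constantly zero and contributes nothing.\<close>
  let ?V = "I \<union> (\<Union>m\<in>Poly_Mapping.keys F. Poly_Mapping.keys m)"
  have fin: "finite ?V" using I by auto
  have "Poly_Mapping.keys m \<subseteq> ?V" if "m \<in> Poly_Mapping.keys F" for m using that by auto
  from mpoly_eval_curve_aux[OF fin this]
  obtain g where g: "\<forall>\<gamma> \<gamma>' t0. (\<forall>e\<in>?V. ((\<lambda>t. \<gamma> t e) has_field_derivative \<gamma>' e) (at t0)) \<longrightarrow>
    ((\<lambda>t. mpoly_eval F (\<gamma> t)) has_field_derivative (\<Sum>e\<in>?V. g (\<gamma> t0) e * \<gamma>' e)) (at t0)" ..
  have pd: "partial_deriv i F x = g x i" if "i \<in> ?V" for i x
  proof -
    have "((\<lambda>t. mpoly_eval F (x(i := t))) has_field_derivative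
        (\<Sum>e\<in>?V. g (x(i := x i)) e * (if e = i then 1 else 0))) (at (x i))"
      by (rule g[rule_format]) (auto intro: derivative_eq_intros)
    moreover have "(\<Sum>e\<in>?V. g (x(i := x i)) e * (if e = i then 1 else 0)) = g x i"
      using that fin by (simp add: if_distrib sum.delta cong: if_cong)
    ultimately show ?thesis unfolding partial_deriv_def by (simp add: DERIV_imp_deriv)
  qed
  have "((\<lambda>t. mpoly_eval F (\<gamma> t)) has_field_derivative
      (\<Sum>e\<in>?V. g (\<gamma> t0) e * (if e \<in> I then \<gamma>' e else 0))) (at t0)"
  proof (rule g[rule_format])
    fix e assume "e \<in> ?V"
    have "(\<lambda>t. \<gamma> t e) = (\<lambda>t. 0)" if "e \<notin> I" using \<gamma> that by (auto simp: coord_space_def)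
    then show "((\<lambda>t. \<gamma> t e) has_field_derivative (if e \<in> I then \<gamma>' e else 0)) (at t0)"
      using der by auto
  qed
  also have "(\<Sum>e\<in>?V. g (\<gamma> t0) e * (if e \<in> I then \<gamma>' e else 0)) = (\<Sum>e\<in>I. g (\<gamma> t0) e * \<gamma>' e)"
    using fin by (intro sum.mono_neutral_cong_right) auto
  also have "\<dots> = (\<Sum>i\<in>I. partial_deriv i F (\<gamma> t0) * \<gamma>' i)"
    by (intro sum.cong) (auto simp: pd)
  finally show ?thesis .
qed

lemma subspace_tangent_space: "cfun.subspace (tangent_space I X p)"
proof (rule cfun.subspaceI)
  show "0 \<in> tangent_space I X p" by (simp add: tangent_space_def coord_space_def)
next
  fix v w assume "v \<in> tangent_space I X p" "w \<in> tangent_space I X p"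
  then show "v + w \<in> tangent_space I X p"
    by (simp add: tangent_space_def coord_space_def distrib_left sum.distrib)
next
  fix c v assume "v \<in> tangent_space I X p"
  moreover have "(\<Sum>i\<in>I. a i * (c * v i)) = c * (\<Sum>i\<in>I. a i * v i)" for a
    by (simp add: sum_distrib_left algebra_simps)
  ultimately show "cscale c v \<in> tangent_space I X p"
    by (simp add: tangent_space_def coord_space_def)
qed


section \<open>Tangent spaces of the Segre-Veronese variety\<close>

lemma sum_fun_upd_nat:
  fixes f :: "'a \<Rightarrow> nat"
  assumes "finite A" "j \<in> A"
  shows "sum (f(j := c)) A + f j = sum f A + c"
proof -
  have "sum (f(j := c)) A = c + sum f (A - {j})"
    using assms by (simp add: sum.remove)
  moreover have "sum f A = f j + sum f (A - {j})"
    using assms by (simp add: sum.remove)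
  ultimately show ?thesis by simp
qed

context
  fixes k :: nat and n :: "nat \<Rightarrow> nat"
begin

text \<open>A step to a neighbouring exponent: the monomial is divided by \<open>y i j\<close> and
  multiplied by \<open>y i j'\<close>.\<close>

definition move :: "(nat \<Rightarrow> nat \<Rightarrow> nat) \<Rightarrow> nat \<Rightarrow> nat \<Rightarrow> nat \<Rightarrow> nat \<Rightarrow> nat \<Rightarrow> nat" where
  "move e i j j' = upd2 (upd2 e i j (e i j - 1)) i j' (e i j' + 1)"

lemma move_in:
  assumes e: "e \<in> multi_exponents k n d" and ij: "i < k" "j \<le> n i" "j' \<le> n i" "j \<noteq> j'" "e i j \<noteq> 0"
  shows "move e i j j' \<in> multi_exponents k n d"
proof -
  have "(\<Sum>l\<le>n i'. move e i j j' i' l) = d i'" if "i' < k" for i'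
  proof (cases "i' = i")
    case True
    define f where "f = (e i)(j := e i j - 1)"
    define g where "g = f(j' := e i j' + 1)"
    have "move e i j j' i = g"
      using ij by (simp add: move_def upd2_def f_def g_def)
    moreover have "sum g {..n i} + f j' = sum f {..n i} + (e i j' + 1)"
      unfolding g_def using ij by (intro sum_fun_upd_nat) auto
    moreover have "sum f {..n i} + e i j = sum (e i) {..n i} + (e i j - 1)"
      unfolding f_def using ij by (intro sum_fun_upd_nat) auto
    moreover have "sum (e i) {..n i} = d i" using e ij by (simp add: multi_exponents_def)
    moreover have "f j' = e i j'" using ij by (simp add: f_def)
    ultimately have "move e i j j' i = g" "sum g {..n i} = d i" using ij by (simp, linarith)
    then show ?thesis using True by simp
  next
    case False
    then have "move e i j j' i' = e i'" by (simp add: move_def upd2_def)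
    then show ?thesis using e that by (simp add: multi_exponents_def)
  qed
  then show ?thesis using e ij by (auto simp: multi_exponents_def move_def upd2_apply)
qed

text \<open>The binomial quadric \<open>z a * z b - z c * z e\<close> vanishes on \<open>X\<close>,
  since both products are the monomial with exponent \<open>a + b\<close>. The identity says that
  the differential of this quadric kills \<open>v\<close>.\<close>

lemma tangent_quadric:
  assumes v: "v \<in> tangent_space (multi_exponents k n d) (segre_veronese k n d) (pt k n d y)"
    and E: "a \<in> multi_exponents k n d" "b \<in> multi_exponents k n d" "c \<in> multi_exponents k n d" "e \<in> multi_exponents k n d"
    and eq: "a + b = c + e"
  shows "v a * multi_monomials k n d y b + multi_monomials k n d y a * v b =
    v c * multi_monomials k n d y e + multi_monomials k n d y c * v e"
proof -
  let ?E = "multi_exponents k n d" and ?z = "multi_monomials k n d y"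
  let ?m = "\<lambda>a b. Poly_Mapping.single a 1 + Poly_Mapping.single b (1::nat)"
  define F where "F = Poly_Mapping.single (?m a b) (1::complex) + Poly_Mapping.single (?m c e) (-1)"
  have single: "mfun (Poly_Mapping.single a 1) x = x a" "mdeg (Poly_Mapping.single a 1) = 1"
    for a and x :: "(nat \<Rightarrow> nat \<Rightarrow> nat) \<Rightarrow> complex"
    by (simp_all add: mfun_def mdeg_def)
  have F: "mpoly_eval F x = x a * x b - x c * x e" for x
    by (simp add: F_def mpoly_eval_add mpoly_eval_single mfun_add single del: One_nat_def)
  have "\<forall>m\<in>Poly_Mapping.keys F. mdeg m = 2"
  proof
    fix m assume "m \<in> Poly_Mapping.keys F"
    then have "m = ?m a b \<or> m = ?m c e"
      using Poly_Mapping.keys_add[of "Poly_Mapping.single (?m a b) (1::complex)" "Poly_Mapping.single (?m c e) (-1)"]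
      by (auto simp: F_def)
    then show "mdeg m = 2" by (auto simp: mdeg_add single simp del: One_nat_def)
  qed
  then have "homogeneous F" unfolding homogeneous_iff by blast
  moreover have "\<forall>q\<in>segre_veronese k n d. vanishes_at F q"
  proof (clarsimp simp: segre_veronese_eq vanishes_at_def)
    fix w x assume "x \<in> pt k n d w"
    then obtain r where x: "x = cscale r (multi_monomials k n d w)" by (auto simp: proj_point_def)
    have "mon k n w a * mon k n w b = mon k n w c * mon k n w e"
      using eq by (simp flip: mon_add)
    then show "mpoly_eval F x = 0" using E by (simp add: F x nu_apply)
  qed
  ultimately have T: "(\<Sum>i\<in>?E. partial_deriv i F ?z * v i) = 0"
    using v proj_point_self unfolding tangent_space_def by blast
  have vE: "v \<in> coord_space ?E" using v by (simp add: tangent_space_def)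
  \<comment> \<open>The derivative along the line through \<open>?z\<close> in direction
    \<open>v\<close> is computed twice: by the chain rule it is \<open>0\<close>, and directly it is
    the difference of the two sides.\<close>
  have "((\<lambda>t. mpoly_eval F (?z + cscale t v)) has_field_derivative
      (\<Sum>i\<in>?E. partial_deriv i F (?z + cscale 0 v) * v i)) (at 0)"
  proof (rule mpoly_eval_curve)
    show "?z + cscale t v \<in> coord_space ?E" for t
      using vE nu_in_coord_space[of k n d y] by (simp add: coord_space_def)
  qed (auto intro!: derivative_eq_intros)
  moreover have "?z + cscale 0 v = ?z" by (simp add: fun_eq_iff)
  ultimately have "((\<lambda>t. mpoly_eval F (?z + cscale t v)) has_field_derivative 0) (at 0)"
    using T by simp
  moreover have "((\<lambda>t. mpoly_eval F (?z + cscale t v)) has_field_derivative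
      (v a * ?z b + ?z a * v b - (v c * ?z e + ?z c * v e))) (at 0)"
    unfolding F by (auto intro!: derivative_eq_intros simp: algebra_simps)
  ultimately show ?thesis using DERIV_unique by fastforce
qed

text \<open>Moving a zero coordinate never destroys validity; moving a nonzero one is harmless as
  long as it stays nonzero. So coordinate curves remain on \<open>X\<close> locally.\<close>

lemma valid_near:
  assumes "valid k n y"
  shows "\<forall>\<^sub>F t in nhds (y i j). valid k n (upd2 y i j t)"
proof (cases "y i j = 0")
  case True
  have "valid k n (upd2 y i j t)" for t
    unfolding valid_def
  proof (intro allI impI)
    fix i' assume "i' < k"
    then obtain j' where j': "j' \<le> n i'" "y i' j' \<noteq> 0" using assms by (auto simp: valid_def)
    then have "upd2 y i j t i' j' \<noteq> 0" using True by (auto simp: upd2_apply)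
    then show "\<exists>j'\<le>n i'. upd2 y i j t i' j' \<noteq> 0" using j' by blast
  qed
  then show ?thesis by simp
next
  case False
  have "open (- {0::complex})" by (simp add: open_Compl)
  then have "\<forall>\<^sub>F t in nhds (y i j). t \<in> - {0}"
    using False by (intro eventually_nhds_in_open) auto
  then show ?thesis
  proof eventually_elim
    case (elim t)
    then have "upd2 y i j t i' j' \<noteq> 0" if "y i' j' \<noteq> 0" for i' j'
      using that by (auto simp: upd2_apply)
    then show ?case using assms unfolding valid_def by blast
  qed
qed

text \<open>An equation of \<open>X\<close> vanishes identically along the curve that moves
  \<open>y i j\<close>, so its derivative there is zero.\<close>

lemma Dv_in_tangent_space:
  assumes y: "valid k n y" and ij: "i < k" "j \<le> n i"
  shows "Dv k n d y i j \<in> tangent_space (multi_exponents k n d) (segre_veronese k n d) (pt k n d y)"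
proof -
  let ?E = "multi_exponents k n d" and ?z = "multi_monomials k n d"
  have "(\<Sum>e\<in>?E. partial_deriv e F x * Dv k n d y i j e) = 0"
    if F: "homogeneous F" "\<forall>q\<in>segre_veronese k n d. vanishes_at F q" and x: "x \<in> pt k n d y" for F x
  proof -
  obtain c where c: "c \<noteq> 0" "x = cscale c (?z y)" using x by (auto simp: proj_point_def)
  let ?\<gamma> = "\<lambda>t. cscale c (?z (upd2 y i j t))"
  have "((\<lambda>t. mpoly_eval F (?\<gamma> t)) has_field_derivative
      (\<Sum>e\<in>?E. partial_deriv e F (?\<gamma> (y i j)) * (c * Dv k n d y i j e))) (at (y i j))"
  proof (rule mpoly_eval_curve)
    show "?\<gamma> t \<in> coord_space ?E" for t
      using nu_in_coord_space[of k n d] by (simp add: coord_space_def)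
    fix e
    show "((\<lambda>t. ?\<gamma> t e) has_field_derivative c * Dv k n d y i j e) (at (y i j))"
      unfolding cscale_apply by (intro DERIV_cmult nu_curve_deriv ij)
  qed simp
  moreover have "\<forall>\<^sub>F t in nhds (y i j). mpoly_eval F (?\<gamma> t) = 0"
    using valid_near[OF y]
  proof eventually_elim
    case (elim t)
    then have "pt k n d (upd2 y i j t) \<in> segre_veronese k n d" by (auto simp: segre_veronese_eq)
    moreover have "?\<gamma> t \<in> pt k n d (upd2 y i j t)" using c(1) by (auto simp: proj_point_def)
    ultimately show ?case using F(2) by (auto simp: vanishes_at_def)
  qed
  then have "((\<lambda>t. mpoly_eval F (?\<gamma> t)) has_field_derivative 0) (at (y i j))"
    by (subst DERIV_cong_ev[OF refl _ refl, where g = "\<lambda>_. 0"]) auto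
  ultimately have "(\<Sum>e\<in>?E. partial_deriv e F (?\<gamma> (y i j)) * (c * Dv k n d y i j e)) = 0"
    by (rule DERIV_unique)
  also have "?\<gamma> (y i j) = x" by (simp add: c(2))
  finally have "c * (\<Sum>e\<in>?E. partial_deriv e F x * Dv k n d y i j e) = 0"
    by (simp add: sum_distrib_left mult.left_commute)
  then show ?thesis using c(1) by simp
  qed
  moreover have "Dv k n d y i j \<in> coord_space ?E" by (simp add: coord_space_def Dv_def)
  ultimately show ?thesis unfolding tangent_space_def by blast
qed

lemma euler_relation:
  assumes "i < k" "e \<in> multi_exponents k n d"
  shows "(\<Sum>j\<le>n i. y i j * Dv k n d y i j e) = of_nat (d i) * multi_monomials k n d y e"
proof -
  have "y i j * Dv k n d y i j e = of_nat (e i j) * mon k n y e" if "j \<le> n i" for j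
  proof (cases "e i j = 0")
    case False
    then have "y i j * mon k n y (upd2 e i j (e i j - 1)) = mon k n y e"
      using mon_upd2[where k = k and n = n, OF assms(1) that, of y e "e i j - 1"] mon_split[where k = k and n = n, OF assms(1) that, of y e]
      by (simp flip: mult.assoc power_Suc)
    then show ?thesis using assms(2) by (simp add: Dv_def mult.left_commute)
  qed (simp add: Dv_def)
  then have "(\<Sum>j\<le>n i. y i j * Dv k n d y i j e) = (\<Sum>j\<le>n i. of_nat (e i j) * mon k n y e)"
    by (intro sum.cong) auto
  also have "\<dots> = of_nat (\<Sum>j\<le>n i. e i j) * mon k n y e" by (simp add: sum_distrib_right)
  also have "(\<Sum>j\<le>n i. e i j) = d i" using assms by (simp add: multi_exponents_def)
  finally show ?thesis using assms(2) by (simp add: nu_apply)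
qed

text \<open>Euler's relation in factor \<open>0\<close>, divided by \<open>d 0\<close>.\<close>

lemma nu_in_span_Dv:
  assumes "0 < k" "d 0 \<noteq> 0"
  shows "multi_monomials k n d y \<in> cfun.span {Dv k n d y i j | i j. i < k \<and> j \<le> n i}"
proof -
  have "multi_monomials k n d y = cscale (1 / of_nat (d 0)) (\<Sum>j\<le>n 0. cscale (y 0 j) (Dv k n d y 0 j))"
  proof
    fix e
    show "multi_monomials k n d y e = cscale (1 / of_nat (d 0)) (\<Sum>j\<le>n 0. cscale (y 0 j) (Dv k n d y 0 j)) e"
    proof (cases "e \<in> multi_exponents k n d")
      case True
      then show ?thesis using euler_relation[OF assms(1) True, of y] assms(2) by (simp add: sum_fun_apply)
    next
      case False
      then show ?thesis by (simp add: sum_fun_apply nu_apply Dv_def)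
    qed
  qed
  moreover have "cscale (1 / of_nat (d 0)) (\<Sum>j\<le>n 0. cscale (y 0 j) (Dv k n d y 0 j))
      \<in> cfun.span {Dv k n d y i j | i j. i < k \<and> j \<le> n i}"
    using assms(1) by (intro cfun.span_scale cfun.span_sum cfun.span_base) auto
  ultimately show ?thesis by metis
qed

text \<open>A tangent vector is determined by its entries at a vertex and at the neighbours of this
  vertex in the direction of single coordinates. These are \<open>1 + (\<Sum>i<k. n i)\<close>
  entries, which bounds the dimension of the tangent space from above.\<close>

lemma tangent_vector_zero:
  assumes v: "v \<in> tangent_space (multi_exponents k n d) (segre_veronese k n d) (pt k n d y)"
    and J: "\<And>i. i < k \<Longrightarrow> J i \<le> n i" "\<And>i. i < k \<Longrightarrow> y i (J i) \<noteq> 0"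
    and d: "\<And>i. i < k \<Longrightarrow> d i \<noteq> 0"
    and v0: "v (top_exponent k d J) = 0"
    and v1: "\<And>i j. i < k \<Longrightarrow> j \<le> n i \<Longrightarrow> j \<noteq> J i \<Longrightarrow> v (move (top_exponent k d J) i (J i) j) = 0"
  shows "v = 0"
proof -
  let ?E = "multi_exponents k n d" and ?o = "top_exponent k d J" and ?z = "multi_monomials k n d y"
  have o: "?o \<in> ?E" using J(1) by (rule top_exponent_in)
  \<comment> \<open>For an exponent \<open>e\<close> in \<open>?E\<close> this is the degree of its
    monomial in the coordinates other than the \<open>y i (J i)\<close>, i.e. the distance from the
    vertex.\<close>
  define w where "w = (\<lambda>e :: nat \<Rightarrow> nat \<Rightarrow> nat. \<Sum>i<k. d i - e i (J i))"
  have main: "v e = 0" if "e \<in> ?E" for e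
    using that
  proof (induction "w e" arbitrary: e rule: less_induct)
    case less
    show ?case
    proof (cases "\<exists>i<k. \<exists>j\<le>n i. j \<noteq> J i \<and> e i j \<noteq> 0")
      case False
      have "e i j = ?o i j" for i j
      proof (cases "i < k \<and> j \<le> n i")
        case True
        have "(\<Sum>j\<le>n i. e i j) = (\<Sum>j\<le>n i. if j = J i then e i j else 0)"
          using False True by (intro sum.cong) auto
        also have "\<dots> = e i (J i)" using J(1) True by simp
        finally have "e i (J i) = d i" using less.prems True by (simp add: multi_exponents_def)
        then show ?thesis using False True by (auto simp: top_exponent_def)
      next
        case False
        then show ?thesis using less.prems J(1) by (auto simp: multi_exponents_def top_exponent_def)
      qed
      then have "e = ?o" by blast
      then show ?thesis using v0 by simp
    next
      case True
      then obtain i j where ij: "i < k" "j \<le> n i" "j \<noteq> J i" "e i j \<noteq> 0" by blast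
      let ?a = "move e i j (J i)" and ?b = "move ?o i (J i) j"
      have a: "?a \<in> ?E" using less.prems ij J(1) by (intro move_in) auto
      have oi: "?o i (J i) = d i" "?o i j = 0" using ij by (simp_all add: top_exponent_def)
      have b: "?b \<in> ?E" using o ij J(1) d oi by (intro move_in) auto
      have "e i (J i) + e i j = sum (e i) {J i, j}" using ij by simp
      also have "\<dots> \<le> sum (e i) {..n i}" using ij J(1) by (intro sum_mono2) auto
      also have "\<dots> = d i" using less.prems ij by (simp add: multi_exponents_def)
      finally have lt: "e i (J i) < d i" using ij by simp
      have "w ?a < w e"
        unfolding w_def
      proof (rule sum_strict_mono_ex1)
        show "\<forall>i'\<in>{..<k}. d i' - ?a i' (J i') \<le> d i' - e i' (J i')"
          using ij by (auto simp: move_def upd2_apply)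
        show "\<exists>i'\<in>{..<k}. d i' - ?a i' (J i') < d i' - e i' (J i')"
          using ij lt by (intro bexI[of _ i]) (auto simp: move_def)
      qed simp
      then have va: "v ?a = 0" using less.hyps a by blast
      have vb: "v ?b = 0" using v1 ij by blast
      have "e + ?o = ?a + ?b"
      proof (intro ext)
        fix i' j'
        show "(e + ?o) i' j' = (?a + ?b) i' j'"
          using ij oi d[of i] by (auto simp: move_def upd2_apply)
      qed
      \<comment> \<open>differentiating the quadric \<open>z e * z o = z a * z b\<close> moves towards the vertex \<open>o\<close>\<close>
      from tangent_quadric[OF v less.prems o a b this]
      have "v e * ?z ?o = 0" using va vb v0 by simp
      moreover have "?z ?o \<noteq> 0" using J by (intro nu_top_nonzero) auto
      ultimately show ?thesis by simp
    qed
  qed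
  show ?thesis
  proof
    fix e
    show "v e = 0 e" using main v by (cases "e \<in> ?E") (auto simp: tangent_space_def coord_space_def)
  qed
qed

text \<open>At the vertex and its neighbours, the vector of monomials and the derivatives in the
  coordinates other than \<open>y i (J i)\<close> form a triangular matrix with nonzero diagonal.
  Hence they are independent, and some combination of them agrees with a given tangent vector at
  these entries; by \<open>tangent_vector_zero\<close> it agrees everywhere.\<close>

lemma tangent_space_basis:
  assumes k: "0 < k" and d: "\<And>i. i < k \<Longrightarrow> d i \<noteq> 0" and y: "valid k n y"
  shows "tangent_space (multi_exponents k n d) (segre_veronese k n d) (pt k n d y) =
      cfun.span {Dv k n d y i j | i j. i < k \<and> j \<le> n i}" (is "?T = cfun.span ?S")
    and "cfun.dim (tangent_space (multi_exponents k n d) (segre_veronese k n d) (pt k n d y)) = 1 + (\<Sum>i<k. n i)"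
proof -
  let ?E = "multi_exponents k n d" and ?z = "multi_monomials k n d y"
  obtain J where J: "\<And>i. i < k \<Longrightarrow> J i \<le> n i" "\<And>i. i < k \<Longrightarrow> y i (J i) \<noteq> 0"
    using validE[OF y] by blast
  let ?o = "top_exponent k d J"
  have o: "?o \<in> ?E" using J(1) by (rule top_exponent_in)
  have zo: "?z ?o \<noteq> 0" using J by (intro nu_top_nonzero) auto
  define I where "I = (SIGMA i:{..<k}. {..n i} - {J i})"
  \<comment> \<open>\<open>None\<close> stands for the vector of monomials, which replaces all the
    derivatives in the coordinates \<open>y i (J i)\<close>.\<close>
  define h where "h = (\<lambda>x. case x of None \<Rightarrow> ?z | Some (i, j) \<Rightarrow> Dv k n d y i j)"
  have finI: "finite I" by (simp add: I_def)
  have cardI: "card I = (\<Sum>i<k. n i)" using J(1) by (simp add: I_def)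
  have ST: "?S \<subseteq> ?T" using Dv_in_tangent_space[OF y] by auto
  have zS: "?z \<in> cfun.span ?S" using k d by (intro nu_in_span_Dv) auto
  have Dv_o: "Dv k n d y i j ?o = 0" if "(i, j) \<in> I" for i j
    using that by (auto simp: I_def Dv_def top_exponent_def)
  have Dv_move: "Dv k n d y i' j' (move ?o i (J i) j) = (if i' = i \<and> j' = j then mon k n y (upd2 ?o i (J i) (d i - 1)) else 0)"
    if ij: "(i, j) \<in> I" and ij': "(i', j') \<in> I" for i j i' j'
  proof (cases "i' = i \<and> j' = j")
    case True
    have in_E: "move ?o i (J i) j \<in> ?E"
      using ij J(1) d by (intro move_in o) (auto simp: I_def top_exponent_def)
    have "upd2 (move ?o i (J i) j) i j (move ?o i (J i) j i j - 1) = upd2 ?o i (J i) (d i - 1)"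
      using ij by (intro ext) (auto simp: I_def move_def upd2_apply top_exponent_def)
    moreover have "move ?o i (J i) j i j = 1" using ij by (auto simp: I_def move_def upd2_apply top_exponent_def)
    ultimately show ?thesis using True in_E by (simp add: Dv_def)
  next
    case False
    then have "move ?o i (J i) j i' j' = 0"
      using ij ij' by (auto simp: I_def move_def upd2_apply top_exponent_def)
    then show ?thesis unfolding if_not_P[OF False] by (simp add: Dv_def)
  qed
  \<comment> \<open>The diagonal entries of the triangular matrix.\<close>
  have m0: "mon k n y (upd2 ?o i (J i) (d i - 1)) \<noteq> 0" if "i < k" for i
  proof -
    have "mon k n y (upd2 ?o i (J i) 0) \<noteq> 0"
      using mon_split[where k = k and n = n, OF that J(1)[OF that], of y ?o] zo by (auto simp: nu_apply split: if_splits)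
    then show ?thesis
      using mon_upd2[where k = k and n = n, OF that J(1)[OF that], of y ?o "d i - 1"] J(2)[OF that] by simp
  qed
  let ?K = "insert None (Some ` I)"
  have sumK: "(\<Sum>m\<in>?K. g m) = g None + (\<Sum>p\<in>I. g (Some p))" for g :: "(nat \<times> nat) option \<Rightarrow> complex"
    using finI by (subst sum.insert) (auto simp: sum.reindex)
  have at_o: "(\<Sum>m\<in>?K. a m * h m ?o) = a None * ?z ?o" for a
    using Dv_o by (auto simp: sumK h_def intro!: sum.neutral)
  have at_move: "(\<Sum>m\<in>?K. a m * h m (move ?o i (J i) j)) =
      a None * ?z (move ?o i (J i) j) + a (Some (i, j)) * mon k n y (upd2 ?o i (J i) (d i - 1))"
    if ij: "(i, j) \<in> I" for a i j
  proof -
    have "(\<Sum>p\<in>I. a (Some p) * h (Some p) (move ?o i (J i) j)) =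
        (\<Sum>p\<in>I. if p = (i, j) then a (Some p) * mon k n y (upd2 ?o i (J i) (d i - 1)) else 0)"
      by (intro sum.cong refl) (auto simp: h_def Dv_move[OF ij] split: prod.splits)
    then show ?thesis using ij finI unfolding sumK by (simp add: h_def)
  qed
  have ind: "a m = 0" if a: "\<And>x. (\<Sum>m\<in>?K. a m * h m x) = 0" and m: "m \<in> ?K" for a m
  proof -
    have 0: "a None = 0" using a[of ?o] zo unfolding at_o by simp
    show ?thesis
    proof (cases m)
      case (Some p)
      obtain i j where p: "p = (i, j)" by (cases p)
      then have ij: "(i, j) \<in> I" using m Some by auto
      have "i < k" using ij by (simp add: I_def)
      then show ?thesis using a[of "move ?o i (J i) j"] m0 0 p Some unfolding at_move[OF ij] by simp
    qed (simp add: 0)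
  qed
  have finK: "finite ?K" using finI by simp
  have inj: "inj_on h ?K" and indep: "cfun.independent (h ` ?K)"
    using independent_family[of ?K h] finK ind by blast+
  have hS: "h ` ?K \<subseteq> cfun.span ?S"
    using zS by (auto simp: h_def I_def intro!: cfun.span_base)
  have TS: "?T \<subseteq> cfun.span (h ` ?K)"
  proof
    fix v assume v: "v \<in> ?T"
    \<comment> \<open>Forward substitution: the entry at the vertex fixes the first coefficient,
      then each neighbour fixes its own.\<close>
    define a where "a = (\<lambda>m. case m of None \<Rightarrow> v ?o / ?z ?o
      | Some (i, j) \<Rightarrow> (v (move ?o i (J i) j) - v ?o / ?z ?o * ?z (move ?o i (J i) j)) /
          mon k n y (upd2 ?o i (J i) (d i - 1)))"
    define w where "w = (\<Sum>m\<in>?K. cscale (a m) (h m))"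
    have wK: "w \<in> cfun.span (h ` ?K)"
      unfolding w_def by (intro cfun.span_sum cfun.span_scale cfun.span_base) auto
    have "cfun.span ?S \<subseteq> ?T" using ST subspace_tangent_space by (rule cfun.span_minimal)
    then have "h ` ?K \<subseteq> ?T" using hS by blast
    then have "cfun.span (h ` ?K) \<subseteq> ?T" using subspace_tangent_space by (rule cfun.span_minimal)
    then have "w \<in> ?T" using wK by blast
    then have vw: "v - w \<in> ?T" using v subspace_tangent_space cfun.subspace_diff by blast
    have w: "w x = (\<Sum>m\<in>?K. a m * h m x)" for x
      by (simp only: w_def sum_fun_apply cscale_apply)
    have "v - w = 0"
    proof (rule tangent_vector_zero[OF vw J d])
      show "(v - w) ?o = 0" using zo by (simp add: w at_o del: sum.insert) (simp add: a_def)
      show "(v - w) (move ?o i (J i) j) = 0" if "i < k" "j \<le> n i" "j \<noteq> J i" for i j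
      proof -
        have ij: "(i, j) \<in> I" using that by (simp add: I_def)
        show ?thesis unfolding minus_apply w at_move[OF ij] using m0[OF that(1)] by (simp add: a_def)
      qed
    qed auto
    then show "v \<in> cfun.span (h ` ?K)" using wK by simp
  qed
  have "cfun.span (h ` ?K) \<subseteq> cfun.span ?S" using hS cfun.span_minimal cfun.subspace_span by blast
  moreover have "cfun.span ?S \<subseteq> ?T" using ST subspace_tangent_space by (rule cfun.span_minimal)
  ultimately show T: "?T = cfun.span ?S" using TS by blast
  have "cfun.dim ?T = card (h ` ?K)"
    using hS TS indep T by (intro cfun.dim_unique) auto
  also have "\<dots> = card ?K" by (rule card_image[OF inj])
  also have "\<dots> = 1 + (\<Sum>i<k. n i)" using finI cardI by (simp add: card_image)
  finally show "cfun.dim ?T = 1 + (\<Sum>i<k. n i)" .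
qed

end


section \<open>The dimension of a Segre-Veronese variety\<close>

definition polyfun :: "(complex \<Rightarrow> complex) \<Rightarrow> bool" where
  "polyfun f \<longleftrightarrow> (\<exists>p. \<forall>t. f t = poly p t)"

lemma polyfun_const: "polyfun (\<lambda>t. c)"
  unfolding polyfun_def by (rule exI[of _ "[:c:]"]) simp

lemma polyfun_linear: "polyfun (\<lambda>t. a + t * b)"
  unfolding polyfun_def by (rule exI[of _ "[:a, b:]"]) simp

lemma polyfun_add: "polyfun f \<Longrightarrow> polyfun g \<Longrightarrow> polyfun (\<lambda>t. f t + g t)"
  unfolding polyfun_def by (metis poly_add)

lemma polyfun_mult: "polyfun f \<Longrightarrow> polyfun g \<Longrightarrow> polyfun (\<lambda>t. f t * g t)"
  unfolding polyfun_def by (metis poly_mult)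

lemma polyfun_power: "polyfun f \<Longrightarrow> polyfun (\<lambda>t. f t ^ m)"
  unfolding polyfun_def by (metis poly_power)

lemma polyfun_prod: "(\<And>i. i \<in> I \<Longrightarrow> polyfun (f i)) \<Longrightarrow> polyfun (\<lambda>t. \<Prod>i\<in>I. f i t)"
  by (induction I rule: infinite_finite_induct) (auto intro: polyfun_const polyfun_mult)

text \<open>Finitely many nonzero polynomials have finitely many roots in total, and the field is
  infinite.\<close>

lemma polyfun_common_nonzero:
  assumes "finite I" "\<And>i. i \<in> I \<Longrightarrow> polyfun (f i)" "\<And>i. i \<in> I \<Longrightarrow> \<exists>t. f i t \<noteq> 0"
  shows "\<exists>t. \<forall>i\<in>I. f i t \<noteq> 0"
proof -
  obtain p where p: "\<And>i t. i \<in> I \<Longrightarrow> f i t = poly (p i) t"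
    using assms(2) unfolding polyfun_def by metis
  have "p i \<noteq> 0" if "i \<in> I" for i using assms(3)[OF that] p[OF that] by auto
  then have "finite (\<Union>i\<in>I. {t. poly (p i) t = 0})" using assms(1) by (auto intro: poly_roots_finite)
  then obtain t where "t \<notin> (\<Union>i\<in>I. {t. poly (p i) t = 0})"
    using ex_new_if_finite infinite_UNIV_char_0 by blast
  then show ?thesis using p by auto
qed

section \<open>Multihomogeneous forms and the upper bound for the dimension\<close>

context
  fixes k :: nat and n :: "nat \<Rightarrow> nat"
begin

text \<open>The sections of the line bundle of multidegree \<open>d\<close>, as functions of the
  homogeneous coordinates.\<close>

definition mforms :: "(nat \<Rightarrow> nat) \<Rightarrow> ((nat \<Rightarrow> nat \<Rightarrow> complex) \<Rightarrow> complex) set" where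
  "mforms d = cfun.span ((\<lambda>e y. mon k n y e) ` multi_exponents k n d)"

lemma exps_add:
  "e \<in> multi_exponents k n a \<Longrightarrow> e' \<in> multi_exponents k n b \<Longrightarrow>
    e + e' \<in> multi_exponents k n (\<lambda>i. a i + b i)"
  by (auto simp: multi_exponents_def sum.distrib)

lemma mforms_mult:
  "f \<in> mforms a \<Longrightarrow> g \<in> mforms b \<Longrightarrow> (\<lambda>y. f y * g y) \<in> mforms (\<lambda>i. a i + b i)"
  unfolding mforms_def
proof (erule (1) span_mult)
  fix f g assume "f \<in> (\<lambda>e y. mon k n y e) ` multi_exponents k n a"
    "g \<in> (\<lambda>e y. mon k n y e) ` multi_exponents k n b"
  then obtain e e' where e: "f = (\<lambda>y. mon k n y e)" "g = (\<lambda>y. mon k n y e')"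
    "e \<in> multi_exponents k n a" "e' \<in> multi_exponents k n b" by blast
  have "(\<lambda>y. f y * g y) = (\<lambda>y. mon k n y (e + e'))" by (simp add: e mon_add)
  then show "(\<lambda>y. f y * g y) \<in> cfun.span ((\<lambda>e y. mon k n y e) ` multi_exponents k n (\<lambda>i. a i + b i))"
    using exps_add[OF e(3,4)] by (auto intro!: cfun.span_base)
qed

lemma mforms_zero: "(\<lambda>y. 0) \<in> mforms a"
  using cfun.span_zero by (simp add: mforms_def zero_fun_def)

lemma mforms_one: "(\<lambda>y. 1) \<in> mforms (\<lambda>i. 0)"
proof -
  have "(\<lambda>i j. 0) \<in> multi_exponents k n (\<lambda>i. 0)" by (simp add: multi_exponents_def)
  moreover have "(\<lambda>y. 1) = (\<lambda>y. mon k n y (\<lambda>i j. 0))" by (simp add: mon_def)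
  ultimately show ?thesis unfolding mforms_def by (auto intro!: cfun.span_base)
qed

lemma mforms_nu: "(\<lambda>y. multi_monomials k n d y e) \<in> mforms d"
proof (cases "e \<in> multi_exponents k n d")
  case True
  then have "(\<lambda>y. multi_monomials k n d y e) = (\<lambda>y. mon k n y e)" by (simp add: nu_apply)
  then show ?thesis using True unfolding mforms_def by (auto intro!: cfun.span_base)
next
  case False
  then have "(\<lambda>y. multi_monomials k n d y e) = (\<lambda>y. 0)" by (simp add: nu_apply)
  then show ?thesis using mforms_zero by simp
qed

lemma mforms_power: "f \<in> mforms d \<Longrightarrow> (\<lambda>y. f y ^ m) \<in> mforms (\<lambda>i. m * d i)"
  by (induction m) (auto intro: mforms_one mforms_mult)

lemma mforms_prod:
  "finite I \<Longrightarrow> (\<And>i. i \<in> I \<Longrightarrow> f i \<in> mforms (\<lambda>j. s i * d j)) \<Longrightarrow>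
    (\<lambda>y. \<Prod>i\<in>I. f i y) \<in> mforms (\<lambda>j. (\<Sum>i\<in>I. s i) * d j)"
proof (induction I rule: finite_induct)
  case empty
  then show ?case using mforms_one by simp
next
  case (insert i I)
  then have "(\<lambda>y. f i y * (\<Prod>i\<in>I. f i y)) \<in> mforms (\<lambda>j. s i * d j + (\<Sum>i\<in>I. s i) * d j)"
    by (intro mforms_mult) auto
  then show ?case using insert.hyps by (simp add: distrib_right)
qed

lemma form_pullback:
  assumes "f \<in> form s"
  shows "(\<lambda>y. f (multi_monomials k n d y)) \<in> mforms (\<lambda>i. s * d i)"
  using assms unfolding form_def
proof (induction rule: cfun.span_induct_alt)
  case base
  then show ?case using mforms_zero by simp
next
  case (step c g h)
  then obtain m where m: "g = mfun m" "mdeg m = s" by auto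
  have "(\<lambda>y. \<Prod>i\<in>Poly_Mapping.keys m. multi_monomials k n d y i ^ Poly_Mapping.lookup m i)
      \<in> mforms (\<lambda>j. (\<Sum>i\<in>Poly_Mapping.keys m. Poly_Mapping.lookup m i) * d j)"
    by (intro mforms_prod mforms_power mforms_nu) simp
  then have "(\<lambda>y. g (multi_monomials k n d y)) \<in> mforms (\<lambda>i. s * d i)"
    using m by (simp add: mfun_def mdeg_def)
  then have "cscale c (\<lambda>y. g (multi_monomials k n d y)) + (\<lambda>y. h (multi_monomials k n d y)) \<in> mforms (\<lambda>i. s * d i)"
    using step(2) unfolding mforms_def by (intro cfun.span_add cfun.span_scale)
  moreover have "cscale c (\<lambda>y. g (multi_monomials k n d y)) + (\<lambda>y. h (multi_monomials k n d y)) =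
      (\<lambda>y. (cscale c g + h) (multi_monomials k n d y))" by (simp add: fun_eq_iff)
  ultimately show ?case by simp
qed

text \<open>The independent forms on \<open>X\<close> given by the chain stay independent after
  pullback to the product, where their number is bounded by the number of exponents. For large
  \<open>u\<close> this excludes \<open>l > ?N\<close>.\<close>

lemma chain_length_le:
  assumes Z: "\<And>j. j \<le> l \<Longrightarrow> zariski_closed_in (segre_veronese k n d) (Z j)"
    "\<And>j. j \<le> l \<Longrightarrow> zariski_irreducible (Z j)" "\<And>j. j < l \<Longrightarrow> Z j \<subset> Z (Suc j)"
  shows "l \<le> (\<Sum>i<k. n i)"
proof (rule ccontr)
  let ?X = "segre_veronese k n d" and ?N = "\<Sum>i<k. n i"
  assume "\<not> l \<le> ?N"
  note basis = chain_independent_forms[of ?X l Z, OF segre_veronese_proj_point Z]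
  show False
  proof (rule basis)
    fix c :: nat and h :: "nat \<Rightarrow> nat list \<Rightarrow> ((nat \<Rightarrow> nat \<Rightarrow> nat) \<Rightarrow> complex) \<Rightarrow> complex"
    assume h: "\<And>u ts. set ts \<subseteq> {..u} \<Longrightarrow> length ts = l \<Longrightarrow> h u ts \<in> form (u * c)"
      "\<And>u a us. (\<And>p x. p \<in> ?X \<Longrightarrow> x \<in> p \<Longrightarrow>
          (\<Sum>ts\<in>{ts. set ts \<subseteq> {..u} \<and> length ts = l}. a ts * h u ts x) = 0) \<Longrightarrow>
        set us \<subseteq> {..u} \<Longrightarrow> length us = l \<Longrightarrow> a us = (0::complex)"
    define M where "M = (\<Sum>i<k. d i)"
    have bound: "(u + 1) ^ l \<le> (u * c * M + 1) ^ ?N" for u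
    proof -
      let ?J = "{ts. set ts \<subseteq> {..u} \<and> length ts = l}"
      define H where "H = (\<lambda>ts y. h u ts (multi_monomials k n d y))"
      have fin: "finite ?J" by (rule finite_lists_length_eq) simp
      \<comment> \<open>A relation between the pullbacks holds at one representative of each point
        of \<open>X\<close>, and by homogeneity at all of them.\<close>
      have ind: "a us = 0" if a: "\<And>y. (\<Sum>ts\<in>?J. a ts * H ts y) = 0" and us: "us \<in> ?J" for a us
      proof (rule h(2))
        fix p x assume px: "p \<in> ?X" "x \<in> p"
        then obtain y where y: "p = pt k n d y" by (auto simp: segre_veronese_eq)
        have "(\<lambda>x. \<Sum>ts\<in>?J. a ts * h u ts x) \<in> form (u * c)"
          using h(1) by (intro form_sum form_scale) auto
        moreover have "(\<Sum>ts\<in>?J. a ts * h u ts (multi_monomials k n d y)) = 0"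
          using a[of y] by (simp add: H_def)
        ultimately show "(\<Sum>ts\<in>?J. a ts * h u ts x) = 0"
          using form_zero_proj_point[of "\<lambda>x. \<Sum>ts\<in>?J. a ts * h u ts x"] px(2) y by blast
      qed (use us in auto)
      have inj: "inj_on H ?J" and indep: "cfun.independent (H ` ?J)"
        using independent_family[of ?J H] fin ind by blast+
      let ?d = "\<lambda>i. u * c * d i"
      have "H ` ?J \<subseteq> mforms ?d"
      proof
        fix f assume "f \<in> H ` ?J"
        then obtain ts where ts: "f = H ts" "set ts \<subseteq> {..u}" "length ts = l" by blast
        show "f \<in> mforms ?d" unfolding ts(1) H_def by (rule form_pullback[OF h(1)[OF ts(2,3)]])
      qed
      then have "card (H ` ?J) \<le> card ((\<lambda>e y. mon k n y e) ` multi_exponents k n ?d)"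
        unfolding mforms_def using cfun.independent_span_bound[OF finite_imageI[OF finite_exps] indep] by simp
      also have "\<dots> \<le> card (multi_exponents k n ?d)" by (rule card_image_le) simp
      also have "\<dots> \<le> (u * c * M + 1) ^ ?N"
      proof (rule finite_exps_card)
        fix i assume "i < k"
        then have "d i \<le> M" unfolding M_def by (intro member_le_sum) auto
        then show "u * c * d i \<le> u * c * M" by simp
      qed
      also have "card (H ` ?J) = (u + 1) ^ l"
        using inj by (simp add: card_image card_lists_length_eq)
      finally show ?thesis .
    qed
    \<comment> \<open>Taking \<open>u = K\<close> is enough: \<open>K * c * M + 1\<close> is at most
      \<open>(K + 1) * (c * M + 1)\<close>, whose \<open>?N\<close>-th power is
      \<open>(K + 1) ^ ?N * K\<close>, less than \<open>(K + 1) ^ (?N + 1)\<close>.\<close>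
    define K where "K = (c * M + 1) ^ ?N"
    have "(K + 1) ^ (?N + 1) \<le> (K + 1) ^ l"
      using \<open>\<not> l \<le> ?N\<close> by (intro power_increasing) auto
    also have "\<dots> \<le> (K * c * M + 1) ^ ?N" by (rule bound)
    also have "\<dots> \<le> ((K + 1) * (c * M + 1)) ^ ?N" by (intro power_mono) (auto simp: algebra_simps)
    also have "\<dots> = (K + 1) ^ ?N * K" by (simp only: power_mult_distrib K_def)
    finally have "(K + 1) ^ ?N * (K + 1) \<le> (K + 1) ^ ?N * K" by (simp only: power_add power_one_right)
    then show False by simp
  qed
qed

section \<open>Coordinate subvarieties and the lower bound for the dimension\<close>

definition coord_subvariety :: "(nat \<Rightarrow> nat) \<Rightarrow> (nat \<Rightarrow> nat set) \<Rightarrow> ((nat \<Rightarrow> nat \<Rightarrow> nat) \<Rightarrow> complex) set set" where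
  "coord_subvariety d S = {pt k n d y | y. valid k n y \<and> (\<forall>i<k. \<forall>j\<le>n i. j \<notin> S i \<longrightarrow> y i j = 0)}"

text \<open>A coordinate vanishes exactly when all monomials that contain it vanish. The first form
  gives linear equations on the target, the second shows that membership can be tested on any
  representative.\<close>

lemma coord_subvariety_iff:
  assumes d: "\<forall>i<k. d i \<noteq> 0" and y: "valid k n y"
  shows "pt k n d y \<in> coord_subvariety d S \<longleftrightarrow>
    (\<forall>e i j. e \<in> multi_exponents k n d \<longrightarrow> i < k \<longrightarrow> j \<le> n i \<longrightarrow> j \<notin> S i \<longrightarrow> e i j \<noteq> 0 \<longrightarrow>
      (\<forall>x\<in>pt k n d y. x e = 0))" (is "?L \<longleftrightarrow> ?R")
    and "pt k n d y \<in> coord_subvariety d S \<longleftrightarrow> (\<forall>i<k. \<forall>j\<le>n i. j \<notin> S i \<longrightarrow> y i j = 0)" (is "_ \<longleftrightarrow> ?Y")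
proof -
  have 1: "?L \<Longrightarrow> ?R"
  proof (intro allI impI)
    fix e i j assume L: ?L and e: "e \<in> multi_exponents k n d" and ij: "i < k" "j \<le> n i" "j \<notin> S i" "e i j \<noteq> 0"
    obtain w where w: "pt k n d y = pt k n d w" "\<forall>i<k. \<forall>j\<le>n i. j \<notin> S i \<longrightarrow> w i j = 0"
      using L by (auto simp: coord_subvariety_def)
    have "mon k n w e = 0" using mon_split[where k = k and n = n, OF ij(1,2), of w e] w(2) ij by simp
    then have "multi_monomials k n d w e = 0" by (simp add: nu_apply)
    then show "\<forall>x\<in>pt k n d y. x e = 0" unfolding w(1) by (auto simp: proj_point_def)
  qed
  have 2: "?R \<Longrightarrow> ?Y"
  proof (intro allI impI, rule ccontr)
    fix i j assume R: ?R and ij: "i < k" "j \<le> n i" "j \<notin> S i" "y i j \<noteq> 0"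
    obtain J where J: "\<And>i. i < k \<Longrightarrow> J i \<le> n i" "\<And>i. i < k \<Longrightarrow> y i (J i) \<noteq> 0"
      using validE[OF y] by blast
    \<comment> \<open>The vertex monomial of \<open>?J\<close> contains \<open>y i j\<close> and
      only coordinates that are nonzero at \<open>y\<close>.\<close>
    let ?J = "J(i := j)"
    have "multi_monomials k n d y (top_exponent k d ?J) \<noteq> 0"
      using J ij by (intro nu_top_nonzero) auto
    moreover have "top_exponent k d ?J \<in> multi_exponents k n d"
      using J ij by (intro top_exponent_in) auto
    moreover have "top_exponent k d ?J i j \<noteq> 0" using ij d by (simp add: top_exponent_def)
    ultimately show False using R ij proj_point_self by blast
  qed
  have 3: "?Y \<Longrightarrow> ?L" unfolding coord_subvariety_def using y by blast
  show "?L \<longleftrightarrow> ?R" "?L \<longleftrightarrow> ?Y" using 1 2 3 by blast+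
qed

text \<open>Stated relative to any \<open>C\<close> in between, since it is applied to
  \<open>X\<close> and to a contact locus.\<close>

lemma coord_subvariety_closed:
  assumes d: "\<And>i. i < k \<Longrightarrow> d i \<noteq> 0" and C: "C \<subseteq> segre_veronese k n d" "coord_subvariety d S \<subseteq> C"
  shows "zariski_closed_in C (coord_subvariety d S)"
proof (rule zariski_closed_inI)
  have d': "\<forall>i<k. d i \<noteq> 0" using d by blast
  let ?F = "{(\<lambda>x :: (nat \<Rightarrow> nat \<Rightarrow> nat) \<Rightarrow> complex. x e) | e. e \<in> multi_exponents k n d \<and> (\<exists>i<k. \<exists>j\<le>n i. j \<notin> S i \<and> e i j \<noteq> 0)}"
  show "\<exists>s. f \<in> form s" if f: "f \<in> ?F" for f
  proof -
    obtain e where "f = (\<lambda>x. x e)" using f by blast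
    then have "f \<in> form 1" by (simp only: form_coord)
    then show ?thesis by blast
  qed
  show "coord_subvariety d S = {p \<in> C. \<forall>f\<in>?F. \<forall>x\<in>p. f x = 0}"
  proof (intro equalityI subsetI)
    fix p assume p: "p \<in> coord_subvariety d S"
    then obtain y where y: "valid k n y" "p = pt k n d y" by (auto simp: coord_subvariety_def)
    have R: "\<forall>e i j. e \<in> multi_exponents k n d \<longrightarrow> i < k \<longrightarrow> j \<le> n i \<longrightarrow> j \<notin> S i \<longrightarrow> e i j \<noteq> 0 \<longrightarrow>
      (\<forall>x\<in>p. x e = 0)"
      using p unfolding y(2) coord_subvariety_iff(1)[OF d' y(1)] .
    show "p \<in> {p \<in> C. \<forall>f\<in>?F. \<forall>x\<in>p. f x = 0}"
    proof (intro CollectI conjI ballI)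
      show "p \<in> C" using p C(2) by blast
      fix f x assume "f \<in> ?F" "x \<in> p"
      then obtain e i j where "f = (\<lambda>x. x e)" "e \<in> multi_exponents k n d" "i < k" "j \<le> n i" "j \<notin> S i" "e i j \<noteq> 0"
        by blast
      then show "f x = 0" using R \<open>x \<in> p\<close> by simp
    qed
  next
    fix p assume p: "p \<in> {p \<in> C. \<forall>f\<in>?F. \<forall>x\<in>p. f x = 0}"
    then obtain y where y: "valid k n y" "p = pt k n d y" using C(1) by (auto simp: segre_veronese_eq)
    have "\<forall>x\<in>p. x e = 0"
      if "e \<in> multi_exponents k n d" "i < k" "j \<le> n i" "j \<notin> S i" "e i j \<noteq> 0" for e i j
    proof -
      have "(\<lambda>x. x e) \<in> ?F" using that by blast
      with CollectD[OF p, THEN conjunct2] show ?thesis by (rule bspec)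
    qed
    then show "p \<in> coord_subvariety d S"
      unfolding y(2) coord_subvariety_iff(1)[OF d' y(1)] by blast
  qed
qed

text \<open>On the segment from coordinates \<open>v\<close> with \<open>f\<close> nonzero to
  coordinates \<open>w\<close> with \<open>g\<close> nonzero, both pullbacks are nonzero polynomials
  in the parameter, so some valid point of the line avoids both zero sets.\<close>

lemma coord_subvariety_irreducible:
  assumes S: "\<And>i. i < k \<Longrightarrow> \<exists>j\<le>n i. j \<in> S i"
  shows "zariski_irreducible (coord_subvariety d S)"
proof (rule zariski_irreducibleI)
  define y where "y = (\<lambda>i j. if j \<in> S i then 1 else 0 :: complex)"
  have "valid k n y" using S by (auto simp: valid_def y_def)
  moreover have "\<forall>i<k. \<forall>j\<le>n i. j \<notin> S i \<longrightarrow> y i j = 0" by (simp add: y_def)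
  ultimately show "coord_subvariety d S \<noteq> {}" unfolding coord_subvariety_def by blast
next
  fix f g s t p q x y
  assume f: "f \<in> form s" and g: "g \<in> form t"
    and pq: "p \<in> coord_subvariety d S" "q \<in> coord_subvariety d S" "x \<in> p" "y \<in> q"
    and nz: "f x \<noteq> 0" "g y \<noteq> 0"
  obtain v where v: "p = pt k n d v" "valid k n v" "\<forall>i<k. \<forall>j\<le>n i. j \<notin> S i \<longrightarrow> v i j = 0"
    using pq(1) by (auto simp: coord_subvariety_def)
  obtain w where w: "q = pt k n d w" "valid k n w" "\<forall>i<k. \<forall>j\<le>n i. j \<notin> S i \<longrightarrow> w i j = 0"
    using pq(2) by (auto simp: coord_subvariety_def)
  obtain J where J: "\<And>i. i < k \<Longrightarrow> J i \<le> n i" "\<And>i. i < k \<Longrightarrow> v i (J i) \<noteq> 0"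
    using validE[OF v(2)] by blast
  define z where "z = (\<lambda>t i j. v i j + t * (w i j - v i j))"
  have z01: "z 0 = v" "z 1 = w" by (simp_all add: z_def)
  have poly: "polyfun (\<lambda>t. a (multi_monomials k n d (z t)))" if "a \<in> form s" for a s
  proof -
    have "b \<in> mforms e \<Longrightarrow> polyfun (\<lambda>t. b (z t))" for b e
      unfolding mforms_def
    proof (induction rule: cfun.span_induct_alt)
      case base
      then show ?case by (simp add: polyfun_const)
    next
      case (step c g h)
      then obtain m where m: "g = (\<lambda>y. mon k n y m)" by auto
      have "polyfun (\<lambda>t. g (z t))"
        unfolding m mon_def z_def by (intro polyfun_prod polyfun_power polyfun_linear)
      then have "polyfun (\<lambda>t. c * g (z t) + h (z t))"
        using step(2) by (intro polyfun_add polyfun_mult polyfun_const)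
      then show ?case by simp
    qed
    then show ?thesis using form_pullback[OF that] by blast
  qed
  \<comment> \<open>These are \<open>k + 2\<close> polynomials: \<open>k\<close> to keep the point
    valid, then \<open>f\<close> and \<open>g\<close>.\<close>
  define F where "F = (\<lambda>i t. if i < k then z t i (J i) else
    if i = k then f (multi_monomials k n d (z t)) else g (multi_monomials k n d (z t)))"
  have "f (multi_monomials k n d v) \<noteq> 0" "g (multi_monomials k n d w) \<noteq> 0"
    using nz pq v(1) w(1) form_zero_proj_point[OF f] form_zero_proj_point[OF g] by blast+
  then have "F i (if i \<le> k then 0 else 1) \<noteq> 0" for i using z01 J(2) by (simp add: F_def)
  then have "\<exists>t. F i t \<noteq> 0" for i by blast
  moreover have "polyfun (F i)" for i
  proof -
    consider "F i = (\<lambda>t. v i (J i) + t * (w i (J i) - v i (J i)))" |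
      "F i = (\<lambda>t. f (multi_monomials k n d (z t)))" | "F i = (\<lambda>t. g (multi_monomials k n d (z t)))"
      unfolding F_def z_def by fastforce
    then show ?thesis
    proof cases
      case 1
      then show ?thesis by (simp only: polyfun_linear)
    next
      case 2
      then show ?thesis using poly[OF f] by simp
    next
      case 3
      then show ?thesis using poly[OF g] by simp
    qed
  qed
  ultimately obtain \<tau> where "\<forall>i\<in>{..k+1}. F i \<tau> \<noteq> 0"
    using polyfun_common_nonzero[of "{..k+1}" F] by blast
  then have \<tau>: "F i \<tau> \<noteq> 0" if "i \<le> k + 1" for i using that by simp
  have "z \<tau> i (J i) \<noteq> 0" if "i < k" for i using \<tau>[of i] that by (simp add: F_def)
  then have "valid k n (z \<tau>)" using J(1) by (auto simp: valid_def)
  moreover have "\<forall>i<k. \<forall>j\<le>n i. j \<notin> S i \<longrightarrow> z \<tau> i j = 0" using v(3) w(3) by (simp add: z_def)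
  ultimately have "pt k n d (z \<tau>) \<in> coord_subvariety d S" by (auto simp: coord_subvariety_def)
  moreover have "f (multi_monomials k n d (z \<tau>)) \<noteq> 0" "g (multi_monomials k n d (z \<tau>)) \<noteq> 0"
    using \<tau>[of k] \<tau>[of "k + 1"] by (auto simp: F_def)
  ultimately show "\<exists>p\<in>coord_subvariety d S. \<exists>x\<in>p. f x \<noteq> 0 \<and> (\<exists>x\<in>p. g x \<noteq> 0)"
    using proj_point_self by blast
qed

lemma coord_subvariety_subset: "coord_subvariety d S \<subseteq> segre_veronese k n d"
  by (auto simp: coord_subvariety_def segre_veronese_eq)

lemma coord_subvariety_mono:
  "(\<And>i. i < k \<Longrightarrow> S i \<subseteq> S' i) \<Longrightarrow> coord_subvariety d S \<subseteq> coord_subvariety d S'"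
  unfolding coord_subvariety_def by blast

lemma zariski_dim_segre_veronese:
  assumes d: "\<And>i. i < k \<Longrightarrow> d i \<noteq> 0"
  shows "zariski_dim (segre_veronese k n d) = enat (\<Sum>i<k. n i)"
proof (rule antisym)
  have d': "\<forall>i<k. d i \<noteq> 0" using d by blast
  show "zariski_dim (segre_veronese k n d) \<le> enat (\<Sum>i<k. n i)"
    using chain_length_le by (intro zariski_dim_leI) blast
  \<comment> \<open>Coordinates are released one at a time, factor after factor. Truncated
    subtraction leaves only coordinate \<open>0\<close> in the factors not yet reached.\<close>
  define S where "S = (\<lambda>m i. {..min (n i) (m - (\<Sum>i'<i. n i'))})"
  show "enat (\<Sum>i<k. n i) \<le> zariski_dim (segre_veronese k n d)"
  proof (rule zariski_dim_geI[where Z = "\<lambda>m. coord_subvariety d (S m)"])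
    show "zariski_closed_in (segre_veronese k n d) (coord_subvariety d (S m))" for m
      using d coord_subvariety_subset by (intro coord_subvariety_closed) auto
    show "zariski_irreducible (coord_subvariety d (S m))" for m
      by (rule coord_subvariety_irreducible) (auto simp: S_def)
    fix m assume m: "m < (\<Sum>i<k. n i)"
    have mono: "coord_subvariety d (S m) \<subseteq> coord_subvariety d (S (Suc m))"
      by (rule coord_subvariety_mono) (auto simp: S_def)
    \<comment> \<open>The factor in which the passage from \<open>m\<close> to \<open>Suc m\<close>
      releases a coordinate; \<open>j\<close> below is this coordinate.\<close>
    define i where "i = (LEAST i. m < (\<Sum>i'<Suc i. n i'))"
    have k0: "0 < k" using m by (cases k) auto
    then have ex: "m < (\<Sum>i'<Suc (k - 1). n i')" using m by simp
    then have i: "m < (\<Sum>i'<Suc i. n i')" unfolding i_def by (rule LeastI)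
    have "i \<le> k - 1" unfolding i_def using ex by (rule Least_le)
    then have ik: "i < k" using k0 by simp
    have le: "(\<Sum>i'<i. n i') \<le> m"
    proof (cases i)
      case (Suc i')
      then have "i' < (LEAST i. m < (\<Sum>i'<Suc i. n i'))" unfolding i_def by simp
      from not_less_Least[OF this] have "\<not> m < (\<Sum>i'<Suc i'. n i')" .
      then show ?thesis using Suc by simp
    qed simp
    define j where "j = Suc m - (\<Sum>i'<i. n i')"
    have j: "j \<le> n i" using i le by (simp add: j_def)
    define y where "y = (\<lambda>i' j'. if i' = i then (if j' = j then 1 else 0) else if j' = 0 then 1 else 0 :: complex)"
    have y: "valid k n y"
      unfolding valid_def
    proof (intro allI impI)
      fix i'
      show "\<exists>j'\<le>n i'. y i' j' \<noteq> 0"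
        by (rule exI[of _ "if i' = i then j else 0"]) (use j in \<open>simp add: y_def\<close>)
    qed
    have "pt k n d y \<in> coord_subvariety d (S (Suc m))"
      unfolding coord_subvariety_iff(2)[OF d' y] using j by (auto simp: y_def S_def j_def)
    moreover have "pt k n d y \<notin> coord_subvariety d (S m)"
      unfolding coord_subvariety_iff(2)[OF d' y]
    proof
      assume *: "\<forall>i<k. \<forall>j\<le>n i. j \<notin> S m i \<longrightarrow> y i j = 0"
      have "j \<notin> S m i" using le by (auto simp: S_def j_def)
      then have "y i j = 0" using * ik j by blast
      then show False by (simp add: y_def)
    qed
    ultimately show "coord_subvariety d (S m) \<subset> coord_subvariety d (S (Suc m))" using mono by blast
  qed
qed

lemma smooth_locus_segre_veronese:
  assumes "0 < k" "\<And>i. i < k \<Longrightarrow> d i \<noteq> 0"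
  shows "smooth_locus (multi_exponents k n d) (segre_veronese k n d) = segre_veronese k n d"
  using tangent_space_basis(2)[OF assms] zariski_dim_segre_veronese[OF assms(2)]
  by (auto simp: smooth_locus_def segre_veronese_eq one_enat_def)

end


section \<open>Points on a line\<close>

text \<open>The weights read off the coefficient \<open>b0\<close> of a polynomial of degree at most
  \<open>t\<close> from its values on \<open>S\<close>. They are the coefficients at
  \<open>b0\<close> of the Lagrange basis polynomials.\<close>

lemma lagrange_coefficients:
  fixes S :: "complex set"
  assumes "finite S" "t < card S"
  shows "\<exists>a. \<forall>b\<le>t. (\<Sum>s\<in>S. a s * s ^ b) = (if b = b0 then 1 else 0)"
proof -
  define L where "L = (\<lambda>s. \<Prod>u\<in>S - {s}. smult (1 / (s - u)) [:- u, 1:])"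
  have deg: "degree (L s) < card S" if "s \<in> S" for s
  proof -
    have "degree (L s) \<le> (\<Sum>u\<in>S - {s}. degree (smult (1 / (s - u)) [:- u, 1:]))"
      unfolding L_def using assms(1) by (intro degree_prod_sum_le[unfolded o_def]) auto
    also have "\<dots> \<le> (\<Sum>u\<in>S - {s}. 1)" by (intro sum_mono order_trans[OF degree_smult_le]) simp
    also have "\<dots> < card S" using assms that by simp
    finally show ?thesis .
  qed
  have L: "poly (L s) x = (if s = x then 1 else 0)" if "s \<in> S" "x \<in> S" for s x
  proof (cases "s = x")
    case True
    have "poly (smult (1 / (s - u)) [:- u, 1:]) s = 1" if "u \<in> S - {s}" for u
    proof -
      have "poly [:- u, 1:] s = s - u" by simp
      then show ?thesis using that by (simp only: poly_smult) auto
    qed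
    then show ?thesis using True unfolding L_def poly_prod by simp
  next
    case False
    then have "\<exists>u\<in>S - {s}. poly (smult (1 / (s - u)) [:- u, 1:]) x = 0"
      using that by (intro bexI[of _ x]) auto
    then show ?thesis using False assms(1) unfolding L_def poly_prod by simp
  qed
  show ?thesis
  proof (intro exI allI impI)
    fix b assume b: "b \<le> t"
    let ?P = "\<Sum>s\<in>S. smult (s ^ b) (L s)"
    have "?P = monom 1 b"
    proof (rule poly_eqI_degree)
      show "poly ?P x = poly (monom 1 b) x" if "x \<in> S" for x
      proof -
        have "poly ?P x = (\<Sum>s\<in>S. if s = x then s ^ b else 0)"
          using L that by (auto simp: poly_sum intro!: sum.cong)
        also have "\<dots> = x ^ b" using that assms(1) by simp
        finally show ?thesis by (simp add: poly_monom)
      qed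
      show "degree (monom (1::complex) b) < card S" using b assms(2) by (simp add: degree_monom_eq)
      have "degree ?P \<le> card S - 1"
        using deg by (intro degree_sum_le assms(1) order_trans[OF degree_smult_le]) fastforce
      then show "degree ?P < card S" using assms(2) by simp
    qed
    then have "coeff ?P b0 = coeff (monom 1 b) b0" by simp
    then show "(\<Sum>s\<in>S. coeff (L s) b0 * s ^ b) = (if b = b0 then 1 else 0)"
      by (simp add: coeff_sum mult.commute)
  qed
qed

section \<open>The span of the tangent spaces along a line in factor \<open>c\<close>\<close>

context
  fixes k :: nat and n :: "nat \<Rightarrow> nat" and d :: "nat \<Rightarrow> nat" and c :: nat
  assumes k: "0 < k" and c: "c < k" and n: "\<forall>i<k. 1 \<le> n i" and d: "\<forall>i<k. d i \<noteq> 0"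
begin

definition line_coords :: "nat \<Rightarrow> nat set" where
  "line_coords i = (if i = c then {0, 1} else {0})"

text \<open>The affine part of the line; its point at infinity belongs to
  \<open>coord_subvariety\<close> of \<open>line_coords\<close> only.\<close>

definition line_point :: "complex \<Rightarrow> nat \<Rightarrow> nat \<Rightarrow> complex" where
  "line_point s i j = (if j = 0 then 1 else if i = c \<and> j = 1 then s else 0)"

text \<open>
  The monomials of degree at most \<open>1\<close> in the coordinates that vanish on the line; \<open>(i, j)\<close> is the place
  of the only such coordinate, or an arbitrary place if there is none.
\<close>

definition low_exponents :: "(nat \<Rightarrow> nat \<Rightarrow> nat) set" where
  "low_exponents = {e \<in> multi_exponents k n d. \<exists>i<k. \<exists>j\<le>n i.
     \<forall>i'<k. \<forall>j'\<le>n i'. j' \<notin> line_coords i' \<longrightarrow> e i' j' \<le> (if i' = i \<and> j' = j then 1 else 0)}"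

lemma valid_line_point: "valid k n (line_point s)"
  by (auto simp: valid_def line_point_def)

lemma mon_line_point:
  "mon k n (line_point s) e =
    (if \<forall>i<k. \<forall>j\<le>n i. j \<notin> line_coords i \<longrightarrow> e i j = 0 then s ^ e c 1 else 0)"
proof (cases "\<forall>i<k. \<forall>j\<le>n i. j \<notin> line_coords i \<longrightarrow> e i j = 0")
  case True
  have "(\<Prod>j\<le>n i. line_point s i j ^ e i j) = (if i = c then s ^ e c 1 else 1)" if "i < k" for i
  proof -
    have "(\<Prod>j\<le>n i. line_point s i j ^ e i j) = (\<Prod>j\<le>n i. if j = 1 then (if i = c then s ^ e c 1 else 1) else 1)"
      using True that by (intro prod.cong) (auto simp: line_point_def line_coords_def)
    then show ?thesis using n that by simp
  qed
  then have "mon k n (line_point s) e = (\<Prod>i<k. if i = c then s ^ e c 1 else 1)"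
    unfolding mon_def by (intro prod.cong) auto
  then show ?thesis using c True by simp
next
  case False
  then obtain i j where ij: "i < k" "j \<le> n i" "j \<notin> line_coords i" "e i j \<noteq> 0" by blast
  then have "line_point s i j = 0" by (auto simp: line_point_def line_coords_def split: if_splits)
  then have "mon k n (line_point s) e = 0"
    using mon_split[where k = k and n = n, OF ij(1,2), of "line_point s" e] ij(4) by simp
  then show ?thesis unfolding if_not_P[OF False] .
qed

text \<open>A derivative removes one coordinate from a monomial, so on the line it can be nonzero
  only if at most this one coordinate vanishes there. All points of the line are covered, as the
  contact locus requires.\<close>

lemma tangent_space_line:
  assumes y: "valid k n y" "\<forall>i<k. \<forall>j\<le>n i. j \<notin> line_coords i \<longrightarrow> y i j = 0"
  shows "tangent_space (multi_exponents k n d) (segre_veronese k n d) (pt k n d y) \<subseteq> coord_space low_exponents"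
proof -
  have "Dv k n d y i j \<in> coord_space low_exponents" if ij: "i < k" "j \<le> n i" for i j
    unfolding coord_space_def
  proof (intro CollectI allI impI, rule ccontr)
    fix e assume e: "e \<notin> low_exponents" "Dv k n d y i j e \<noteq> 0"
    then have E: "e \<in> multi_exponents k n d" and m: "mon k n y (upd2 e i j (e i j - 1)) \<noteq> 0"
      by (auto simp: Dv_def split: if_splits)
    have "e i' j' \<le> (if i' = i \<and> j' = j then 1 else 0)"
      if i': "i' < k" "j' \<le> n i'" "j' \<notin> line_coords i'" for i' j'
    proof (rule ccontr)
      assume "\<not> ?thesis"
      then have "upd2 e i j (e i j - 1) i' j' \<noteq> 0" by (auto simp: upd2_apply split: if_splits)
      moreover have "y i' j' = 0" using y(2) i' by blast
      ultimately show False
        using mon_split[where k = k and n = n, OF i'(1,2), of y "upd2 e i j (e i j - 1)"] m by simp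
    qed
    then have "e \<in> low_exponents" using E ij unfolding low_exponents_def by blast
    then show False using e(1) by blast
  qed
  moreover have "cfun.subspace (coord_space low_exponents)"
    by (rule cfun.subspaceI) (auto simp: coord_space_def)
  ultimately have "cfun.span {Dv k n d y i j |i j. i < k \<and> j \<le> n i} \<subseteq> coord_space low_exponents"
    by (intro cfun.span_minimal) auto
  then show ?thesis using tangent_space_basis(1)[of k d n y] k d y(1) by simp
qed

lemma exponent_eqI:
  assumes e: "e \<in> multi_exponents k n d" "e' \<in> multi_exponents k n d"
    and eq: "\<And>i j. i < k \<Longrightarrow> j \<le> n i \<Longrightarrow> j \<noteq> 0 \<Longrightarrow> e i j = e' i j"
  shows "e = e'"
proof (intro ext)
  fix i j
  show "e i j = e' i j"
  proof (cases "i < k \<and> j \<le> n i")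
    case True
    have "sum (e i) {..n i} = sum (e' i) {..n i}" using e True by (simp add: multi_exponents_def)
    moreover have "{..n i} = insert 0 {1..n i}" by auto
    moreover have "sum (e i) {1..n i} = sum (e' i) {1..n i}" using eq True by (intro sum.cong) auto
    ultimately have "e i 0 = e' i 0" by simp
    then show ?thesis using eq True by (cases "j = 0") auto
  qed (use e in \<open>auto simp: multi_exponents_def\<close>)
qed

text \<open>For each \<open>s\<close> a tangent vector is chosen whose entries are powers of
  \<open>s\<close> on \<open>F\<close> and zero elsewhere. Interpolation isolates the power that
  belongs to \<open>e\<close>; the powers are at most \<open>d c\<close>, which is why
  \<open>d c + 1\<close> points suffice.\<close>

lemma unit_in_span:
  assumes S: "finite S" "d c < card S" and e: "e \<in> low_exponents"
  shows "(\<lambda>e'. if e' = e then 1 else 0) \<in>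
    cfun.span (\<Union>s\<in>S. tangent_space (multi_exponents k n d) (segre_veronese k n d) (pt k n d (line_point s)))"
proof -
  let ?E = "multi_exponents k n d"
  let ?T = "\<lambda>s. tangent_space ?E (segre_veronese k n d) (pt k n d (line_point s))"
  have E: "e \<in> ?E" using e by (simp add: low_exponents_def)
  define F where "F = {e' \<in> ?E. \<forall>i<k. \<forall>j\<le>n i. j \<notin> line_coords i \<longrightarrow> e' i j = e i j}"
  have T: "?T s = cfun.span {Dv k n d (line_point s) i j |i j. i < k \<and> j \<le> n i}" for s
    using tangent_space_basis(1)[of k d n "line_point s"] k d valid_line_point by auto
  \<comment> \<open>the exponents in \<open>F\<close> are told apart by the power of \<open>s\<close>\<close>
  have "\<exists>w. \<forall>s. w s \<in> ?T s \<and> (\<forall>e'. w s e' = (if e' \<in> F then s ^ e' c 1 else 0))"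
  proof (cases "\<forall>i<k. \<forall>j\<le>n i. j \<notin> line_coords i \<longrightarrow> e i j = 0")
    case True
    have "multi_monomials k n d (line_point s) \<in> ?T s" for s
      unfolding T using k d by (intro nu_in_span_Dv) auto
    moreover have "multi_monomials k n d (line_point s) e' = (if e' \<in> F then s ^ e' c 1 else 0)" for s e'
      using True by (auto simp: nu_apply mon_line_point F_def)
    ultimately show ?thesis by (intro exI[of _ "\<lambda>s. multi_monomials k n d (line_point s)"]) blast
  next
    case False
    then obtain i j where ij: "i < k" "j \<le> n i" "j \<notin> line_coords i" "e i j \<noteq> 0" by blast
    obtain i0 j0 where low: "\<forall>i'<k. \<forall>j'\<le>n i'. j' \<notin> line_coords i' \<longrightarrow> e i' j' \<le> (if i' = i0 \<and> j' = j0 then 1 else 0)"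
      using e unfolding low_exponents_def by blast
    then have "e i j \<le> (if i = i0 \<and> j = j0 then 1 else 0)" using ij by blast
    then have eij: "e i j = 1" "i = i0" "j = j0" using ij(4) by (auto split: if_splits)
    have other: "e i' j' = 0" if "i' < k" "j' \<le> n i'" "j' \<notin> line_coords i'" "\<not> (i' = i \<and> j' = j)" for i' j'
    proof -
      have "e i' j' \<le> (if i' = i0 \<and> j' = j0 then 1 else 0)" using low that by blast
      moreover have "\<not> (i' = i0 \<and> j' = j0)" using that(4) eij by blast
      ultimately show ?thesis by (simp only: if_False)
    qed
    \<comment> \<open>The differentiation is not in the parameter coordinate, so the power of
      \<open>s\<close> is unchanged.\<close>
    have cj: "\<not> (c = i \<and> 1 = j)" using ij(3) by (auto simp: line_coords_def)
    have "Dv k n d (line_point s) i j \<in> ?T s" for s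
      unfolding T using ij by (intro cfun.span_base) blast
    moreover have "Dv k n d (line_point s) i j e' = (if e' \<in> F then s ^ e' c 1 else 0)" for s e'
    proof (cases "e' \<in> F")
      case True
      then have F: "e' \<in> ?E" "e' i' j' = e i' j'" if "i' < k" "j' \<le> n i'" "j' \<notin> line_coords i'" for i' j'
        using that by (auto simp: F_def)
      have 1: "e' i j = 1" using F(2)[OF ij(1-3)] eij by simp
      have z: "\<forall>i'<k. \<forall>j'\<le>n i'. j' \<notin> line_coords i' \<longrightarrow> upd2 e' i j (e' i j - 1) i' j' = 0"
        using other 1 F(2) by (simp add: upd2_apply)
      have "mon k n (line_point s) (upd2 e' i j (e' i j - 1)) = s ^ upd2 e' i j (e' i j - 1) c 1"
        unfolding mon_line_point if_P[OF z] ..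
      also have "upd2 e' i j (e' i j - 1) c 1 = e' c 1" using cj by (auto simp: upd2_apply)
      finally show ?thesis using True 1 F(1)[OF ij(1-3)] by (simp add: Dv_def)
    next
      case False
      have "Dv k n d (line_point s) i j e' = 0"
      proof (rule ccontr)
        assume nz: "Dv k n d (line_point s) i j e' \<noteq> 0"
        then have e': "e' \<in> ?E" "e' i j \<noteq> 0" "mon k n (line_point s) (upd2 e' i j (e' i j - 1)) \<noteq> 0"
          by (auto simp: Dv_def split: if_splits)
        then have z: "\<forall>i'<k. \<forall>j'\<le>n i'. j' \<notin> line_coords i' \<longrightarrow> upd2 e' i j (e' i j - 1) i' j' = 0"
          unfolding mon_line_point by (auto split: if_splits)
        have "e' i' j' = e i' j'" if i': "i' < k" "j' \<le> n i'" "j' \<notin> line_coords i'" for i' j'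
        proof (cases "i' = i \<and> j' = j")
          case True
          have "upd2 e' i j (e' i j - 1) i j = 0" using z ij by blast
          then show ?thesis using True e'(2) eij by simp
        next
          case False
          have "upd2 e' i j (e' i j - 1) i' j' = 0" using z i' by blast
          then show ?thesis using False other[OF i' False] by (simp add: upd2_apply)
        qed
        then show False using \<open>e' \<notin> F\<close> e'(1) by (simp add: F_def)
      qed
      then show ?thesis using False by simp
    qed
    ultimately show ?thesis by (intro exI[of _ "\<lambda>s. Dv k n d (line_point s) i j"]) blast
  qed
  then obtain w where w: "\<And>s. w s \<in> ?T s" "\<And>s e'. w s e' = (if e' \<in> F then s ^ e' c 1 else 0)" by metis
  obtain a where a: "\<forall>b\<le>d c. (\<Sum>s\<in>S. a s * s ^ b) = (if b = e c 1 then 1 else 0)"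
    using lagrange_coefficients[OF S] by blast
  have "(\<Sum>s\<in>S. cscale (a s) (w s)) = (\<lambda>e'. if e' = e then 1 else 0)"
  proof
    fix e'
    show "(\<Sum>s\<in>S. cscale (a s) (w s)) e' = (if e' = e then 1 else 0)"
    proof (cases "e' \<in> F")
      case True
      have E': "e' \<in> ?E" using True by (simp add: F_def)
      have "e' c 1 \<le> sum (e' c) {..n c}" using n c by (intro member_le_sum) auto
      then have "e' c 1 \<le> d c" using E' c by (simp add: multi_exponents_def)
      then have "(\<Sum>s\<in>S. cscale (a s) (w s)) e' = (if e' c 1 = e c 1 then 1 else 0)"
        using a True by (simp add: sum_fun_apply w)
      \<comment> \<open>Membership in \<open>F\<close> fixes the exponents off the line, and the
        degrees fix those of the coordinates \<open>0\<close>.\<close>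
      also have "e' c 1 = e c 1 \<longleftrightarrow> e' = e"
      proof
        assume eq: "e' c 1 = e c 1"
        show "e' = e"
        proof (rule exponent_eqI[OF E' E])
          fix i j assume "i < k" "j \<le> n i" "j \<noteq> 0"
          then show "e' i j = e i j"
            using eq True by (cases "i = c \<and> j = 1") (auto simp: F_def line_coords_def)
        qed
      qed simp
      finally show ?thesis .
    next
      case False
      then have "e' \<noteq> e" using E by (auto simp: F_def)
      then show ?thesis using False by (simp add: sum_fun_apply w)
    qed
  qed
  moreover have "(\<Sum>s\<in>S. cscale (a s) (w s)) \<in> cfun.span (\<Union>s\<in>S. ?T s)"
    using w(1) by (intro cfun.span_sum cfun.span_scale cfun.span_base) blast
  ultimately show ?thesis by metis
qed

text \<open>The right-hand side does not depend on \<open>S\<close>, so adding another point of the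
  line does not enlarge the span.\<close>

lemma double_span_line:
  assumes S: "finite S" "d c < card S"
  shows "double_span (multi_exponents k n d) (segre_veronese k n d) ((\<lambda>s. pt k n d (line_point s)) ` S) =
    coord_space low_exponents"
proof -
  let ?T = "\<lambda>s. tangent_space (multi_exponents k n d) (segre_veronese k n d) (pt k n d (line_point s))"
  have line: "\<forall>i<k. \<forall>j\<le>n i. j \<notin> line_coords i \<longrightarrow> line_point s i j = 0" for s
    by (simp add: line_coords_def line_point_def)
  have sub: "cfun.subspace (coord_space low_exponents)"
    by (rule cfun.subspaceI) (auto simp: coord_space_def)
  have "?T s \<subseteq> coord_space low_exponents" for s
    by (rule tangent_space_line[OF valid_line_point line])
  then have 1: "cfun.span (\<Union>s\<in>S. ?T s) \<subseteq> coord_space low_exponents"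
    using sub by (intro cfun.span_minimal) auto
  have 2: "coord_space low_exponents \<subseteq> cfun.span (\<Union>s\<in>S. ?T s)"
  proof
    fix v assume v: "v \<in> coord_space low_exponents"
    have fin: "finite low_exponents"
      by (rule finite_subset[OF _ finite_exps[of k n d]]) (auto simp: low_exponents_def)
    have "v = (\<Sum>e\<in>low_exponents. cscale (v e) (\<lambda>e'. if e' = e then 1 else 0))"
    proof
      fix e'
      have "(\<Sum>e\<in>low_exponents. v e * (if e' = e then 1 else 0)) = (\<Sum>e\<in>low_exponents. if e' = e then v e else 0)"
        by (intro sum.cong) auto
      also have "\<dots> = v e'" using fin v by (auto simp: coord_space_def)
      finally show "v e' = (\<Sum>e\<in>low_exponents. cscale (v e) (\<lambda>e'. if e' = e then 1 else 0)) e'"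
        by (simp add: sum_fun_apply)
    qed
    moreover have "(\<Sum>e\<in>low_exponents. cscale (v e) (\<lambda>e'. if e' = e then 1 else 0)) \<in> cfun.span (\<Union>s\<in>S. ?T s)"
      using unit_in_span[OF S] by (intro cfun.span_sum cfun.span_scale) auto
    ultimately show "v \<in> cfun.span (\<Union>s\<in>S. ?T s)" by metis
  qed
  show ?thesis unfolding double_span_def image_image using 1 2 by auto
qed

text \<open>The parameter is recovered as the ratio of two entries: one is constantly
  \<open>1\<close>, the other is \<open>s\<close>.\<close>

lemma inj_line_point: "inj (\<lambda>s. pt k n d (line_point s))"
proof (rule injI)
  fix s s' assume "pt k n d (line_point s) = pt k n d (line_point s')"
  then have "multi_monomials k n d (line_point s) \<in> pt k n d (line_point s')" by (metis proj_point_self)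
  then obtain a where a: "multi_monomials k n d (line_point s) = cscale a (multi_monomials k n d (line_point s'))"
    by (auto simp: proj_point_def)
  let ?o = "top_exponent k d (\<lambda>_. 0)"
  let ?e = "move ?o c 0 1"
  have o: "?o \<in> multi_exponents k n d" by (rule top_exponent_in) simp
  have e: "?e \<in> multi_exponents k n d"
    using c n d by (intro move_in o) (auto simp: top_exponent_def)
  have o_val: "multi_monomials k n d (line_point s) ?o = 1" for s
    using o by (simp add: nu_apply mon_line_point) (auto simp: line_coords_def top_exponent_def)
  have e0: "\<forall>i<k. \<forall>j\<le>n i. j \<notin> line_coords i \<longrightarrow> ?e i j = 0"
    by (auto simp: line_coords_def top_exponent_def move_def upd2_apply)
  have "?e c 1 = 1" by (simp add: top_exponent_def move_def upd2_apply)
  then have e_val: "multi_monomials k n d (line_point s) ?e = s" for s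
    using e by (simp only: nu_apply mon_line_point if_P[OF e0] if_True power_one_right)
  have "a = 1" using fun_cong[OF a, of ?o] by (simp add: o_val)
  then show "s = s'" using fun_cong[OF a, of ?e] by (simp add: e_val del: One_nat_def)
qed

text \<open>A point on the line and the line itself form a chain of length \<open>1\<close>.\<close>

lemma line_coords_chain:
  assumes C: "coord_subvariety k n d line_coords \<subseteq> C" "C \<subseteq> segre_veronese k n d"
  shows "zariski_dim C > 0"
proof -
  let ?Z0 = "coord_subvariety k n d (\<lambda>i. {0})" and ?Z1 = "coord_subvariety k n d line_coords"
  have Z01: "?Z0 \<subseteq> ?Z1" by (rule coord_subvariety_mono) (simp add: line_coords_def)
  have "enat 1 \<le> zariski_dim C"
  proof (rule zariski_dim_geI[where Z = "\<lambda>j. if j = 0 then ?Z0 else ?Z1"])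
    fix j :: nat
    show "zariski_closed_in C (if j = 0 then ?Z0 else ?Z1)"
      using C Z01 d by (auto intro!: coord_subvariety_closed)
    show "zariski_irreducible (if j = 0 then ?Z0 else ?Z1)"
      by (auto intro!: coord_subvariety_irreducible simp: line_coords_def)
    assume "j < 1"
    have "pt k n d (line_point 1) \<in> ?Z1"
      unfolding coord_subvariety_iff(2)[OF d valid_line_point] by (simp add: line_coords_def line_point_def)
    moreover have "pt k n d (line_point 1) \<notin> ?Z0"
      unfolding coord_subvariety_iff(2)[OF d valid_line_point]
      using c n by (auto simp: line_point_def intro!: exI[of _ c] exI[of _ 1])
    ultimately have "?Z0 \<subset> ?Z1" using Z01 by blast
    then show "(if j = 0 then ?Z0 else ?Z1) \<subset> (if Suc j = 0 then ?Z0 else ?Z1)" using \<open>j < 1\<close> by simp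
  qed
  then show ?thesis by (cases "zariski_dim C") (auto simp: zero_enat_def)
qed

lemma loci_nonempty:
  assumes r: "d c < r" and low: "low_exponents \<noteq> multi_exponents k n d"
  shows "strong_base_locus (multi_exponents k n d) (segre_veronese k n d) r \<noteq> {}"
    and "positive_contact_locus (multi_exponents k n d) (segre_veronese k n d) r \<noteq> {}"
proof -
  let ?E = "multi_exponents k n d" and ?X = "segre_veronese k n d"
  let ?P = "\<lambda>s. pt k n d (line_point s)"
  have smooth: "smooth_locus ?E ?X = ?X" using k d by (intro smooth_locus_segre_veronese) auto
  have PX: "?P s \<in> ?X" for s using valid_line_point by (auto simp: segre_veronese_eq)
  \<comment> \<open>\<open>A\<close> sits at the parameters \<open>0\<close> to \<open>r - 1\<close>
    and the extra point \<open>q\<close> at \<open>r\<close>.\<close>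
  define S :: "complex set" where "S = of_nat ` {..<r}"
  have S: "finite S" "card S = r" by (simp_all add: S_def card_image inj_on_def)
  have rS: "of_nat r \<notin> S" by (auto simp: S_def)
  let ?A = "?P ` S" and ?q = "?P (of_nat r)"
  have span: "double_span ?E ?X ?A = coord_space low_exponents"
    using S r by (intro double_span_line) auto
  have "?A \<union> {?q} = ?P ` insert (of_nat r) S" by auto
  then have span': "double_span ?E ?X (?A \<union> {?q}) = coord_space low_exponents"
    using S r rS by (simp only:) (intro double_span_line, auto)
  have "?q \<notin> ?A" using rS inj_line_point by (auto dest: injD)
  then have q: "?q \<in> smooth_locus ?E ?X - ?A" using PX smooth by blast
  have "card ?A = r" using S inj_line_point by (simp add: card_image inj_on_subset)
  then have A: "?A \<in> smooth_point_sets ?E ?X r"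
    using PX S(1) smooth by (auto simp: smooth_point_sets_def)
  have "low_exponents \<subseteq> ?E" by (auto simp: low_exponents_def)
  then obtain e where e: "e \<in> ?E" "e \<notin> low_exponents" using low by blast
  have "(\<lambda>e'. if e' = e then 1 else 0) \<in> coord_space ?E - coord_space low_exponents"
    using e by (auto simp: coord_space_def)
  then have ne: "double_span ?E ?X ?A \<noteq> coord_space ?E" using span by blast
  have "?A \<in> strong_base_locus ?E ?X r"
    unfolding strong_base_locus_def
  proof (intro CollectI conjI A ne bexI[OF _ q])
    show "double_span ?E ?X (?A \<union> {?q}) = double_span ?E ?X ?A" by (simp only: span span')
  qed
  then show "strong_base_locus ?E ?X r \<noteq> {}" by blast
  have "coord_subvariety k n d line_coords \<subseteq> contact_locus ?E ?X ?A"
  proof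
    fix p assume p: "p \<in> coord_subvariety k n d line_coords"
    then obtain y where y: "p = pt k n d y" "valid k n y" "\<forall>i<k. \<forall>j\<le>n i. j \<notin> line_coords i \<longrightarrow> y i j = 0"
      by (auto simp: coord_subvariety_def)
    show "p \<in> contact_locus ?E ?X ?A"
      using tangent_space_line[OF y(2,3)] span smooth y(1,2) by (auto simp: contact_locus_def segre_veronese_eq)
  qed
  moreover have "contact_locus ?E ?X ?A \<subseteq> ?X" using smooth by (auto simp: contact_locus_def)
  ultimately have "zariski_dim (contact_locus ?E ?X ?A) > 0" by (rule line_coords_chain)
  with A ne have "?A \<in> positive_contact_locus ?E ?X r"
    unfolding positive_contact_locus_def by (intro CollectI conjI)
  then show "positive_contact_locus ?E ?X r \<noteq> {}" by blast
qed

text \<open>The span is proper if some monomial has degree at least \<open>2\<close> in the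
  coordinates that vanish on the line: a power of one of them, or a product of two from different
  factors.\<close>

lemma low_exponents_neq:
  assumes "(\<exists>i<k. \<exists>j\<le>n i. j \<notin> line_coords i \<and> 2 \<le> d i) \<or>
    (\<exists>i<k. \<exists>i'<k. \<exists>j\<le>n i. \<exists>j'\<le>n i'. j \<notin> line_coords i \<and> j' \<notin> line_coords i' \<and> i \<noteq> i')"
  shows "low_exponents \<noteq> multi_exponents k n d"
proof -
  have "\<exists>e\<in>multi_exponents k n d. e \<notin> low_exponents"
    using assms
  proof
    assume "\<exists>i<k. \<exists>j\<le>n i. j \<notin> line_coords i \<and> 2 \<le> d i"
    then obtain i j where ij: "i < k" "j \<le> n i" "j \<notin> line_coords i" "2 \<le> d i" by blast
    let ?e = "top_exponent k d ((\<lambda>_. 0)(i := j))"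
    have "?e i j = d i" using ij by (simp add: top_exponent_def)
    then have "\<not> ?e i j \<le> (if i = i0 \<and> j = j0 then 1 else 0)" for i0 j0
      using ij(4) by auto
    then have "?e \<notin> low_exponents" using ij(1-3) unfolding low_exponents_def by blast
    moreover have "?e \<in> multi_exponents k n d" using ij by (intro top_exponent_in) auto
    ultimately show ?thesis by blast
  next
    assume "\<exists>i<k. \<exists>i'<k. \<exists>j\<le>n i. \<exists>j'\<le>n i'. j \<notin> line_coords i \<and> j' \<notin> line_coords i' \<and> i \<noteq> i'"
    then obtain i j i' j' where ij: "i < k" "j \<le> n i" "j \<notin> line_coords i"
      "i' < k" "j' \<le> n i'" "j' \<notin> line_coords i'" "i \<noteq> i'" by blast
    let ?e = "top_exponent k d ((\<lambda>_. 0)(i := j, i' := j'))"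
    have "?e i j = d i" "?e i' j' = d i'" using ij by (simp_all add: top_exponent_def)
    then have pos: "?e i j \<noteq> 0" "?e i' j' \<noteq> 0" using d ij by auto
    have "?e \<notin> low_exponents"
    proof
      assume "?e \<in> low_exponents"
      then obtain i0 j0 where low: "\<forall>i'<k. \<forall>j'\<le>n i'. j' \<notin> line_coords i' \<longrightarrow>
          ?e i' j' \<le> (if i' = i0 \<and> j' = j0 then 1 else 0)"
        unfolding low_exponents_def by blast
      then have "?e i j \<le> (if i = i0 \<and> j = j0 then 1 else 0)" "?e i' j' \<le> (if i' = i0 \<and> j' = j0 then 1 else 0)"
        using ij by blast+
      then show False using pos ij(7) by (auto split: if_splits)
    qed
    moreover have "?e \<in> multi_exponents k n d" using ij by (intro top_exponent_in) auto
    ultimately show ?thesis by blast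
  qed
  then show ?thesis by blast
qed

end


section \<open>Hypersurfaces singular at given points\<close>

context
  fixes k :: nat and n :: "nat \<Rightarrow> nat"
begin

definition lin :: "nat \<Rightarrow> (nat \<Rightarrow> complex) \<Rightarrow> (nat \<Rightarrow> nat \<Rightarrow> complex) \<Rightarrow> complex" where
  "lin i l y = (\<Sum>j\<le>n i. l j * y i j)"

text \<open>For valid \<open>q\<close> and \<open>a\<close> this says that their components in
  factor \<open>i\<close> are different points; in this form it supplies the linear form used
  later.\<close>

definition separated :: "(nat \<Rightarrow> nat \<Rightarrow> complex) \<Rightarrow> (nat \<Rightarrow> nat \<Rightarrow> complex) \<Rightarrow> nat \<Rightarrow> bool" where
  "separated q a i \<longleftrightarrow> (\<exists>l. lin i l a = 0 \<and> lin i l q \<noteq> 0)"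

lemma mforms_cong: "(\<And>i. i < k \<Longrightarrow> a i = b i) \<Longrightarrow> mforms k n a = mforms k n b"
proof -
  assume "\<And>i. i < k \<Longrightarrow> a i = b i"
  then have "multi_exponents k n a = multi_exponents k n b" unfolding multi_exponents_def by auto
  then show ?thesis unfolding mforms_def by simp
qed

lemma lin_mforms:
  assumes i: "i < k"
  shows "lin i l \<in> mforms k n (\<lambda>i'. if i' = i then 1 else 0)"
proof -
  let ?u = "\<lambda>j. upd2 (\<lambda>_ _. 0) i j (1::nat)"
  have mon: "mon k n y (?u j) = y i j" if "j \<le> n i" for y j
  proof -
    have "upd2 (\<lambda>_ _. 0 :: nat) i j 0 = (\<lambda>_ _. 0)" by (intro ext) (simp add: upd2_apply)
    then have "mon k n y (?u j) = y i j * mon k n y (\<lambda>_ _. 0)"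
      using mon_upd2[where k = k and n = n, OF i that, of y "\<lambda>_ _. 0" 1] by simp
    then show ?thesis by (simp add: mon_def)
  qed
  have u: "?u j \<in> multi_exponents k n (\<lambda>i'. if i' = i then 1 else 0)" if "j \<le> n i" for j
    using that i by (auto simp: multi_exponents_def upd2_apply)
  have "lin i l = (\<Sum>j\<le>n i. cscale (l j) (\<lambda>y. mon k n y (?u j)))"
    unfolding lin_def by (intro ext) (simp add: sum_fun_apply mon del: One_nat_def)
  also have "\<dots> \<in> mforms k n (\<lambda>i'. if i' = i then 1 else 0)"
    unfolding mforms_def using u by (intro cfun.span_sum cfun.span_scale cfun.span_base) blast
  finally show ?thesis .
qed

lemma prod_lin_mforms:
  assumes "finite I" "\<And>x. x \<in> I \<Longrightarrow> g x < k"
  shows "(\<lambda>y. \<Prod>x\<in>I. lin (g x) (l x) y) \<in> mforms k n (\<lambda>i. card {x\<in>I. g x = i})"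
  using assms
proof (induction I rule: finite_induct)
  case empty
  then show ?case using mforms_one by simp
next
  case (insert x I)
  have "(\<lambda>y. lin (g x) (l x) y * (\<Prod>x\<in>I. lin (g x) (l x) y)) \<in>
      mforms k n (\<lambda>i. (if i = g x then 1 else 0) + card {x\<in>I. g x = i})"
    using insert by (intro mforms_mult lin_mforms) auto
  moreover have "(if i = g x then 1 else 0) + card {x\<in>I. g x = i} = card {x'\<in>insert x I. g x' = i}" for i
  proof -
    have "{x'\<in>insert x I. g x' = i} = (if i = g x then insert x {x\<in>I. g x = i} else {x\<in>I. g x = i})" by auto
    then show ?thesis using insert.hyps by simp
  qed
  ultimately show ?case using insert.hyps by simp
qed

text \<open>Forms of multidegree \<open>d\<close> are the pullbacks of linear functionals on the
  target.\<close>

lemma mforms_functional: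
  assumes "f \<in> mforms k n d"
  shows "\<exists>c. \<forall>y. f y = (\<Sum>e\<in>multi_exponents k n d. c e * multi_monomials k n d y e)"
  using assms unfolding mforms_def
proof (induction rule: cfun.span_induct_alt)
  case base
  show ?case by (rule exI[of _ "\<lambda>_. 0"]) simp
next
  case (step b g h)
  then obtain c where c: "\<forall>y. h y = (\<Sum>e\<in>multi_exponents k n d. c e * multi_monomials k n d y e)" by blast
  obtain e0 where e0: "e0 \<in> multi_exponents k n d" "g = (\<lambda>y. mon k n y e0)" using step(1) by blast
  show ?case
  proof (intro exI[of _ "\<lambda>e. (if e = e0 then b else 0) + c e"] allI)
    fix y
    have "(\<Sum>e\<in>multi_exponents k n d. (if e = e0 then b else 0) * multi_monomials k n d y e) =
        (\<Sum>e\<in>multi_exponents k n d. if e = e0 then b * mon k n y e else 0)"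
      by (intro sum.cong) (auto simp: nu_apply)
    also have "\<dots> = b * mon k n y e0" using e0 by simp
    finally show "(cscale b g + h) y =
        (\<Sum>e\<in>multi_exponents k n d. ((if e = e0 then b else 0) + c e) * multi_monomials k n d y e)"
      using c by (simp add: e0(2) distrib_right sum.distrib)
  qed
qed

lemma functional_deriv:
  assumes c: "\<forall>y. f y = (\<Sum>e\<in>multi_exponents k n d. c e * multi_monomials k n d y e)" and ij: "i < k" "j \<le> n i"
  shows "((\<lambda>t. f (upd2 y i j t)) has_field_derivative
    (\<Sum>e\<in>multi_exponents k n d. c e * Dv k n d y i j e)) (at (y i j))"
  unfolding c[rule_format] by (intro DERIV_sum DERIV_cmult nu_curve_deriv ij)

lemma mforms_deriv:
  assumes "f \<in> mforms k n d" "i < k" "j \<le> n i"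
  shows "\<exists>D. ((\<lambda>t. f (upd2 y i j t)) has_field_derivative D) (at (y i j))"
  using mforms_functional[OF assms(1)] functional_deriv assms(2,3) by blast

text \<open>The functional of \<open>f\<close> kills the tangent spaces along \<open>A\<close> by
  the product rule, since both factors vanish there. It does not kill the one at \<open>q\<close>,
  where \<open>f\<close> or one of its derivatives is nonzero.\<close>

lemma tangent_space_not_in_span:
  assumes k: "0 < k" and d: "\<forall>i<k. d i \<noteq> 0" and q: "valid k n q" and A: "\<And>a. a \<in> A \<Longrightarrow> valid k n a"
    and f: "f \<in> mforms k n d" "\<And>y. f y = F y * G y"
    and F: "F \<in> mforms k n df" "\<And>a. a \<in> A \<Longrightarrow> F a = 0"
    and G: "G \<in> mforms k n dg" "\<And>a. a \<in> A \<Longrightarrow> G a = 0"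
    and fq: "f q \<noteq> 0 \<or> (\<exists>i<k. \<exists>j\<le>n i. \<exists>D. D \<noteq> 0 \<and> ((\<lambda>t. f (upd2 q i j t)) has_field_derivative D) (at (q i j)))"
  shows "\<not> tangent_space (multi_exponents k n d) (segre_veronese k n d) (pt k n d q) \<subseteq>
    cfun.span (\<Union>a\<in>A. tangent_space (multi_exponents k n d) (segre_veronese k n d) (pt k n d a))"
proof
  let ?E = "multi_exponents k n d"
  let ?T = "\<lambda>y. tangent_space ?E (segre_veronese k n d) (pt k n d y)"
  let ?S = "\<lambda>y. {Dv k n d y i j |i j. i < k \<and> j \<le> n i}"
  assume sub: "?T q \<subseteq> cfun.span (\<Union>a\<in>A. ?T a)"
  have T: "?T y = cfun.span (?S y)" if "valid k n y" for y
    using tangent_space_basis(1)[of k d n y] k d that by auto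
  obtain c where c: "\<forall>y. f y = (\<Sum>e\<in>?E. c e * multi_monomials k n d y e)"
    using mforms_functional[OF f(1)] by blast
  define L where "L = (\<lambda>v. \<Sum>e\<in>?E. c e * v e)"
  have L_sub: "cfun.subspace {v. L v = 0}"
  proof (rule cfun.subspaceI)
    fix b v assume v: "v \<in> {v. L v = 0}"
    have "L (cscale b v) = b * L v" by (simp add: L_def sum_distrib_left mult.left_commute)
    then show "cscale b v \<in> {v. L v = 0}" using v by simp
  qed (auto simp: L_def distrib_left sum.distrib)
  have "?T a \<subseteq> {v. L v = 0}" if a: "a \<in> A" for a
    unfolding T[OF A[OF a]]
  proof (rule cfun.span_minimal[OF _ L_sub], rule subsetI)
    fix v assume "v \<in> ?S a"
    then obtain i j where v: "v = Dv k n d a i j" "i < k" "j \<le> n i" by blast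
    obtain DF DG where D: "((\<lambda>t. F (upd2 a i j t)) has_field_derivative DF) (at (a i j))"
      "((\<lambda>t. G (upd2 a i j t)) has_field_derivative DG) (at (a i j))"
      using mforms_deriv[OF F(1) v(2,3)] mforms_deriv[OF G(1) v(2,3)] by blast
    have "((\<lambda>t. f (upd2 a i j t)) has_field_derivative 0) (at (a i j))"
      unfolding f(2) using DERIV_mult[OF D] F(2)[OF a] G(2)[OF a] by simp
    then have "L v = 0"
      unfolding L_def v(1) using functional_deriv[OF c v(2,3)] DERIV_unique by blast
    then show "v \<in> {v. L v = 0}" by simp
  qed
  then have "cfun.span (\<Union>a\<in>A. ?T a) \<subseteq> {v. L v = 0}"
    by (intro cfun.span_minimal[OF _ L_sub]) blast
  then have Lq: "L v = 0" if "v \<in> ?T q" for v using sub that by blast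
  show False
    using fq
  proof
    assume nz: "f q \<noteq> 0"
    have "multi_monomials k n d q \<in> ?T q" unfolding T[OF q] using k d by (intro nu_in_span_Dv) auto
    then have "L (multi_monomials k n d q) = 0" by (rule Lq)
    then show False using nz c by (simp add: L_def)
  next
    assume "\<exists>i<k. \<exists>j\<le>n i. \<exists>D. D \<noteq> 0 \<and> ((\<lambda>t. f (upd2 q i j t)) has_field_derivative D) (at (q i j))"
    then obtain i j D where D: "i < k" "j \<le> n i" "D \<noteq> 0"
      "((\<lambda>t. f (upd2 q i j t)) has_field_derivative D) (at (q i j))" by blast
    have "Dv k n d q i j \<in> ?T q" unfolding T[OF q] using D by (intro cfun.span_base) blast
    then have "L (Dv k n d q i j) = 0" by (rule Lq)
    then have "D = 0" using functional_deriv[OF c D(1,2)] D(4) DERIV_unique unfolding L_def by metis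
    then show False using D(3) by simp
  qed
qed

section \<open>Distributing the degrees of the linear forms\<close>

lemma lin_two:
  assumes "j \<le> n i" "j' \<le> n i" "j \<noteq> j'"
  shows "lin i (\<lambda>l. if l = j then a else if l = j' then b else 0) y = a * y i j + b * y i j'"
proof -
  have "lin i (\<lambda>l. if l = j then a else if l = j' then b else 0) y =
      (\<Sum>l\<le>n i. (if l = j then a * y i l else 0) + (if l = j' then b * y i l else 0))"
    unfolding lin_def using assms(3) by (intro sum.cong) auto
  then show ?thesis using assms(1,2) by (simp add: sum.distrib)
qed

lemma not_separated_proportional:
  assumes q: "valid k n q" and a: "valid k n a" and i: "i < k" "\<not> separated q a i"
  shows "\<exists>c. c \<noteq> 0 \<and> (\<forall>j\<le>n i. q i j = c * a i j)"
proof -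
  obtain J where J: "J \<le> n i" "a i J \<noteq> 0" using a i by (auto simp: valid_def)
  have eq: "q i j = q i J / a i J * a i j" if j: "j \<le> n i" for j
  proof (cases "j = J")
    case False
    let ?l = "\<lambda>l. if l = j then a i J else if l = J then - a i j else 0"
    have l: "lin i ?l y = a i J * y i j - a i j * y i J" for y
      using lin_two[OF j J(1) False] by simp
    have "lin i ?l a = 0" unfolding l by simp
    then have "lin i ?l q = 0" using i(2) unfolding separated_def by blast
    then show ?thesis using J(2) unfolding l by (simp add: field_simps)
  qed (use J in simp)
  obtain j where "j \<le> n i" "q i j \<noteq> 0" using q i by (auto simp: valid_def)
  then have "q i J / a i J \<noteq> 0" using eq by force
  then show ?thesis using eq by blast
qed

lemma separated_exists:
  assumes q: "valid k n q" and a: "valid k n a" and ne: "pt k n d q \<noteq> pt k n d a"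
  shows "\<exists>i<k. separated q a i"
proof (rule ccontr)
  assume "\<not> ?thesis"
  then have "\<forall>i<k. \<exists>c. c \<noteq> 0 \<and> (\<forall>j\<le>n i. q i j = c * a i j)"
    using not_separated_proportional[OF q a] by blast
  then obtain c where c: "\<forall>i<k. c i \<noteq> 0 \<and> (\<forall>j\<le>n i. q i j = c i * a i j)" by metis
  have "multi_monomials k n d q = multi_monomials k n d (\<lambda>i. cscale (c i) (a i))"
    by (rule nu_cong) (use c in simp)
  also have "\<dots> = cscale (\<Prod>i<k. c i ^ d i) (multi_monomials k n d a)" by (rule nu_scale)
  finally show False using ne c by (simp add: proj_point_cscale)
qed

text \<open>Supplies the missing degrees by powers of coordinates that are nonzero at
  \<open>q\<close>.\<close>

lemma nonvanishing_form:
  assumes q: "valid k n q" and le: "\<And>i. i < k \<Longrightarrow> c i \<le> d i"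
  shows "\<exists>P. P \<in> mforms k n (\<lambda>i. d i - c i) \<and> P q \<noteq> 0"
proof -
  obtain J where J: "\<And>i. i < k \<Longrightarrow> J i \<le> n i" "\<And>i. i < k \<Longrightarrow> q i (J i) \<noteq> 0"
    using validE[OF q] by blast
  let ?I = "SIGMA i:{..<k}. {..<d i - c i}"
  let ?l = "\<lambda>x :: nat \<times> nat. \<lambda>j. if j = J (fst x) then 1 else 0 :: complex"
  have l: "lin (fst x) (?l x) y = y (fst x) (J (fst x))" if "x \<in> ?I" for x y
  proof -
    have "lin (fst x) (?l x) y = (\<Sum>j\<le>n (fst x). if j = J (fst x) then y (fst x) j else 0)"
      unfolding lin_def by (intro sum.cong) auto
    then show ?thesis using J(1)[of "fst x"] that by auto
  qed
  have "(\<lambda>y. \<Prod>x\<in>?I. lin (fst x) (?l x) y) \<in> mforms k n (\<lambda>i. card {x\<in>?I. fst x = i})"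
    by (intro prod_lin_mforms) auto
  also have "mforms k n (\<lambda>i. card {x\<in>?I. fst x = i}) = mforms k n (\<lambda>i. d i - c i)"
  proof (rule mforms_cong)
    fix i assume "i < k"
    then have "{x\<in>?I. fst x = i} = {i} \<times> {..<d i - c i}" by auto
    then show "card {x\<in>?I. fst x = i} = d i - c i" by (simp add: card_cartesian_product)
  qed
  finally have "(\<lambda>y. \<Prod>x\<in>?I. lin (fst x) (?l x) y) \<in> mforms k n (\<lambda>i. d i - c i)" .
  moreover have "(\<Prod>x\<in>?I. lin (fst x) (?l x) q) \<noteq> 0"
    using J(2) by (auto simp: l simp del: mem_Sigma_iff)
  ultimately show ?thesis by blast
qed

text \<open>Each point of \<open>A\<close> gets two linear forms that vanish there but not at
  \<open>q\<close>, in different factors if possible. Factor \<open>i\<close> then carries degree at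
  most \<open>2 * card (Si i) + card (A - S)\<close>, which fits into \<open>card A\<close> unless
  \<open>Si i\<close> contains more than half of \<open>S\<close>. Only one factor can violate this,
  and there the second forms are traded for a simple zero at \<open>q\<close>.\<close>

lemma few_points_not_in_span:
  assumes k: "2 \<le> k" and n: "\<forall>i<k. 1 \<le> n i" and d: "\<forall>i<k. d i \<noteq> 0"
    and A: "finite A" "\<And>a. a \<in> A \<Longrightarrow> valid k n a" "\<And>i. i < k \<Longrightarrow> card A \<le> d i"
    and q: "valid k n q" "\<And>a. a \<in> A \<Longrightarrow> pt k n d q \<noteq> pt k n d a"
  shows "\<not> tangent_space (multi_exponents k n d) (segre_veronese k n d) (pt k n d q) \<subseteq>
    cfun.span (\<Union>a\<in>A. tangent_space (multi_exponents k n d) (segre_veronese k n d) (pt k n d a))"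
proof -
  have k0: "0 < k" using k by simp
  \<comment> \<open>The factors of the two linear forms for \<open>a\<close>; they coincide only if
    no other factor separates \<open>a\<close> from \<open>q\<close>.\<close>
  define Q where "Q = (\<lambda>a i i'. i < k \<and> i' < k \<and> separated q a i \<and> separated q a i' \<and>
    (i = i' \<longrightarrow> (\<forall>l<k. separated q a l \<longrightarrow> l = i)))"
  have "\<exists>i i'. Q a i i'" if a: "a \<in> A" for a
  proof -
    obtain i where i: "i < k" "separated q a i"
      using separated_exists[OF q(1) A(2)[OF a] q(2)[OF a]] by blast
    show ?thesis
    proof (cases "\<exists>i'<k. separated q a i' \<and> i' \<noteq> i")
      case True
      then obtain i' where "i' < k" "separated q a i'" "i' \<noteq> i" by blast
      then have "Q a i i'" using i by (simp add: Q_def)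
      then show ?thesis by blast
    next
      case False
      then have "\<forall>l<k. separated q a l \<longrightarrow> l = i" by blast
      with i have "Q a i i" unfolding Q_def by blast
      then show ?thesis by blast
    qed
  qed
  then have "\<forall>a\<in>A. \<exists>i i'. Q a i i'" by blast
  from bchoice[OF this] obtain f1 where "\<forall>a\<in>A. \<exists>i'. Q a (f1 a) i'" ..
  from bchoice[OF this] obtain f2 where Q: "\<forall>a\<in>A. Q a (f1 a) (f2 a)" ..
  have f: "\<And>a. a \<in> A \<Longrightarrow> f1 a < k" "\<And>a. a \<in> A \<Longrightarrow> f2 a < k"
    "\<And>a. a \<in> A \<Longrightarrow> separated q a (f1 a)" "\<And>a. a \<in> A \<Longrightarrow> separated q a (f2 a)"
    "\<And>a l. a \<in> A \<Longrightarrow> f1 a = f2 a \<Longrightarrow> l < k \<Longrightarrow> separated q a l \<Longrightarrow> l = f1 a"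
    using Q unfolding Q_def by simp_all
  obtain l1 where l1: "\<And>a. a \<in> A \<Longrightarrow> lin (f1 a) (l1 a) a = 0" "\<And>a. a \<in> A \<Longrightarrow> lin (f1 a) (l1 a) q \<noteq> 0"
    using f(3) unfolding separated_def by metis
  obtain l2 where l2: "\<And>a. a \<in> A \<Longrightarrow> lin (f2 a) (l2 a) a = 0" "\<And>a. a \<in> A \<Longrightarrow> lin (f2 a) (l2 a) q \<noteq> 0"
    using f(4) unfolding separated_def by metis
  \<comment> \<open>\<open>S\<close>: the points that differ from \<open>q\<close> in one factor only\<close>
  define S where "S = {a \<in> A. f1 a = f2 a}"
  define Si where "Si = (\<lambda>i. {a \<in> A. f1 a = f2 a \<and> f1 a = i})"
  define U where "U = (\<lambda>i. {a \<in> A - S. f1 a = i})"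
  define V where "V = (\<lambda>i. {a \<in> A - S. f2 a = i})"
  have fin: "finite S" "finite (Si i)" "finite (U i)" "finite (V i)" for i
    using A(1) by (auto simp: S_def Si_def U_def V_def)
  have UV: "card (U i) + card (V i) \<le> card (A - S)" for i
  proof -
    have "U i \<inter> V i = {}" by (auto simp: U_def V_def S_def)
    then have "card (U i) + card (V i) = card (U i \<union> V i)" using fin by (simp add: card_Un_disjoint)
    also have "\<dots> \<le> card (A - S)" using A(1) by (intro card_mono) (auto simp: U_def V_def)
    finally show ?thesis .
  qed
  have cA: "card A = card S + card (A - S)"
    using A(1) by (metis (no_types, lifting) S_def card_Diff_subset card_mono fin(1) le_add_diff_inverse mem_Collect_eq subsetI)
  have c1: "card {a\<in>A. f1 a = i} \<le> card (Si i) + card (U i)" for i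
  proof -
    have "{a\<in>A. f1 a = i} \<subseteq> Si i \<union> U i" by (auto simp: Si_def U_def S_def)
    then have "card {a\<in>A. f1 a = i} \<le> card (Si i \<union> U i)" using fin by (intro card_mono) auto
    then show ?thesis using card_Un_le[of "Si i" "U i"] by linarith
  qed
  have c2: "card {a\<in>A. f2 a = i} \<le> card (Si i) + card (V i)" for i
  proof -
    have "{a\<in>A. f2 a = i} \<subseteq> Si i \<union> V i" by (auto simp: Si_def V_def S_def)
    then have "card {a\<in>A. f2 a = i} \<le> card (Si i \<union> V i)" using fin by (intro card_mono) auto
    then show ?thesis using card_Un_le[of "Si i" "V i"] by linarith
  qed
  have SiS: "card (Si i) + card (Si i') \<le> card S" if "i \<noteq> i'" for i i'
  proof -
    have "card (Si i) + card (Si i') = card (Si i \<union> Si i')"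
      using that fin by (subst card_Un_disjoint) (auto simp: Si_def)
    also have "\<dots> \<le> card S" using fin(1) by (intro card_mono) (auto simp: Si_def S_def)
    finally show ?thesis .
  qed
  let ?F = "\<lambda>y. \<Prod>b\<in>A. lin (f1 b) (l1 b) y"
  have F: "?F \<in> mforms k n (\<lambda>i. card {a\<in>A. f1 a = i})"
    using A(1) f(1) by (intro prod_lin_mforms) auto
  have FA: "?F a = 0" if "a \<in> A" for a using that A(1) l1(1) by auto
  have Fq: "?F q \<noteq> 0" using A(1) l1(2) by simp
  have G_gen: "(\<lambda>y. \<Prod>a\<in>A'. lin (f2 a) (l2 a) y) \<in> mforms k n (\<lambda>i. card {a\<in>A'. f2 a = i})"
    "(\<Prod>a\<in>A'. lin (f2 a) (l2 a) q) \<noteq> 0" "\<And>a. a \<in> A' \<Longrightarrow> (\<Prod>b\<in>A'. lin (f2 b) (l2 b) a) = 0"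
    if "A' \<subseteq> A" for A'
  proof -
    have "finite A'" using that A(1) finite_subset by blast
    show "(\<lambda>y. \<Prod>a\<in>A'. lin (f2 a) (l2 a) y) \<in> mforms k n (\<lambda>i. card {a\<in>A'. f2 a = i})"
      using \<open>finite A'\<close> that f(2) by (intro prod_lin_mforms) auto
    show "(\<Prod>a\<in>A'. lin (f2 a) (l2 a) q) \<noteq> 0" using \<open>finite A'\<close> that l2(2) by auto
    show "(\<Prod>b\<in>A'. lin (f2 b) (l2 b) a) = 0" if "a \<in> A'" for a
      using \<open>finite A'\<close> that \<open>A' \<subseteq> A\<close> l2(1) by auto
  qed
  show ?thesis
  proof (cases "\<forall>i<k. 2 * card (Si i) \<le> card S")
    case True
    let ?G = "\<lambda>y. \<Prod>a\<in>A. lin (f2 a) (l2 a) y"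
    let ?c = "\<lambda>i. card {a\<in>A. f1 a = i} + card {a\<in>A. f2 a = i}"
    have c: "?c i \<le> d i" if "i < k" for i
    proof -
      have "?c i \<le> 2 * card (Si i) + card (A - S)" using c1[of i] c2[of i] UV[of i] by linarith
      also have "\<dots> \<le> card A" using True that cA by simp
      finally show ?thesis using A(3)[OF that] by simp
    qed
    obtain P where P: "P \<in> mforms k n (\<lambda>i. d i - ?c i)" "P q \<noteq> 0"
      using nonvanishing_form[OF q(1), of ?c d] c by blast
    let ?f = "\<lambda>y. ?F y * (?G y * P y)"
    have "?f \<in> mforms k n (\<lambda>i. card {a\<in>A. f1 a = i} + (card {a\<in>A. f2 a = i} + (d i - ?c i)))"
      using F G_gen(1)[of A] P(1) by (intro mforms_mult) auto
    also have "\<dots> = mforms k n d"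
    proof (rule mforms_cong)
      fix i assume "i < k"
      from c[OF this] show "card {a\<in>A. f1 a = i} + (card {a\<in>A. f2 a = i} + (d i - ?c i)) = d i" by linarith
    qed
    finally have f_in: "?f \<in> mforms k n d" .
    show ?thesis
    proof (rule tangent_space_not_in_span[OF k0 d q(1) A(2) f_in refl F FA])
      show "(\<lambda>y. ?G y * P y) \<in> mforms k n (\<lambda>i. card {a\<in>A. f2 a = i} + (d i - ?c i))"
        using G_gen(1)[of A] P(1) by (intro mforms_mult) auto
      show "?G a * P a = 0" if "a \<in> A" for a using G_gen(3)[of A a] that by simp
      have "?f q \<noteq> 0" using Fq G_gen(2)[of A] P(2) by simp
      then show "?f q \<noteq> 0 \<or> (\<exists>i<k. \<exists>j\<le>n i. \<exists>D. D \<noteq> 0 \<and>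
          ((\<lambda>t. ?f (upd2 q i j t)) has_field_derivative D) (at (q i j)))" ..
    qed
  next
    case False
    \<comment> \<open>The forms for the points of \<open>Si i0\<close> would use up too much of the degree in factor \<open>i0\<close>. Instead of
      doubling them we use a single hyperplane \<open>m\<close> of another factor through \<open>q\<close>; it contains all
      of \<open>Si i0\<close>, and the product still vanishes only to first order at \<open>q\<close>.\<close>
    then obtain i0 where i0: "i0 < k" "card S < 2 * card (Si i0)" by auto
    define i' where "i' = (if i0 = 0 then 1 else 0 :: nat)"
    have i': "i' < k" "i' \<noteq> i0" using k by (auto simp: i'_def)
    obtain J where J: "J \<le> n i'" "q i' J \<noteq> 0" using q(1) i' by (auto simp: valid_def)
    define j where "j = (if J = 0 then 1 else 0 :: nat)"
    have j: "j \<le> n i'" "j \<noteq> J" using n i' by (auto simp: j_def)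
    \<comment> \<open>A minor of \<open>q\<close> and the variables: it vanishes at
      \<open>q\<close>, and its derivative in \<open>y i' j\<close> is \<open>q i' J\<close>, which
      is nonzero.\<close>
    define m where "m = (\<lambda>l. if l = j then q i' J else if l = J then - q i' j else 0)"
    have m: "lin i' m y = q i' J * y i' j - q i' j * y i' J" for y
      unfolding m_def using lin_two[OF j(1) J(1) j(2)] by simp
    have mq: "lin i' m q = 0" unfolding m by simp
    \<comment> \<open>Points of \<open>Si i0\<close> agree with \<open>q\<close> in all factors
      except \<open>i0\<close>.\<close>
    have ma: "lin i' m a = 0" if "a \<in> Si i0" for a
    proof -
      have a: "a \<in> A" "f1 a = f2 a" "f1 a = i0" using that by (auto simp: Si_def)
      have "\<not> separated q a i'" using f(5)[OF a(1,2) i'(1)] a(3) i'(2) by blast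
      then obtain c where c: "c \<noteq> 0" "\<forall>j\<le>n i'. q i' j = c * a i' j"
        using not_separated_proportional[OF q(1) A(2)[OF a(1)] i'(1)] by blast
      have "q i' J = c * a i' J" "q i' j = c * a i' j" using c(2) J(1) j(1) by blast+
      then show ?thesis unfolding m by simp
    qed
    let ?A' = "A - Si i0"
    let ?G = "\<lambda>y. \<Prod>a\<in>?A'. lin (f2 a) (l2 a) y"
    let ?c = "\<lambda>i. card {a\<in>A. f1 a = i} + ((if i = i' then 1 else 0) + card {a\<in>?A'. f2 a = i})"
    have c: "?c i \<le> d i" if "i < k" for i
    proof -
      have "?c i \<le> card A"
      proof (cases "i = i0")
        case True
        have "{a\<in>?A'. f2 a = i} \<subseteq> V i" using True by (auto simp: Si_def V_def S_def)
        then have "card {a\<in>?A'. f2 a = i} \<le> card (V i)" using fin by (intro card_mono) auto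
        moreover have "card (Si i) \<le> card S" using fin by (intro card_mono) (auto simp: Si_def S_def)
        ultimately show ?thesis using True c1[of i] UV[of i] cA i'(2) by simp
      next
        case False
        have "card {a\<in>?A'. f2 a = i} \<le> card {a\<in>A. f2 a = i}" using A(1) by (intro card_mono) auto
        then have "card {a\<in>?A'. f2 a = i} \<le> card (Si i) + card (V i)" using c2[of i] by simp
        \<comment> \<open>Less than half of \<open>S\<close> remains for the factors other than
          \<open>i0\<close>, which leaves room for the degree \<open>1\<close> of
          \<open>m\<close>.\<close>
        moreover have "2 * card (Si i) + 1 \<le> card S" using SiS[OF False] i0(2) by linarith
        moreover have "(if i = i' then 1 else 0) \<le> (1::nat)" by simp
        ultimately show ?thesis using c1[of i] UV[of i] cA by linarith
      qed
      then show ?thesis using A(3)[OF that] by simp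
    qed
    obtain P where P: "P \<in> mforms k n (\<lambda>i. d i - ?c i)" "P q \<noteq> 0"
      using nonvanishing_form[OF q(1), of ?c d] c by blast
    let ?H = "\<lambda>y. (lin i' m y * ?G y) * P y"
    let ?f = "\<lambda>y. ?F y * ?H y"
    \<comment> \<open>The cofactor of \<open>m\<close> in \<open>?f\<close>. As \<open>m\<close>
      vanishes at \<open>q\<close>, the derivative of \<open>?f\<close> there is that of
      \<open>m\<close> times the nonzero value \<open>?R q\<close>.\<close>
    let ?R = "\<lambda>y. ?F y * (?G y * P y)"
    have H: "?H \<in> mforms k n (\<lambda>i. ((if i = i' then 1 else 0) + card {a\<in>?A'. f2 a = i}) + (d i - ?c i))"
      using lin_mforms[OF i'(1)] G_gen(1)[of ?A'] P(1) by (intro mforms_mult) auto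
    have "?f \<in> mforms k n (\<lambda>i. card {a\<in>A. f1 a = i} +
        (((if i = i' then 1 else 0) + card {a\<in>?A'. f2 a = i}) + (d i - ?c i)))"
      by (rule mforms_mult[OF F H])
    also have "\<dots> = mforms k n d"
    proof (rule mforms_cong)
      fix i assume "i < k"
      from c[OF this] show "card {a\<in>A. f1 a = i} +
        (((if i = i' then 1 else 0) + card {a\<in>?A'. f2 a = i}) + (d i - ?c i)) = d i" by linarith
    qed
    finally have f_in: "?f \<in> mforms k n d" .
    have "?R \<in> mforms k n (\<lambda>i. card {a\<in>A. f1 a = i} + (card {a\<in>?A'. f2 a = i} + (d i - ?c i)))"
      using F G_gen(1)[of ?A'] P(1) by (intro mforms_mult) auto
    then obtain DR where DR: "((\<lambda>t. ?R (upd2 q i' j t)) has_field_derivative DR) (at (q i' j))"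
      using mforms_deriv[OF _ i'(1) j(1)] by blast
    have Rq: "?R q \<noteq> 0" using Fq G_gen(2)[of ?A'] P(2) by simp
    have Dm: "((\<lambda>t. lin i' m (upd2 q i' j t)) has_field_derivative q i' J) (at (q i' j))"
      unfolding m using j(2) by (auto simp: upd2_apply intro!: derivative_eq_intros)
    have "((\<lambda>t. lin i' m (upd2 q i' j t) * ?R (upd2 q i' j t)) has_field_derivative q i' J * ?R q) (at (q i' j))"
      using DERIV_mult[OF Dm DR] by (simp add: mq)
    then have Df: "((\<lambda>t. ?f (upd2 q i' j t)) has_field_derivative q i' J * ?R q) (at (q i' j))"
      by (simp only: mult.assoc mult.left_commute)
    show ?thesis
    proof (rule tangent_space_not_in_span[OF k0 d q(1) A(2) f_in refl F FA H])
      show "?H a = 0" if "a \<in> A" for a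
        using G_gen(3)[of ?A' a] that ma by (cases "a \<in> Si i0") auto
      show "?f q \<noteq> 0 \<or> (\<exists>i<k. \<exists>j\<le>n i. \<exists>D. D \<noteq> 0 \<and>
          ((\<lambda>t. ?f (upd2 q i j t)) has_field_derivative D) (at (q i j)))"
        using Df i'(1) j(1) J(2) Rq no_zero_divisors by blast
    qed
  qed
qed

lemma tangent_space_few_points:
  assumes k: "2 \<le> k" and n: "\<forall>i<k. 1 \<le> n i" and d: "\<forall>i<k. d i \<noteq> 0"
    and A: "finite A" "A \<subseteq> segre_veronese k n d" "\<forall>i<k. card A \<le> d i"
    and p: "p \<in> segre_veronese k n d" "p \<notin> A"
  shows "\<not> tangent_space (multi_exponents k n d) (segre_veronese k n d) p \<subseteq>
    double_span (multi_exponents k n d) (segre_veronese k n d) A"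
proof -
  have "\<forall>a\<in>A. \<exists>y. a = pt k n d y \<and> valid k n y" using A(2) by (auto simp: segre_veronese_eq)
  then obtain g where g: "\<And>a. a \<in> A \<Longrightarrow> a = pt k n d (g a)" "\<And>a. a \<in> A \<Longrightarrow> valid k n (g a)" by metis
  obtain q where q: "p = pt k n d q" "valid k n q" using p(1) by (auto simp: segre_veronese_eq)
  let ?T = "tangent_space (multi_exponents k n d) (segre_veronese k n d)"
  have "\<not> ?T (pt k n d q) \<subseteq> cfun.span (\<Union>a\<in>g ` A. ?T (pt k n d a))"
  proof (rule few_points_not_in_span[OF k n d _ _ _ q(2)])
    show "finite (g ` A)" using A(1) by simp
    show "valid k n a" if "a \<in> g ` A" for a using that g(2) by auto
    show "card (g ` A) \<le> d i" if "i < k" for i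
      using card_image_le[OF A(1), of g] A(3) that by (auto intro: order_trans)
    show "pt k n d q \<noteq> pt k n d a" if "a \<in> g ` A" for a
      using that g(1) p(2) q(1) by (metis imageE)
  qed
  moreover have "(\<Union>a\<in>g ` A. ?T (pt k n d a)) = (\<Union>a\<in>A. ?T a)"
    using g(1) by simp
  ultimately show ?thesis unfolding double_span_def q(1) by metis
qed

lemma loci_empty:
  assumes k: "2 \<le> k" and n: "\<forall>i<k. 1 \<le> n i" and d: "\<forall>i<k. d i \<noteq> 0" and r: "\<forall>i<k. r \<le> d i"
  shows "strong_base_locus (multi_exponents k n d) (segre_veronese k n d) r = {}"
    and "positive_contact_locus (multi_exponents k n d) (segre_veronese k n d) r = {}"
proof -
  let ?E = "multi_exponents k n d" and ?X = "segre_veronese k n d"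
  have sm: "smooth_locus ?E ?X \<subseteq> ?X" by (auto simp: smooth_locus_def)
  have *: "\<not> tangent_space ?E ?X p \<subseteq> double_span ?E ?X A"
    if A: "A \<in> smooth_point_sets ?E ?X r" and p: "p \<in> smooth_locus ?E ?X" "p \<notin> A" for A p
    using A p sm r by (intro tangent_space_few_points[OF k n d]) (auto simp: smooth_point_sets_def)
  show "strong_base_locus ?E ?X r = {}"
  proof (rule ccontr)
    assume "strong_base_locus ?E ?X r \<noteq> {}"
    then obtain A p where A: "A \<in> smooth_point_sets ?E ?X r" "p \<in> smooth_locus ?E ?X - A"
      "double_span ?E ?X (A \<union> {p}) = double_span ?E ?X A" by (auto simp: strong_base_locus_def)
    have "tangent_space ?E ?X p \<subseteq> double_span ?E ?X (A \<union> {p})"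
      unfolding double_span_def using cfun.span_superset by fast
    then show False using *[OF A(1), of p] A(2,3) by simp
  qed
  show "positive_contact_locus ?E ?X r = {}"
  proof (rule ccontr)
    assume "positive_contact_locus ?E ?X r \<noteq> {}"
    then obtain A where A: "A \<in> smooth_point_sets ?E ?X r" "zariski_dim (contact_locus ?E ?X A) > 0"
      by (auto simp: positive_contact_locus_def)
    have sub: "contact_locus ?E ?X A \<subseteq> A" using *[OF A(1)] by (auto simp: contact_locus_def)
    have "finite (contact_locus ?E ?X A)"
      using sub A(1) finite_subset by (auto simp: smooth_point_sets_def)
    moreover have "contact_locus ?E ?X A \<subseteq> proj_point ` (- {0})"
      using sm segre_veronese_proj_point[of k n d] by (auto simp: contact_locus_def)
    ultimately show False using zariski_dim_finite A(2) by auto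
  qed
qed

end

theorem theorem4p10:
  fixes k r :: nat and n d :: "nat \<Rightarrow> nat"
  assumes "k \<ge> 2"
    and "\<forall>i<k. n i \<ge> 1"
    and "\<forall>i<k. d i \<ge> 1"
    and "r \<ge> 1"
  shows "(r \<ge> Min (d ` {..<k}) + 1 \<and> \<not> (k = 2 \<and> n 0 = 1 \<and> n 1 = 1 \<and> d 0 = 1 \<and> d 1 = 1) \<longrightarrow>
            strong_base_locus (multi_exponents k n d) (segre_veronese k n d) r \<noteq> {} \<and>
            positive_contact_locus (multi_exponents k n d) (segre_veronese k n d) r \<noteq> {}) \<and>
         (r \<le> Min (d ` {..<k}) \<longrightarrow>
            strong_base_locus (multi_exponents k n d) (segre_veronese k n d) r = {} \<and>
            positive_contact_locus (multi_exponents k n d) (segre_veronese k n d) r = {})"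
proof -
  have d: "\<forall>i<k. d i \<noteq> 0" using assms(3) by auto
  have k: "0 < k" using assms(1) by simp
  have Min_le: "Min (d ` {..<k}) \<le> d i" if "i < k" for i using that by (intro Min_le) auto
  have nonempty: "strong_base_locus (multi_exponents k n d) (segre_veronese k n d) r \<noteq> {} \<and>
      positive_contact_locus (multi_exponents k n d) (segre_veronese k n d) r \<noteq> {}"
    if r: "r \<ge> Min (d ` {..<k}) + 1" and exc: "\<not> (k = 2 \<and> n 0 = 1 \<and> n 1 = 1 \<and> d 0 = 1 \<and> d 1 = 1)"
  proof -
    \<comment> \<open>The line goes into a factor of minimal degree that leaves a monomial of degree
      \<open>2\<close> in the vanishing coordinates. If \<open>k = 2\<close> and both degrees are
      \<open>1\<close>, the factor must be chosen with \<open>n c >= 2\<close>, which is impossible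
      only in the excluded case.\<close>
    have "\<exists>c. c < k \<and> d c = Min (d ` {..<k}) \<and> ((\<exists>i<k. i \<noteq> c \<and> 2 \<le> d i) \<or> 2 \<le> n c \<or> 3 \<le> k)"
    proof (cases "k = 2 \<and> d 0 = 1 \<and> d 1 = 1")
      case True
      have "d ` {..<k} = {1}" using True by (auto simp: numeral_2_eq_2 lessThan_Suc)
      then have M: "Min (d ` {..<k}) = 1" by simp
      have "2 \<le> n 0 \<or> 2 \<le> n 1" using True exc assms(2) by (metis One_nat_def le_antisym lessI not_less_eq_eq numeral_2_eq_2 zero_less_numeral)
      then show ?thesis using True M by (metis one_less_numeral_iff semiring_norm(76) zero_less_numeral)
    next
      case False
      have "Min (d ` {..<k}) \<in> d ` {..<k}" using k by (intro Min_in) auto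
      then obtain c where c: "c < k" "d c = Min (d ` {..<k})" by auto
      show ?thesis
      proof (cases "3 \<le> k")
        case 3: False
        then have k2: "k = 2" using assms(1) by simp
        define i where "i = 1 - c"
        have ci: "c = 0 \<and> i = 1 \<or> c = 1 \<and> i = 0" using c(1) k2 unfolding i_def by presburger
        then have i: "i < k" "i \<noteq> c" using k2 by auto
        \<comment> \<open>If \<open>d i = 1\<close>, minimality forces \<open>d c = 1\<close>, and
          this is the case already treated.\<close>
        have "d i \<noteq> 1"
        proof
          assume "d i = 1"
          then have "d c = 1" using Min_le[OF i(1)] c d by auto
          then show False using ci False k2 \<open>d i = 1\<close> by auto
        qed
        moreover have "d i \<noteq> 0" using d i(1) by blast
        ultimately have "2 \<le> d i" by simp
        then show ?thesis using c i by blast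
      qed (use c in blast)
    qed
    then obtain c where c: "c < k" "d c = Min (d ` {..<k})"
      "(\<exists>i<k. i \<noteq> c \<and> 2 \<le> d i) \<or> 2 \<le> n c \<or> 3 \<le> k" by blast
    have line: "1 \<notin> line_coords c i" if "i \<noteq> c" for i
      using that by (simp add: line_coords_def[OF k c(1) assms(2) d])
    have line_c: "2 \<notin> line_coords c c" by (simp add: line_coords_def[OF k c(1) assms(2) d])
    define i where "i = (if c = 0 then 1 else 0 :: nat)"
    have i: "i < k" "i \<noteq> c" "1 \<le> n i" using assms(1,2) by (auto simp: i_def)
    have "low_exponents k n d c \<noteq> multi_exponents k n d"
    proof (rule low_exponents_neq[OF k c(1) assms(2) d])
      show "(\<exists>i<k. \<exists>j\<le>n i. j \<notin> line_coords c i \<and> 2 \<le> d i) \<or>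
        (\<exists>i<k. \<exists>i'<k. \<exists>j\<le>n i. \<exists>j'\<le>n i'. j \<notin> line_coords c i \<and> j' \<notin> line_coords c i' \<and> i \<noteq> i')"
        using c(3)
      proof (elim disjE)
        assume "\<exists>i<k. i \<noteq> c \<and> 2 \<le> d i"
        then show ?thesis using line assms(2) by blast
      next
        assume "2 \<le> n c"
        then show ?thesis using line[OF i(2)] line_c i c(1) by blast
      next
        assume "3 \<le> k"
        then obtain i' where i': "i' < k" "i' \<noteq> c" "i' \<noteq> i"
        proof -
          have "\<not> {..<k} \<subseteq> {c, i}" using \<open>3 \<le> k\<close> card_mono[of "{c, i}" "{..<k}"] i(2) by auto
          then show ?thesis using that by blast
        qed
        then show ?thesis using line[OF i(2)] line[OF i'(2)] i assms(2) by blast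
      qed
    qed
    then show ?thesis
      using loci_nonempty[OF k c(1) assms(2) d, of r] r c(2) by simp
  qed
  moreover have "strong_base_locus (multi_exponents k n d) (segre_veronese k n d) r = {} \<and>
      positive_contact_locus (multi_exponents k n d) (segre_veronese k n d) r = {}"
    if r: "r \<le> Min (d ` {..<k})"
    using loci_empty[OF assms(1,2) d, of r] order_trans[OF r Min_le] by blast
  ultimately show ?thesis by blast
qed

end
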